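(* Let $\Omega\subset\mathbb{R}^N$ be a bounded open Lipschitz domain. Suppose that $1\le p<N$ and $-\infty<\mu<N-p$. Then the embedding $$W^{1,p}_\mu(\Omega)\hookrightarrow L^q\Big(\Omega,\frac{dx}{|x|^s}\Big)$$ is compact if $$\begin{cases}\frac{N\mu}{N-p}\le s\le\mu+p,\\ 1\le q<p^*(s,\mu),\end{cases}\qquad\text{or}\qquad\begin{cases}s<\frac{N\mu}{N-p},\\ 1\le q<p^*.\end{cases}$$ Moreover, if $s\ge\max\{0,\frac{N\mu}{N-p}\}$ (so that the first pair of conditions on $s$ and $q$ is the one imposed), the conclusion is still valid when the open Lipschitz domain $\Omega$ is unbounded but has finite Lebesgue measure.
   Context: $N\ge2$; $p^*:=\frac{Np}{N-p}$; $p^*(s,\mu):=\frac{p(N-s)}{N-p-\mu}$. $W^{1,p}_\mu(\Omega)$ is the completion of $C_0^\infty(\Omega)$ with respect to the norm $\big(\int_\Omega\frac{|\nabla u|^p}{|x|^\mu}dx\big)^{1/p}$, and $L^q(\Omega,\frac{dx}{|x|^s})$ is the completion of $C_0^\infty(\Omega)$ with respect to the norm $\big(\int_\Omega\frac{|u|^q}{|x|^s}dx\big)^{1/q}$. *)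

theory Defs
  imports "HOL-Analysis.Analysis"
begin

subsection \<open>Test functions\<close>

definition gradient :: "(real^'n \<Rightarrow> real) \<Rightarrow> real^'n \<Rightarrow> real^'n" where
  "gradient u x = (THE D. GDERIV u x :> D)"

definition partial :: "'n \<Rightarrow> (real^'n \<Rightarrow> real) \<Rightarrow> real^'n \<Rightarrow> real" where
  "partial i u x = gradient u x $ i"

text \<open>Infinitely differentiable: every iterated partial derivative is (Frechet) differentiable
  everywhere. The empty list gives differentiability of \<open>u\<close> itself; differentiability of the
  next order gives continuity of the previous one.\<close>

definition smooth :: "(real^'n \<Rightarrow> real) \<Rightarrow> bool" where
  "smooth u \<longleftrightarrow> (\<forall>js x. fold partial js u differentiable (at x))"

text \<open>\<open>C\<^sub>0\<^sup>\<infinity>(\<Omega>)\<close>; its elements are identified with their extensions by zero to the whole space.\<close>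

definition test_functions :: "(real^'n) set \<Rightarrow> (real^'n \<Rightarrow> real) set" where
  "test_functions \<Omega> =
    {u. smooth u \<and> compact (closure {x. u x \<noteq> 0}) \<and> closure {x. u x \<noteq> 0} \<subseteq> \<Omega>}"

subsection \<open>Weighted norms and exponents\<close>

text \<open>The integrands take the value 0 at the origin, a null set. On test functions they are integrable
  whenever \<open>\<mu>\<close> and \<open>s\<close> are less than the dimension, so no default value of the integral occurs.\<close>

definition sobolev_norm :: "(real^'n) set \<Rightarrow> real \<Rightarrow> real \<Rightarrow> (real^'n \<Rightarrow> real) \<Rightarrow> real" where
  "sobolev_norm \<Omega> p \<mu> u =
    (LINT x:\<Omega>|lborel. norm (gradient u x) powr p / norm x powr \<mu>) powr (1 / p)"

definition lebesgue_norm :: "(real^'n) set \<Rightarrow> real \<Rightarrow> real \<Rightarrow> (real^'n \<Rightarrow> real) \<Rightarrow> real" where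
  "lebesgue_norm \<Omega> q s u =
    (LINT x:\<Omega>|lborel. \<bar>u x\<bar> powr q / norm x powr s) powr (1 / q)"

definition crit_exp :: "real \<Rightarrow> real \<Rightarrow> real" where
  "crit_exp N p = N * p / (N - p)"

definition weighted_crit_exp :: "real \<Rightarrow> real \<Rightarrow> real \<Rightarrow> real \<Rightarrow> real" where
  "weighted_crit_exp N p s \<mu> = p * (N - s) / (N - p - \<mu>)"

subsection \<open>Completion of a function space\<close>

text \<open>The completion of a vector space \<open>V\<close> of real-valued functions with respect to a norm \<open>nrm\<close>
  on \<open>V\<close>: Cauchy sequences in \<open>V\<close> modulo sequences with norm tending to zero. The linear
  structure acts on representatives, and the norm of a class is the limit of the norms along any
  representative.\<close>

definition cauchy_seqs :: "('a \<Rightarrow> real) set \<Rightarrow> (('a \<Rightarrow> real) \<Rightarrow> real) \<Rightarrow> (nat \<Rightarrow> 'a \<Rightarrow> real) set" where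
  "cauchy_seqs V nrm = {f. (\<forall>n. f n \<in> V) \<and>
     (\<forall>e>0. \<exists>M. \<forall>m\<ge>M. \<forall>n\<ge>M. nrm (\<lambda>x. f m x - f n x) < e)}"

definition null_rel ::
  "('a \<Rightarrow> real) set \<Rightarrow> (('a \<Rightarrow> real) \<Rightarrow> real) \<Rightarrow> (nat \<Rightarrow> 'a \<Rightarrow> real) rel" where
  "null_rel V nrm = {(f, g). f \<in> cauchy_seqs V nrm \<and> g \<in> cauchy_seqs V nrm \<and>
     (\<lambda>n. nrm (\<lambda>x. f n x - g n x)) \<longlonglongrightarrow> 0}"

definition completion ::
  "('a \<Rightarrow> real) set \<Rightarrow> (('a \<Rightarrow> real) \<Rightarrow> real) \<Rightarrow> (nat \<Rightarrow> 'a \<Rightarrow> real) set set" where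
  "completion V nrm = cauchy_seqs V nrm // null_rel V nrm"

definition compl_norm :: "(('a \<Rightarrow> real) \<Rightarrow> real) \<Rightarrow> (nat \<Rightarrow> 'a \<Rightarrow> real) set \<Rightarrow> real" where
  "compl_norm nrm X = (THE r. \<forall>f\<in>X. (\<lambda>n. nrm (f n)) \<longlonglongrightarrow> r)"

text \<open>The linear combination \<open>a X + b Y\<close> of two classes.\<close>

definition compl_lincomb ::
  "('a \<Rightarrow> real) set \<Rightarrow> (('a \<Rightarrow> real) \<Rightarrow> real) \<Rightarrow> real \<Rightarrow> (nat \<Rightarrow> 'a \<Rightarrow> real) set \<Rightarrow>
   real \<Rightarrow> (nat \<Rightarrow> 'a \<Rightarrow> real) set \<Rightarrow> (nat \<Rightarrow> 'a \<Rightarrow> real) set" where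
  "compl_lincomb V nrm a X b Y =
    (\<Union>f\<in>X. \<Union>g\<in>Y. null_rel V nrm `` {\<lambda>n x. a * f n x + b * g n x})"

definition compl_dist ::
  "('a \<Rightarrow> real) set \<Rightarrow> (('a \<Rightarrow> real) \<Rightarrow> real) \<Rightarrow>
   (nat \<Rightarrow> 'a \<Rightarrow> real) set \<Rightarrow> (nat \<Rightarrow> 'a \<Rightarrow> real) set \<Rightarrow> real" where
  "compl_dist V nrm X Y = compl_norm nrm (compl_lincomb V nrm 1 X (- 1) Y)"

subsection \<open>Compact embeddings\<close>

text \<open>The map into the completion for \<open>nrm\<close> induced by the identity of \<open>V\<close>: it sends a class
  of sequences that are Cauchy for a stronger norm to the class of the same sequences.\<close>

definition induced_map ::
  "('a \<Rightarrow> real) set \<Rightarrow> (('a \<Rightarrow> real) \<Rightarrow> real) \<Rightarrow>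
   (nat \<Rightarrow> 'a \<Rightarrow> real) set \<Rightarrow> (nat \<Rightarrow> 'a \<Rightarrow> real) set" where
  "induced_map V nrm X = null_rel V nrm `` X"

definition compact_embedding ::
  "('a \<Rightarrow> real) set \<Rightarrow> (('a \<Rightarrow> real) \<Rightarrow> real) \<Rightarrow> (('a \<Rightarrow> real) \<Rightarrow> real) \<Rightarrow> bool" where
  "compact_embedding V nrm1 nrm2 \<longleftrightarrow>
    (let E1 = completion V nrm1; E2 = completion V nrm2; \<iota> = induced_map V nrm2 in
      \<iota> \<in> E1 \<rightarrow> E2 \<and> inj_on \<iota> E1 \<and>
      (\<forall>X\<in>E1. \<forall>Y\<in>E1. \<forall>a b.
         \<iota> (compl_lincomb V nrm1 a X b Y) = compl_lincomb V nrm2 a (\<iota> X) b (\<iota> Y)) \<and>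
      (\<exists>C. \<forall>X\<in>E1. compl_norm nrm2 (\<iota> X) \<le> C * compl_norm nrm1 X) \<and>
      (\<forall>X :: nat \<Rightarrow> (nat \<Rightarrow> 'a \<Rightarrow> real) set.
         (\<forall>k. X k \<in> E1) \<and> (\<exists>B. \<forall>k. compl_norm nrm1 (X k) \<le> B) \<longrightarrow>
         (\<exists>r :: nat \<Rightarrow> nat. strict_mono r \<and>
           (\<exists>Y\<in>E2. (\<lambda>k. compl_dist V nrm2 (\<iota> (X (r k))) Y) \<longlonglongrightarrow> 0))))"

subsection \<open>Lipschitz domains\<close>

text \<open>Near each boundary point \<open>p\<close>, in a cylinder with axis direction \<open>\<nu>\<close>, the set is the region
  strictly below the graph of a Lipschitz function \<open>g\<close> over the hyperplane through \<open>p\<close> orthogonal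
  to \<open>\<nu>\<close>, and its boundary is that graph. Connectedness is not part of the definition, and the
  data \<open>r\<close>, \<open>h\<close>, \<open>L\<close> may depend on \<open>p\<close>.\<close>

definition lipschitz_domain :: "(real^'n) set \<Rightarrow> bool" where
  "lipschitz_domain \<Omega> \<longleftrightarrow> open \<Omega> \<and>
    (\<forall>p\<in>frontier \<Omega>. \<exists>\<nu> r h L g. norm \<nu> = 1 \<and> r > 0 \<and> h > 0 \<and>
       L-lipschitz_on {x. (x - p) \<bullet> \<nu> = 0} g \<and>
       (\<forall>x\<in>ball p r. \<forall>y::real. (x - p) \<bullet> \<nu> = 0 \<and> \<bar>y\<bar> < h \<longrightarrow>
          (x + y *\<^sub>R \<nu> \<in> \<Omega> \<longleftrightarrow> y < g x) \<and>
          (x + y *\<^sub>R \<nu> \<in> frontier \<Omega> \<longleftrightarrow> y = g x)))"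

end

theory Submission
  imports Defs "HOL-Complex_Analysis.Great_Picard" "HOL-Library.Diagonal_Subsequence"
begin

text \<open>
  Write \<open>n\<close> for the dimension and \<open>p\<^sup>* = n p / (n - p)\<close>. A completion embeds compactly as soon as
  two facts hold for test functions (\<open>compact_embeddingI\<close>): a sequence that is bounded in the
  Sobolev norm has a subsequence that is Cauchy in the Lebesgue norm, and a Sobolev-Cauchy sequence
  that tends to zero in the Lebesgue norm tends to zero in the Sobolev norm. The second fact
  is injectivity. The first one already contains continuity of the embedding, by scaling.

  The weight of the gradient is removed by the substitution \<open>v = |x| powr (- \<mu> / p) * u\<close>. Hardy's
  inequality, used for \<open>u\<close> with weight \<open>\<mu>\<close> and for \<open>v\<close> without weight, shows that the Sobolev norm
  of \<open>u\<close> is equivalent to the unweighted \<open>L\<^sup>p\<close> norm of \<open>\<nabla>v\<close>, although \<open>v\<close> is in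
  general singular at the origin. In dimension at least two almost every segment avoids the
  origin, so \<open>v\<close> obeys the translation estimate
  \<open>\<integral> |v (x + y) - v x| powr p \<le> |y| powr p * \<integral> |\<nabla>v| powr p\<close>
  (\<open>translation_powr_bound\<close>). Everything else is read off from estimates of this kind.

  Sobolev's inequality comes from a version localised to a range of values of \<open>v\<close>: if
  \<open>m t\<close> is the measure of \<open>{|v| > t}\<close>, then in a ball of measure \<open>2 * m t\<close> around a point with \<open>|v| > 2 * t\<close>
  at least half of the points have \<open>|v| \<le> t\<close>, and every such pair is paid for by the gradient on
  \<open>{t \<le> |v| \<le> 2 * t}\<close>. This bounds \<open>m (2 * t)\<close> by a power of \<open>m t\<close> (\<open>superlevel_halving\<close>), and
  integration over \<open>t\<close> gives \<open>sobolev_inequality\<close>. Hardy's inequality compares \<open>w x\<close> with \<open>w (2 * x)\<close>.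
  A pointwise interpolation between Sobolev for \<open>v\<close> and Hardy for \<open>u\<close> yields the
  Caffarelli-Kohn-Nirenberg bound at the critical exponent.

  For compactness, the translation estimate makes Kolmogorov's criterion applicable to the \<open>v\<close>'s
  and gives subsequences that are almost Cauchy in \<open>L\<^sup>p\<close> on balls. On an annulus the weights are
  harmless. Near the origin and far away the weight \<open>|x| powr (- s)\<close> has small integral over the
  domain, and the strict inequality between \<open>q\<close> and the critical exponent turns the critical bound
  into uniform integrability. For closability, Fatou's lemma passes the translation estimate to an
  almost everywhere limit, and dividing by the length of the translation recovers the gradient.

  If \<open>s < n * \<mu> / (n - p)\<close>, then on a bounded domain the weight is dominated by the one with
  \<open>s = n * \<mu> / (n - p)\<close>, whose critical exponent is \<open>p\<^sup>*\<close>.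
\<close>

section \<open>Power inequalities and integration on Euclidean space\<close>

lemma powr_above_tangent:
  fixes p d r :: real
  assumes p: "1 \<le> p" and d: "0 < d" and r: "0 \<le> r"
  shows "d powr p + p * d powr (p - 1) * (r - d) \<le> r powr p"
proof (cases "r = 0")
  case True
  have "d powr (p - 1) * d = d powr p"
    using d by (simp add: powr_mult_base mult.commute)
  then have "p * d powr (p - 1) * (r - d) = - (p * d powr p)"
    using True by (metis diff_0 mult.assoc mult_minus_right)
  moreover have "1 * d powr p \<le> p * d powr p"
    using p by (intro mult_right_mono) auto
  moreover have "r powr p = 0" using True by simp
  ultimately show ?thesis by linarith
next
  case False
  then have "r > 0" using r by simp
  have "(\<lambda>x. x powr p) r - (\<lambda>x. x powr p) d \<ge> (p * d powr (p - 1)) * (r - d)"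
    using d \<open>r > 0\<close>
    by (intro convex_on_imp_above_tangent[OF powr_convex[OF p]])
       (auto simp: interior_open intro!: derivative_eq_intros)
  then show ?thesis by simp
qed

text \<open>Convexity of the power function with free weights: a weight \<open>l\<close> close to one keeps the
  constant in front of \<open>A\<close> close to one. With \<open>l\<close> proportional to the norms it gives
  Minkowski's inequality.\<close>

lemma powr_add_le_weighted:
  fixes p l A B :: real
  assumes p: "1 \<le> p" and l: "0 < l" "l < 1" and AB: "0 \<le> A" "0 \<le> B"
  shows "(A + B) powr p \<le> l powr (1 - p) * A powr p + (1 - l) powr (1 - p) * B powr p"
proof (cases "A + B = 0")
  case True
  then show ?thesis using AB by (simp add: add_nonneg_eq_0_iff)
next
  case False
  define d where "d = A + B"
  have d: "d > 0" using False AB by (simp add: d_def)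
  have key: "k * (X / k) powr p = k powr (1 - p) * X powr p" if "k > 0" "X \<ge> 0" for k X :: real
    using that by (simp add: powr_divide powr_diff)
  have "l * (d powr p + p * d powr (p - 1) * (A / l - d))
      + (1 - l) * (d powr p + p * d powr (p - 1) * (B / (1 - l) - d))
     = d powr p + p * d powr (p - 1) * (l * (A / l) + (1 - l) * (B / (1 - l)) - d)"
    by (simp only: algebra_simps)
  also have "\<dots> = d powr p"
    using l by (simp add: d_def)
  finally have "d powr p = l * (d powr p + p * d powr (p - 1) * (A / l - d))
      + (1 - l) * (d powr p + p * d powr (p - 1) * (B / (1 - l) - d))" ..
  also have "\<dots> \<le> l * (A / l) powr p + (1 - l) * (B / (1 - l)) powr p"
    using l AB d p by (intro add_mono mult_left_mono powr_above_tangent) auto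
  also have "\<dots> = l powr (1 - p) * A powr p + (1 - l) powr (1 - p) * B powr p"
    using l AB by (simp add: key)
  finally show ?thesis by (simp add: d_def)
qed

lemma powr_add_le_double:
  fixes p A B :: real
  assumes p: "1 \<le> p" and AB: "0 \<le> A" "0 \<le> B"
  shows "(A + B) powr p \<le> 2 powr p * (A powr p + B powr p)"
proof -
  have "(A + B) powr p \<le> (1/2) powr (1 - p) * A powr p + (1 - 1/2) powr (1 - p) * B powr p"
    by (rule powr_add_le_weighted) (use assms in auto)
  also have "(1/2::real) powr (1 - p) = 2 powr (p - 1)"
    by (simp add: powr_divide powr_diff)
  also have "2 powr (p - 1) * A powr p + (1 - 1/2) powr (1 - p) * B powr p
      = 2 powr (p - 1) * (A powr p + B powr p)"
    by (simp add: powr_divide powr_diff algebra_simps)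
  also have "\<dots> \<le> 2 powr p * (A powr p + B powr p)"
    by (intro mult_right_mono) auto
  finally show ?thesis .
qed

text \<open>Jensen's inequality, from integrating the tangent line of the power function at the mean
  value. For a function that is not integrable the left side is 0, the default value of the
  integral.\<close>

lemma jensen_powr:
  fixes f :: "'a \<Rightarrow> real"
  assumes p: "1 \<le> p" and f[measurable]: "f \<in> borel_measurable M" and S[measurable]: "S \<in> sets M"
    and c: "emeasure M S = ennreal c" "0 < c"
  shows "ennreal (\<bar>LINT x:S|M. f x\<bar> powr p)
      \<le> ennreal (c powr (p - 1)) * (\<integral>\<^sup>+x. ennreal (\<bar>f x\<bar> powr p) * indicator S x \<partial>M)"
proof (cases "set_integrable M S f \<and> (LINT x:S|M. f x) \<noteq> 0
    \<and> (\<integral>\<^sup>+x. ennreal (\<bar>f x\<bar> powr p) * indicator S x \<partial>M) < top")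
  case False
  then consider "\<not> set_integrable M S f" | "(LINT x:S|M. f x) = 0"
    | "(\<integral>\<^sup>+x. ennreal (\<bar>f x\<bar> powr p) * indicator S x \<partial>M) = top"
    by (auto simp del: not_gr_zero simp: less_top[symmetric])
  then show ?thesis
  proof cases
    case 1
    then have "(LINT x:S|M. f x) = 0"
      unfolding set_integrable_def set_lebesgue_integral_def by (rule not_integrable_integral_eq)
    then show ?thesis by simp
  next
    case 3
    then show ?thesis using c by (simp add: ennreal_mult_top)
  qed simp
next
  case True
  define d where "d = \<bar>LINT x:S|M. f x\<bar> / c"
  have d: "d > 0" using True c by (simp add: d_def)
  define J where "J = (LINT x:S|M. \<bar>f x\<bar>)"
  have fint: "set_integrable M S (\<lambda>x. \<bar>f x\<bar>)"
    using True set_integrable_abs by blast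
  have cd: "c * d \<le> J"
    using set_integral_norm_bound[of M S f] True c by (simp add: d_def J_def)
  obtain X where X: "X \<ge> 0" "(\<integral>\<^sup>+x. ennreal (\<bar>f x\<bar> powr p) * indicator S x \<partial>M) = ennreal X"
    using True by (cases "\<integral>\<^sup>+x. ennreal (\<bar>f x\<bar> powr p) * indicator S x \<partial>M") auto
  have J: "(\<integral>\<^sup>+x. ennreal \<bar>f x\<bar> * indicator S x \<partial>M) = ennreal J"
  proof -
    have "(\<integral>\<^sup>+x. ennreal \<bar>f x\<bar> * indicator S x \<partial>M) = (\<integral>\<^sup>+x. ennreal (indicator S x *\<^sub>R \<bar>f x\<bar>) \<partial>M)"
      by (intro nn_integral_cong) (auto split: split_indicator)
    also have "\<dots> = ennreal (\<integral>x. indicator S x *\<^sub>R \<bar>f x\<bar> \<partial>M)"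
      using fint unfolding set_integrable_def by (intro nn_integral_eq_integral) (auto split: split_indicator)
    finally show ?thesis by (simp add: J_def set_lebesgue_integral_def)
  qed
  have dp: "d powr (p - 1) * d = d powr p"
    using d by (simp add: powr_mult_base mult.commute)
  have "(\<integral>\<^sup>+x. (ennreal (d powr p) * indicator S x + ennreal (p * d powr (p - 1)) * (ennreal \<bar>f x\<bar> * indicator S x)) \<partial>M)
    \<le> (\<integral>\<^sup>+x. (ennreal (\<bar>f x\<bar> powr p) * indicator S x + ennreal (p * d powr p) * indicator S x) \<partial>M)"
  proof (intro nn_integral_mono)
    fix x
    have "d powr p + p * d powr (p - 1) * \<bar>f x\<bar> \<le> \<bar>f x\<bar> powr p + p * d powr p"
    proof -
      have "p * d powr (p - 1) * d = p * d powr p" using dp by (simp add: mult.assoc)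
      then show ?thesis
        using powr_above_tangent[OF p d, of "\<bar>f x\<bar>"] unfolding right_diff_distrib by linarith
    qed
    then show "ennreal (d powr p) * indicator S x + ennreal (p * d powr (p - 1)) * (ennreal \<bar>f x\<bar> * indicator S x)
      \<le> ennreal (\<bar>f x\<bar> powr p) * indicator S x + ennreal (p * d powr p) * indicator S x"
      using p by (auto split: split_indicator simp flip: ennreal_plus ennreal_mult)
  qed
  moreover have J0: "J \<ge> 0"
    using cd c d by (meson less_imp_le mult_nonneg_nonneg order_trans)
  ultimately have "ennreal (d powr p) * ennreal c + ennreal (p * d powr (p - 1)) * ennreal J
      \<le> ennreal X + ennreal (p * d powr p) * ennreal c"
    using c X J by (simp add: nn_integral_add nn_integral_cmult)
  then have "d powr p * c + p * d powr (p - 1) * J \<le> X + p * d powr p * c"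
    using c X p J0 by (simp flip: ennreal_plus ennreal_mult add: ennreal_le_iff)
  moreover have "p * d powr (p - 1) * (c * d) \<le> p * d powr (p - 1) * J"
    using cd p by (intro mult_left_mono) auto
  moreover have "p * d powr (p - 1) * (c * d) = p * d powr p * c"
    using dp by (simp add: algebra_simps)
  ultimately have "d powr p * c \<le> X" by linarith
  then have "c powr (p - 1) * (d powr p * c) \<le> c powr (p - 1) * X"
    by (intro mult_left_mono) auto
  moreover have "c powr (p - 1) * (d powr p * c) = \<bar>LINT x:S|M. f x\<bar> powr p"
    using c by (simp add: d_def powr_divide powr_diff)
  ultimately show ?thesis
    using X c by (simp flip: ennreal_mult add: ennreal_le_iff)
qed

text \<open>The Jensen factor \<open>(b - a) powr (p - 1)\<close> is at most one on short intervals, so it can be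
  dropped.\<close>

lemma derivative_powr_bound:
  fixes f f' :: "real \<Rightarrow> real"
  assumes p: "1 \<le> p" and ab: "a \<le> b" "b - a \<le> 1"
    and der: "\<And>x. a \<le> x \<Longrightarrow> x \<le> b \<Longrightarrow> (f has_real_derivative f' x) (at x)"
    and cont: "continuous_on {a..b} f'"
  shows "ennreal (\<bar>f b - f a\<bar> powr p) \<le> (\<integral>\<^sup>+x. ennreal (\<bar>f' x\<bar> powr p) * indicator {a..b} x \<partial>lborel)"
proof (cases "a = b")
  case False
  then have ab': "a < b" using ab by simp
  define g where "g = (\<lambda>x. indicator {a..b} x *\<^sub>R f' x)"
  have [measurable]: "g \<in> borel_measurable borel"
    unfolding g_def using cont by (intro borel_measurable_continuous_on_indicator) auto
  have "(\<integral>x. indicator {a..b} x *\<^sub>R f' x \<partial>lborel) = f b - f a"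
    using ab der cont
    by (intro integral_FTC_Icc)
       (auto simp: has_real_derivative_iff_has_vector_derivative intro: has_vector_derivative_at_within)
  then have int: "(LINT x:{a..b}|lborel. g x) = f b - f a"
    unfolding set_lebesgue_integral_def g_def by (simp add: indicator_inter_arith[symmetric] mult.assoc[symmetric])
  have "ennreal (\<bar>f b - f a\<bar> powr p)
      \<le> ennreal ((b - a) powr (p - 1)) * (\<integral>\<^sup>+x. ennreal (\<bar>g x\<bar> powr p) * indicator {a..b} x \<partial>lborel)"
    unfolding int[symmetric] by (rule jensen_powr) (use p ab' in auto)
  also have "\<dots> \<le> 1 * (\<integral>\<^sup>+x. ennreal (\<bar>g x\<bar> powr p) * indicator {a..b} x \<partial>lborel)"
    using p ab' ab by (intro mult_right_mono) (auto simp: powr_le1)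
  also have "\<dots> = (\<integral>\<^sup>+x. ennreal (\<bar>f' x\<bar> powr p) * indicator {a..b} x \<partial>lborel)"
    by (auto intro!: nn_integral_cong simp: g_def split: split_indicator)
  finally show ?thesis .
qed simp

lemma nn_integral_lincomb:
  assumes "f \<in> borel_measurable M" "g \<in> borel_measurable M"
  shows "(\<integral>\<^sup>+x. (a * f x + b * g x) \<partial>M) = a * (\<integral>\<^sup>+x. f x \<partial>M) + b * (\<integral>\<^sup>+x. g x \<partial>M)"
  using assms by (simp add: nn_integral_add nn_integral_cmult)

lemma nn_integral_translate:
  fixes f :: "'a::euclidean_space \<Rightarrow> ennreal"
  assumes [measurable]: "f \<in> borel_measurable borel"
  shows "(\<integral>\<^sup>+x. f (x + y) \<partial>lborel) = (\<integral>\<^sup>+x. f x \<partial>lborel)"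
proof -
  have "(\<integral>\<^sup>+x. f x \<partial>lborel) = (\<integral>\<^sup>+x. f x \<partial>distr lborel borel ((+) y))"
    by (simp add: lborel_distr_plus)
  also have "\<dots> = (\<integral>\<^sup>+x. f (y + x) \<partial>lborel)" by (subst nn_integral_distr) auto
  finally show ?thesis by (simp add: add.commute)
qed

lemma nn_integral_dilate:
  fixes f :: "'a::euclidean_space \<Rightarrow> ennreal"
  assumes [measurable]: "f \<in> borel_measurable borel" and c: "c > 0"
  shows "(\<integral>\<^sup>+x. f (c *\<^sub>R x) \<partial>lborel) = ennreal (c powr (- real DIM('a))) * (\<integral>\<^sup>+x. f x \<partial>lborel)"
proof -
  have *: "(\<integral>\<^sup>+x. f x \<partial>lborel) = ennreal (c ^ DIM('a)) * (\<integral>\<^sup>+x. f (c *\<^sub>R x) \<partial>lborel)"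
    using c by (subst lborel_affine[of c 0]) (auto simp: nn_integral_density nn_integral_distr nn_integral_cmult)
  show ?thesis
    unfolding * using c
    by (simp add: mult.assoc[symmetric] ennreal_mult[symmetric] powr_minus powr_realpow)
qed

lemma emeasure_ball_powr:
  assumes r: "0 < r"
  shows "emeasure lborel (ball (0::'a::euclidean_space) r) = ennreal (r powr real DIM('a) * measure lborel (ball (0::'a) 1))"
proof -
  have B: "emeasure lborel (ball (0::'a) 1) = ennreal (measure lborel (ball (0::'a) 1))"
    by (intro emeasure_eq_ennreal_measure) (use emeasure_lborel_ball_finite[of "0::'a" 1] in auto)
  have "emeasure lborel (ball (0::'a) r) = (\<integral>\<^sup>+x. indicator (ball (0::'a) 1) ((1 / r) *\<^sub>R x) \<partial>lborel)"
    by (subst nn_integral_indicator[symmetric], simp, rule nn_integral_cong)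
       (use r in \<open>auto split: split_indicator simp: field_simps\<close>)
  also have "\<dots> = ennreal ((1 / r) powr (- real DIM('a))) * emeasure lborel (ball (0::'a) 1)"
    by (subst nn_integral_dilate) (use r in \<open>auto intro!: borel_measurable_indicator\<close>)
  also have "(1 / r) powr (- real DIM('a)) = r powr real DIM('a)"
    using r by (simp add: powr_divide powr_minus)
  finally show ?thesis by (simp add: B ennreal_mult)
qed

text \<open>Cut the unit ball into dyadic shells. On the shell of radius about \<open>2 powr - k\<close> the
  integrand is about \<open>2 powr (b * k)\<close> and the volume about \<open>2 powr (- k * DIM)\<close>, so the
  integral is dominated by a geometric series.\<close>

lemma nn_integral_norm_powr_ball_finite:
  assumes b: "b < real DIM('a)"
  shows "(\<integral>\<^sup>+x. ennreal (norm x powr (- b)) * indicator (cball 0 R) (x::'a::euclidean_space) \<partial>lborel) < \<infinity>"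
proof (cases "b \<le> 0")
  case True
  have "(\<integral>\<^sup>+x. ennreal (norm x powr (- b)) * indicator (cball 0 R) (x::'a) \<partial>lborel)
     \<le> (\<integral>\<^sup>+x. ennreal (\<bar>R\<bar> powr (- b)) * indicator (cball 0 R) (x::'a) \<partial>lborel)"
    using True by (intro nn_integral_mono) (auto split: split_indicator intro!: ennreal_leI powr_mono2)
  also have "\<dots> < \<infinity>"
    using emeasure_lborel_cball_finite[of "0::'a" R]
    by (simp add: nn_integral_cmult_indicator ennreal_mult_less_top)
  finally show ?thesis .
next
  case False
  then have b0: "b > 0" by simp
  define B where "B = measure lborel (ball (0::'a) 1)"
  have ball: "emeasure lborel (ball (0::'a) (2 powr - real k)) = ennreal (B * (2 powr (- real DIM('a))) ^ k)" for k :: nat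
  proof -
    have "(2 powr - real k) powr real DIM('a) = (2 powr (- real DIM('a))) ^ k"
      by (subst powr_realpow[symmetric]) (auto simp: powr_powr mult.commute)
    then show ?thesis by (simp add: emeasure_ball_powr B_def mult.commute del: powr_powr)
  qed
  have pt: "ennreal (norm x powr (- b)) * indicator (cball 0 R) x
      \<le> indicator (cball 0 R) x + (\<Sum>k. ennreal (2 powr (b * (real k + 1))) * indicator (ball 0 (2 powr - real k)) x)"
    for x :: 'a
  proof (cases "norm x < 1 \<and> x \<noteq> 0")
    case False
    then have "norm x powr (- b) \<le> 1"
      using b0 by (cases "x = 0") (auto simp: powr_minus field_simps intro!: ge_one_powr_ge_zero)
    then have "ennreal (norm x powr (- b)) \<le> ennreal 1" by (intro ennreal_leI)
    then show ?thesis by (auto split: split_indicator intro: add_increasing2)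
  next
    case True
    define t where "t = - log 2 (norm x)"
    \<comment> \<open>The index of the shell that contains \<open>x\<close>; the ceiling keeps \<open>k < t\<close> strict, since the balls are open.\<close>
    define k where "k = nat (\<lceil>t\<rceil> - 1)"
    have t0: "t > 0" using True by (simp add: t_def)
    have k: "real k < t" "t \<le> real k + 1" using t0 unfolding k_def by linarith+
    have nx: "norm x = 2 powr (- t)" using True by (simp add: t_def)
    have "norm x powr (- b) = 2 powr (b * t)" by (simp add: nx powr_powr mult.commute)
    also have "\<dots> \<le> 2 powr (b * (real k + 1))" using k b0 by simp
    finally have "ennreal (norm x powr (- b)) \<le> ennreal (2 powr (b * (real k + 1))) * indicator (ball 0 (2 powr - real k)) x"
      using k nx by (simp add: ennreal_leI)
    also have "\<dots> \<le> (\<Sum>k. ennreal (2 powr (b * (real k + 1))) * indicator (ball 0 (2 powr - real k)) x)"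
    proof -
      have "g k \<le> suminf g" for g :: "nat \<Rightarrow> ennreal"
        using sum_le_suminf[of g "{k}"] by simp
      then show ?thesis .
    qed
    finally show ?thesis by (auto split: split_indicator intro: add_increasing)
  qed
  have "(\<integral>\<^sup>+x. ennreal (norm x powr (- b)) * indicator (cball 0 R) (x::'a) \<partial>lborel)
    \<le> (\<integral>\<^sup>+x. (indicator (cball 0 R) x + (\<Sum>k. ennreal (2 powr (b * (real k + 1))) * indicator (ball (0::'a) (2 powr - real k)) x)) \<partial>lborel)"
    by (intro nn_integral_mono pt)
  also have "\<dots> = emeasure lborel (cball (0::'a) R) + (\<Sum>k. ennreal (2 powr (b * (real k + 1))) * ennreal (B * (2 powr (- real DIM('a))) ^ k))"
  proof -
    have [measurable]: "ball (0::'a) r \<in> sets borel" "cball (0::'a) r \<in> sets borel" for r by auto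
    show ?thesis
      by (subst nn_integral_add, measurable, subst nn_integral_suminf, measurable)
         (simp add: nn_integral_cmult_indicator ball)
  qed
  also have "(\<lambda>k. ennreal (2 powr (b * (real k + 1))) * ennreal (B * (2 powr (- real DIM('a))) ^ k))
     = (\<lambda>k. ennreal (2 powr b * B * (2 powr (b - real DIM('a))) ^ k))"
  proof
    fix k
    have "2 powr (b * (real k + 1)) = 2 powr b * (2 powr b) ^ k"
      by (subst powr_realpow[symmetric]) (auto simp: powr_powr powr_add[symmetric] algebra_simps)
    moreover have "2 powr (b - real DIM('a)) = 2 powr b * 2 powr (- real DIM('a))"
      by (simp add: powr_add[symmetric])
    ultimately show "ennreal (2 powr (b * (real k + 1))) * ennreal (B * (2 powr (- real DIM('a))) ^ k)
       = ennreal (2 powr b * B * (2 powr (b - real DIM('a))) ^ k)"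
      by (simp add: ennreal_mult[symmetric] B_def power_mult_distrib algebra_simps)
  qed
  also have "(\<Sum>k. ennreal (2 powr b * B * (2 powr (b - real DIM('a))) ^ k)) < top"
  proof -
    have "2 powr (b - real DIM('a)) < 2 powr 0" using b by (intro powr_less_mono) auto
    then have "summable (\<lambda>k. 2 powr b * B * (2 powr (b - real DIM('a))) ^ k)"
      by (intro summable_mult summable_geometric) auto
    then show ?thesis by (subst suminf_ennreal2) (auto simp: B_def)
  qed
  finally show ?thesis
    using emeasure_lborel_cball_finite[of "0::'a" R] by simp
qed

section \<open>Functions differentiable away from the origin\<close>

text \<open>A smooth function times a power of the norm belongs to this class, though it is in
  general singular at the origin.\<close>

definition punctured_C1 :: "('a::euclidean_space \<Rightarrow> real) \<Rightarrow> ('a \<Rightarrow> 'a) \<Rightarrow> bool" where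
  "punctured_C1 v v' \<longleftrightarrow> (\<forall>x. x \<noteq> 0 \<longrightarrow> GDERIV v x :> v' x) \<and> continuous_on (- {0}) v'"

lemma punctured_C1_continuous_on:
  assumes "punctured_C1 v v'"
  shows "continuous_on (- {0}) v"
proof (intro continuous_at_imp_continuous_on ballI)
  fix x :: 'a assume "x \<in> - {0}"
  then have "GDERIV v x :> v' x" using assms by (simp add: punctured_C1_def)
  then show "isCont v x" unfolding gderiv_def by (rule has_derivative_continuous)
qed

lemma punctured_C1_measurable:
  assumes "punctured_C1 v v'"
  shows "v \<in> borel_measurable borel" "v' \<in> borel_measurable borel"
proof -
  have *: "continuous_on (- {0}) v" "continuous_on (- {0}) v'"
    using assms punctured_C1_continuous_on[OF assms] by (auto simp: punctured_C1_def)
  show "v \<in> borel_measurable borel"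
    by (rule borel_measurable_continuous_countable_exceptions[of "{0}"]) (use * in auto)
  show "v' \<in> borel_measurable borel"
    by (rule borel_measurable_continuous_countable_exceptions[of "{0}"]) (use * in auto)
qed

lemma segment_powr_bound:
  assumes v: "punctured_C1 v v'" and p: "1 \<le> p" and ab: "0 \<le> a" "a \<le> b" "b \<le> 1"
    and avoid: "\<And>t. t \<in> {a..b} \<Longrightarrow> x + t *\<^sub>R y \<noteq> 0"
  shows "ennreal (\<bar>v (x + b *\<^sub>R y) - v (x + a *\<^sub>R y)\<bar> powr p)
    \<le> ennreal (norm y powr p) * (\<integral>\<^sup>+t. ennreal (norm (v' (x + t *\<^sub>R y)) powr p) * indicator {a..b} t \<partial>lborel)"
proof -
  note [measurable] = punctured_C1_measurable[OF v]
  have "ennreal (\<bar>v (x + b *\<^sub>R y) - v (x + a *\<^sub>R y)\<bar> powr p)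
     \<le> (\<integral>\<^sup>+t. ennreal (\<bar>y \<bullet> v' (x + t *\<^sub>R y)\<bar> powr p) * indicator {a..b} t \<partial>lborel)"
  proof (rule derivative_powr_bound[OF p, where f = "\<lambda>t. v (x + t *\<^sub>R y)"])
    fix t assume t: "a \<le> t" "t \<le> b"
    have "(v has_derivative (\<lambda>h. h \<bullet> v' (x + t *\<^sub>R y))) (at (x + t *\<^sub>R y))"
      using v avoid t by (auto simp: punctured_C1_def gderiv_def)
    moreover have "((\<lambda>t. x + t *\<^sub>R y) has_derivative (\<lambda>h. h *\<^sub>R y)) (at t)"
      by (auto intro!: derivative_eq_intros)
    ultimately have "((\<lambda>t. v (x + t *\<^sub>R y)) has_derivative (\<lambda>h. (h *\<^sub>R y) \<bullet> v' (x + t *\<^sub>R y))) (at t)"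
      using has_derivative_compose by fast
    then show "((\<lambda>t. v (x + t *\<^sub>R y)) has_real_derivative y \<bullet> v' (x + t *\<^sub>R y)) (at t)"
    proof -
      have "(\<lambda>h. (h *\<^sub>R y) \<bullet> v' (x + t *\<^sub>R y)) = (*) (y \<bullet> v' (x + t *\<^sub>R y))"
        by (rule ext) (simp add: mult.commute)
      with \<open>((\<lambda>t. v (x + t *\<^sub>R y)) has_derivative _) (at t)\<close> show ?thesis
        unfolding has_field_derivative_def by metis
    qed
  next
    have "continuous_on (- {0}) v'" using v by (simp add: punctured_C1_def)
    then have "continuous_on {a..b} (\<lambda>t. v' (x + t *\<^sub>R y))"
    proof (rule continuous_on_compose2)
      show "(\<lambda>t. x + t *\<^sub>R y) ` {a..b} \<subseteq> - {0}"
      proof (rule image_subsetI)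
        fix t assume "t \<in> {a..b}"
        from avoid[OF this] show "x + t *\<^sub>R y \<in> - {0}" by simp
      qed
    qed (intro continuous_intros)
    then show "continuous_on {a..b} (\<lambda>t. y \<bullet> v' (x + t *\<^sub>R y))"
      by (intro continuous_intros)
  qed (use ab in auto)
  also have "\<dots> \<le> (\<integral>\<^sup>+t. ennreal (norm y powr p) * (ennreal (norm (v' (x + t *\<^sub>R y)) powr p) * indicator {a..b} t) \<partial>lborel)"
  proof (intro nn_integral_mono)
    fix t
    have "\<bar>y \<bullet> v' (x + t *\<^sub>R y)\<bar> powr p \<le> (norm y * norm (v' (x + t *\<^sub>R y))) powr p"
      using p by (intro powr_mono2 Cauchy_Schwarz_ineq2) auto
    then show "ennreal (\<bar>y \<bullet> v' (x + t *\<^sub>R y)\<bar> powr p) * indicator {a..b} t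
       \<le> ennreal (norm y powr p) * (ennreal (norm (v' (x + t *\<^sub>R y)) powr p) * indicator {a..b} t)"
      by (auto split: split_indicator simp: powr_mult ennreal_mult[symmetric] intro!: ennreal_leI)
  qed
  also have "\<dots> = ennreal (norm y powr p) * (\<integral>\<^sup>+t. ennreal (norm (v' (x + t *\<^sub>R y)) powr p) * indicator {a..b} t \<partial>lborel)"
    by (rule nn_integral_cmult) measurable
  finally show ?thesis .
qed

text \<open>A bad starting point lies on the line spanned by \<open>y\<close>, which is a null set because the
  dimension is at least two.\<close>

lemma AE_segment_avoids_origin:
  fixes y :: "'a::euclidean_space"
  assumes "2 \<le> DIM('a)"
  shows "AE x in lborel. \<forall>t\<in>{0..1}. x + t *\<^sub>R y \<noteq> 0"
proof -
  have "negligible (span {y})"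
    by (rule negligible_lowdim) (use assms dim_le_card[of "{y}" "{y}"] in auto)
  then have "emeasure lebesgue (span {y}) = 0"
    by (simp add: negligible_iff_emeasure0)
  moreover have "span {y} \<in> sets borel" by (simp add: closed_subspace)
  ultimately have "span {y} \<in> null_sets lborel"
    by (auto simp: null_sets_def)
  moreover have "x \<in> span {y}" if "x + t *\<^sub>R y = 0" for x t
  proof -
    have "x = (- t) *\<^sub>R y" using that by (simp add: eq_neg_iff_add_eq_0)
    then show ?thesis using span_scale[OF span_base[of y "{y}"], of "- t"] by simp
  qed
  ultimately show ?thesis
    by (intro AE_I'[of "span {y}"]) auto
qed

text \<open>Lebesgue measure is translation invariant, so averaging along a segment does not change
  the integral.\<close>

lemma nn_integral_segment_average:
  fixes f :: "'a::euclidean_space \<Rightarrow> ennreal"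
  assumes [measurable]: "f \<in> borel_measurable borel"
  shows "(\<integral>\<^sup>+x. (\<integral>\<^sup>+t. f (x + t *\<^sub>R y) * indicator {0..1::real} t \<partial>lborel) \<partial>lborel) = (\<integral>\<^sup>+x. f x \<partial>lborel)"
proof -
  have "(\<integral>\<^sup>+x. (\<integral>\<^sup>+t. f (x + t *\<^sub>R y) * indicator {0..1::real} t \<partial>lborel) \<partial>lborel)
      = (\<integral>\<^sup>+t. (\<integral>\<^sup>+x. f (x + t *\<^sub>R y) * indicator {0..1::real} t \<partial>lborel) \<partial>lborel)"
    by (rule lborel_pair.Fubini'[symmetric]) measurable
  also have "\<dots> = (\<integral>\<^sup>+t. (\<integral>\<^sup>+x. f x \<partial>lborel) * indicator {0..1::real} t \<partial>lborel)"
    by (intro nn_integral_cong) (simp add: nn_integral_multc nn_integral_translate)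
  also have "\<dots> = (\<integral>\<^sup>+x. f x \<partial>lborel)"
    by (simp add: nn_integral_cmult_indicator)
  finally show ?thesis .
qed

lemma translation_powr_bound:
  fixes v :: "'a::euclidean_space \<Rightarrow> real"
  assumes v: "punctured_C1 v v'" and p: "1 \<le> p" and dim: "2 \<le> DIM('a)"
  shows "(\<integral>\<^sup>+x. ennreal (\<bar>v (x + y) - v x\<bar> powr p) \<partial>lborel)
    \<le> ennreal (norm y powr p) * (\<integral>\<^sup>+x. ennreal (norm (v' x) powr p) \<partial>lborel)"
proof -
  note [measurable] = punctured_C1_measurable[OF v]
  have "(\<integral>\<^sup>+x. ennreal (\<bar>v (x + y) - v x\<bar> powr p) \<partial>lborel)
    \<le> (\<integral>\<^sup>+x. ennreal (norm y powr p) * (\<integral>\<^sup>+t. ennreal (norm (v' (x + t *\<^sub>R y)) powr p) * indicator {0..1} t \<partial>lborel) \<partial>lborel)"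
  proof (rule nn_integral_mono_AE)
    show "AE x in lborel. ennreal (\<bar>v (x + y) - v x\<bar> powr p)
      \<le> ennreal (norm y powr p) * (\<integral>\<^sup>+t. ennreal (norm (v' (x + t *\<^sub>R y)) powr p) * indicator {0..1} t \<partial>lborel)"
      using AE_segment_avoids_origin[OF dim, of y]
      by eventually_elim (use segment_powr_bound[OF v p, of 0 1 _ y] in auto)
  qed
  also have "\<dots> = ennreal (norm y powr p) * (\<integral>\<^sup>+x. ennreal (norm (v' x) powr p) \<partial>lborel)"
    by (subst nn_integral_cmult, measurable)
       (subst nn_integral_segment_average[of "\<lambda>x. ennreal (norm (v' x) powr p)"], auto)
  finally show ?thesis .
qed

text \<open>Along the segment \<open>|v|\<close> falls from above \<open>2 * t\<close> to \<open>t\<close> or below. Between the last point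
  where it is at least \<open>2 * t\<close> and the first one where it is at most \<open>t\<close>, the function varies
  by at least \<open>t\<close> while its values stay in the band, so only the gradient on the band is
  charged.\<close>

lemma segment_level_crossing:
  assumes v: "punctured_C1 v v'" and p: "1 \<le> p" and t: "0 < t"
    and avoid: "\<forall>s\<in>{0..1}. x + s *\<^sub>R y \<noteq> 0"
    and hi: "2 * t < \<bar>v x\<bar>" and lo: "\<bar>v (x + y)\<bar> \<le> t"
  shows "ennreal (t powr p) \<le> ennreal (norm y powr p) *
    (\<integral>\<^sup>+s. ennreal (norm (v' (x + s *\<^sub>R y)) powr p) * indicator {z. t \<le> \<bar>v z\<bar> \<and> \<bar>v z\<bar> \<le> 2 * t} (x + s *\<^sub>R y)
        * indicator {0..1} s \<partial>lborel)"
proof -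
  define g where "g s = \<bar>v (x + s *\<^sub>R y)\<bar>" for s
  have cont: "continuous_on {0..1} g"
    unfolding g_def using avoid
    by (intro continuous_intros continuous_on_compose2[OF punctured_C1_continuous_on[OF v]]) auto
  define B where "B = {s\<in>{0..1}. g s \<le> t}"
  have "closed B"
    unfolding B_def by (rule continuous_on_closed_Collect_le[OF cont continuous_on_const]) auto
  then have "compact B" unfolding B_def by (auto simp: compact_eq_bounded_closed intro: bounded_subset[OF bounded_closed_interval[of 0 1]])
  moreover have "1 \<in> B" using lo by (simp add: B_def g_def)
  ultimately obtain b where b: "b \<in> B" "\<And>s. s \<in> B \<Longrightarrow> b \<le> s"
    using compact_attains_inf[of B] by auto
  have b01: "0 \<le> b" "b \<le> 1" "g b \<le> t" using b by (auto simp: B_def)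
  define A where "A = {s\<in>{0..b}. 2 * t \<le> g s}"
  have "continuous_on {0..b} g" using cont b01 by (rule_tac continuous_on_subset[OF cont]) auto
  then have "closed A"
    unfolding A_def by (rule continuous_on_closed_Collect_le[OF continuous_on_const]) auto
  then have "compact A" unfolding A_def by (auto simp: compact_eq_bounded_closed intro: bounded_subset[OF bounded_closed_interval[of 0 b]])
  moreover have "0 \<in> A" using hi b01 by (simp add: A_def g_def)
  ultimately obtain a where a: "a \<in> A" "\<And>s. s \<in> A \<Longrightarrow> s \<le> a"
    using compact_attains_sup[of A] by auto
  have a01: "0 \<le> a" "a \<le> b" "2 * t \<le> g a" using a by (auto simp: A_def)
  have mid: "t \<le> g s \<and> g s \<le> 2 * t" if "a < s" "s < b" for s
    using that a(2)[of s] b(2)[of s] a01 b01 by (fastforce simp: A_def B_def)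
  have "t \<le> \<bar>v (x + b *\<^sub>R y) - v (x + a *\<^sub>R y)\<bar>"
    using a01(3) b01(3) unfolding g_def by linarith
  then have "ennreal (t powr p) \<le> ennreal (\<bar>v (x + b *\<^sub>R y) - v (x + a *\<^sub>R y)\<bar> powr p)"
    using t p by (intro ennreal_leI powr_mono2) auto
  also have "\<dots> \<le> ennreal (norm y powr p) * (\<integral>\<^sup>+s. ennreal (norm (v' (x + s *\<^sub>R y)) powr p) * indicator {a..b} s \<partial>lborel)"
    using a01 b01 avoid by (intro segment_powr_bound[OF v p]) auto
  also have "(\<integral>\<^sup>+s. ennreal (norm (v' (x + s *\<^sub>R y)) powr p) * indicator {a..b} s \<partial>lborel) \<le>
     (\<integral>\<^sup>+s. ennreal (norm (v' (x + s *\<^sub>R y)) powr p) * indicator {z. t \<le> \<bar>v z\<bar> \<and> \<bar>v z\<bar> \<le> 2 * t} (x + s *\<^sub>R y)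
        * indicator {0..1} s \<partial>lborel)"
  proof (rule nn_integral_mono_AE)
    have "AE s in lborel. s \<noteq> a" "AE s in lborel. s \<noteq> b" by (rule AE_lborel_singleton)+
    then show "AE s in lborel. ennreal (norm (v' (x + s *\<^sub>R y)) powr p) * indicator {a..b} s \<le>
       ennreal (norm (v' (x + s *\<^sub>R y)) powr p) * indicator {z. t \<le> \<bar>v z\<bar> \<and> \<bar>v z\<bar> \<le> 2 * t} (x + s *\<^sub>R y) * indicator {0..1} s"
    proof eventually_elim
      case (elim s)
      show ?case
      proof (cases "s \<in> {a..b}")
        case True
        then have "a < s" "s < b" using elim by auto
        then show ?thesis using mid[of s] a01 b01 by (simp add: g_def)
      qed simp
    qed
  qed
  finally show ?thesis by (simp add: mult_left_mono)
qed

section \<open>The Sobolev inequality\<close>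

text \<open>Count the pairs \<open>(x, x + y)\<close> with \<open>|v x| > 2 * t\<close>, \<open>|v (x + y)| \<le> t\<close> and \<open>y\<close> in a ball
  of measure \<open>2 * m\<close>. At most measure \<open>m\<close> of each ball is lost to \<open>{|v| > t}\<close>, which bounds
  the measure of the pairs from below; the localised translation estimate bounds it from
  above.\<close>

lemma superlevel_halving:
  fixes v :: "'a::euclidean_space \<Rightarrow> real"
  assumes v: "punctured_C1 v v'" and p: "1 \<le> p" and dim: "2 \<le> DIM('a)" and t: "0 < t"
    and m: "emeasure lborel {x. t < \<bar>v x\<bar>} = ennreal m" "0 \<le> m"
  shows "ennreal (t powr p) * emeasure lborel {x. 2 * t < \<bar>v x\<bar>}
    \<le> ennreal (2 * (2 * m / measure lborel (ball (0::'a) 1)) powr (p / DIM('a)))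
      * (\<integral>\<^sup>+x. ennreal (norm (v' x) powr p) * indicator {z. t \<le> \<bar>v z\<bar> \<and> \<bar>v z\<bar> \<le> 2 * t} x \<partial>lborel)"
proof (cases "m = 0")
  case True
  note [measurable] = punctured_C1_measurable[OF v]
  have "emeasure lborel {x. 2 * t < \<bar>v x\<bar>} \<le> emeasure lborel {x. t < \<bar>v x\<bar>}"
    using t by (intro emeasure_mono) auto
  then have "emeasure lborel {x. 2 * t < \<bar>v x\<bar>} = 0" using m True by simp
  then show ?thesis by simp
next
  case False
  then have m0: "m > 0" using m by simp
  note [measurable] = punctured_C1_measurable[OF v]
  define n where "n = real DIM('a)"
  have n: "n \<ge> 2" using dim by (simp add: n_def)
  define \<omega> where "\<omega> = measure lborel (ball (0::'a) 1)"
  have \<omega>: "\<omega> > 0" unfolding \<omega>_def by simp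
  \<comment> \<open>The radius for which the ball has measure \<open>2 * m\<close>.\<close>
  define h where "h = (2 * m / \<omega>) powr (1 / n)"
  have h: "h > 0" using m0 \<omega> by (simp add: h_def)
  have hball: "emeasure lborel (ball (0::'a) h) = ennreal (2 * m)"
  proof -
    have "h powr n = 2 * m / \<omega>" using n m0 \<omega> by (simp add: h_def powr_powr)
    then show ?thesis using \<omega> emeasure_ball_powr[OF h, where 'a='a] by (simp add: n_def \<omega>_def)
  qed
  define \<Psi> where "\<Psi> x = ennreal (norm (v' x) powr p) * indicator {z. t \<le> \<bar>v z\<bar> \<and> \<bar>v z\<bar> \<le> 2 * t} x" for x
  have [measurable]: "\<Psi> \<in> borel_measurable borel" unfolding \<Psi>_def by measurable
  define P where "P = {(x, y). 2 * t < \<bar>v x\<bar> \<and> \<bar>v (x + y)\<bar> \<le> t \<and> norm y < h}"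
  have P: "P = {z \<in> space (borel \<Otimes>\<^sub>M borel). 2 * t < \<bar>v (fst z)\<bar> \<and> \<bar>v (fst z + snd z)\<bar> \<le> t \<and> norm (snd z) < h}"
    by (auto simp: P_def space_pair_measure)
  have [measurable]: "P \<in> sets (borel \<Otimes>\<^sub>M borel)" unfolding P by measurable
  have lower: "ennreal m * indicator {x. 2 * t < \<bar>v x\<bar>} x \<le> (\<integral>\<^sup>+y. indicator P (x, y) \<partial>lborel)" for x
  proof (cases "2 * t < \<bar>v x\<bar>")
    case True
    have "ennreal (2 * m) = (\<integral>\<^sup>+y. indicator (ball (0::'a) h) y \<partial>lborel)" using hball by simp
    also have "\<dots> \<le> (\<integral>\<^sup>+y. (indicator P (x, y) + indicator {z. t < \<bar>v z\<bar>} (y + x)) \<partial>lborel)"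
      by (intro nn_integral_mono) (use True in \<open>auto split: split_indicator simp: P_def add.commute\<close>)
    also have "\<dots> = (\<integral>\<^sup>+y. indicator P (x, y) \<partial>lborel) + (\<integral>\<^sup>+y. indicator {z. t < \<bar>v z\<bar>} (y + x) \<partial>lborel)"
      by (intro nn_integral_add) measurable
    also have "(\<integral>\<^sup>+y. indicator {z. t < \<bar>v z\<bar>} (y + x) \<partial>lborel) = ennreal m"
      by (subst nn_integral_translate) (use m in auto)
    finally have "ennreal (2 * m) \<le> (\<integral>\<^sup>+y. indicator P (x, y) \<partial>lborel) + ennreal m" .
    then have "ennreal m + ennreal m \<le> ennreal m + (\<integral>\<^sup>+y. indicator P (x, y) \<partial>lborel)"
      using m0 by (simp add: add.commute flip: ennreal_plus)
    then show ?thesis using True by (simp add: ennreal_add_left_cancel_le)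
  qed simp
  have upper: "ennreal (t powr p) * (\<integral>\<^sup>+x. indicator P (x, y) \<partial>lborel)
      \<le> ennreal (h powr p) * (\<integral>\<^sup>+x. \<Psi> x \<partial>lborel) * indicator (ball 0 h) y" for y
  proof (cases "norm y < h")
    case False
    then have "indicator P (x, y) = (0::ennreal)" for x by (simp add: P_def)
    then show ?thesis by simp
  next
    case True
    have "ennreal (t powr p) * (\<integral>\<^sup>+x. indicator P (x, y) \<partial>lborel) = (\<integral>\<^sup>+x. ennreal (t powr p) * indicator P (x, y) \<partial>lborel)"
      by (intro nn_integral_cmult[symmetric]) measurable
    also have "\<dots> \<le> (\<integral>\<^sup>+x. ennreal (norm y powr p) * (\<integral>\<^sup>+s. \<Psi> (x + s *\<^sub>R y) * indicator {0..1} s \<partial>lborel) \<partial>lborel)"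
    proof (rule nn_integral_mono_AE)
      show "AE x in lborel. ennreal (t powr p) * indicator P (x, y)
         \<le> ennreal (norm y powr p) * (\<integral>\<^sup>+s. \<Psi> (x + s *\<^sub>R y) * indicator {0..1} s \<partial>lborel)"
        using AE_segment_avoids_origin[OF dim, of y]
      proof eventually_elim
        case (elim x)
        show ?case
        proof (cases "(x, y) \<in> P")
          case True
          then have "2 * t < \<bar>v x\<bar>" "\<bar>v (x + y)\<bar> \<le> t" by (auto simp: P_def)
          from segment_level_crossing[OF v p t elim this] True show ?thesis by (simp add: \<Psi>_def)
        qed simp
      qed
    qed
    also have "\<dots> = ennreal (norm y powr p) * (\<integral>\<^sup>+x. \<Psi> x \<partial>lborel)"
      by (subst nn_integral_cmult, measurable) (subst nn_integral_segment_average, auto)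
    also have "\<dots> \<le> ennreal (h powr p) * (\<integral>\<^sup>+x. \<Psi> x \<partial>lborel)"
      using True p by (intro mult_right_mono ennreal_leI powr_mono2) auto
    finally show ?thesis using True by simp
  qed
  have "ennreal (t powr p) * (ennreal m * emeasure lborel {x. 2 * t < \<bar>v x\<bar>})
      = ennreal (t powr p) * (\<integral>\<^sup>+x. ennreal m * indicator {x. 2 * t < \<bar>v x\<bar>} x \<partial>lborel)"
    by (subst nn_integral_cmult_indicator) auto
  also have "\<dots> \<le> ennreal (t powr p) * (\<integral>\<^sup>+x. (\<integral>\<^sup>+y. indicator P (x, y) \<partial>lborel) \<partial>lborel)"
    by (intro mult_left_mono nn_integral_mono lower) auto
  also have "(\<integral>\<^sup>+x. (\<integral>\<^sup>+y. indicator P (x, y) \<partial>lborel) \<partial>lborel) = (\<integral>\<^sup>+y. (\<integral>\<^sup>+x. indicator P (x, y) \<partial>lborel) \<partial>lborel)"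
    by (rule lborel_pair.Fubini') measurable
  also have "ennreal (t powr p) * \<dots> = (\<integral>\<^sup>+y. ennreal (t powr p) * (\<integral>\<^sup>+x. indicator P (x, y) \<partial>lborel) \<partial>lborel)"
    by (intro nn_integral_cmult[symmetric]) measurable
  also have "\<dots> \<le> (\<integral>\<^sup>+y. ennreal (h powr p) * (\<integral>\<^sup>+x. \<Psi> x \<partial>lborel) * indicator (ball (0::'a) h) y \<partial>lborel)"
    by (intro nn_integral_mono upper)
  also have "\<dots> = ennreal (h powr p) * (\<integral>\<^sup>+x. \<Psi> x \<partial>lborel) * ennreal (2 * m)"
    by (subst nn_integral_cmult_indicator) (auto simp: hball)
  finally have "ennreal m * (ennreal (t powr p) * emeasure lborel {x. 2 * t < \<bar>v x\<bar>})
     \<le> ennreal m * (ennreal (2 * h powr p) * (\<integral>\<^sup>+x. \<Psi> x \<partial>lborel))"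
    using m0 by (simp add: ennreal_mult mult_ac)
  then have "ennreal (t powr p) * emeasure lborel {x. 2 * t < \<bar>v x\<bar>} \<le> ennreal (2 * h powr p) * (\<integral>\<^sup>+x. \<Psi> x \<partial>lborel)"
    using m0 by (simp add: ennreal_mult_le_mult_iff)
  moreover have "h powr p = (2 * m / \<omega>) powr (p / n)"
    by (simp add: h_def powr_powr)
  ultimately show ?thesis by (simp add: \<Psi>_def n_def \<omega>_def)
qed

lemma nn_integral_powr_sub_one:
  assumes r: "1 < r" and c: "0 \<le> c"
  shows "(\<integral>\<^sup>+t. ennreal (t powr (r - 1)) * indicator {0..c} t \<partial>lborel) = ennreal (c powr r / r)"
proof -
  have "((\<lambda>t. t powr (r - 1)) has_integral (c powr (r - 1 + 1) / (r - 1 + 1))) {0..c}"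
    by (rule has_integral_powr_from_0) (use r c in auto)
  from nn_integral_has_integral_lebesgue'[OF _ this] show ?thesis by simp
qed

lemma nn_integral_inverse_Icc:
  assumes c: "0 < c"
  shows "(\<integral>\<^sup>+t. ennreal (1 / t) * indicator {c / 2..c} t \<partial>lborel) = ennreal (ln 2)"
proof -
  have "(\<integral>\<^sup>+t. ennreal (1 / t) * indicator {c / 2..c} t \<partial>lborel) = ennreal (ln c - ln (c / 2))"
    by (rule nn_integral_FTC_Icc) (use c in \<open>auto intro!: derivative_eq_intros\<close>)
  also have "ln c - ln (c / 2) = ln 2" using c by (simp add: ln_div)
  finally show ?thesis .
qed

text \<open>The value that comes out of the proof of Sobolev's inequality, with \<open>\<omega>\<close> the volume of
  the unit ball.\<close>

definition sobolev_const :: "real \<Rightarrow> real \<Rightarrow> real \<Rightarrow> real" where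
  "sobolev_const n p \<omega> = crit_exp n p * 2 powr crit_exp n p * (2 * (2 / \<omega>) powr (p / n)) * ln 2"

text \<open>Multiply \<open>superlevel_halving\<close> by the power of \<open>t\<close> that turns its left side into a
  layer-cake integral of \<open>|v|\<close> to the critical power. Chebyshev's inequality bounds the
  measure of \<open>{|v| > t}\<close> on the right by the same integral \<open>I\<close>, and each point lies in the
  band \<open>t \<le> |v| \<le> 2 * t\<close> for a set of \<open>t\<close> of measure \<open>ln 2\<close> with respect to \<open>dt / t\<close>. This
  gives \<open>I \<le> C * I powr (p / n) * G\<close>, which can be solved for \<open>I\<close> because \<open>I\<close> is finite.\<close>

lemma sobolev_inequality:
  fixes v :: "'a::euclidean_space \<Rightarrow> real" and p G :: real
  assumes v: "punctured_C1 v v'" and p: "1 \<le> p" "p < real DIM('a)" and dim: "2 \<le> DIM('a)"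
    and fin: "(\<integral>\<^sup>+x. ennreal (\<bar>v x\<bar> powr crit_exp DIM('a) p) \<partial>lborel) < \<infinity>"
    and G: "(\<integral>\<^sup>+x. ennreal (norm (v' x) powr p) \<partial>lborel) \<le> ennreal G" "0 \<le> G"
  shows "(\<integral>\<^sup>+x. ennreal (\<bar>v x\<bar> powr crit_exp DIM('a) p) \<partial>lborel)
    \<le> ennreal ((sobolev_const DIM('a) p (measure lborel (ball (0::'a) 1)) * G) powr (DIM('a) / (DIM('a) - p)))"
proof -
  note [measurable] = punctured_C1_measurable[OF v]
  define n where "n = real DIM('a)"
  define r where "r = crit_exp n p"
  have n: "n \<ge> 2" "p < n" using dim p by (auto simp: n_def)
  have rdef: "r = n * p / (n - p)" by (simp add: r_def crit_exp_def)
  have r1: "r > 1"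
  proof -
    have "n - p < n * 1" using p by simp
    also have "\<dots> \<le> n * p" using p n by (intro mult_left_mono) auto
    finally show ?thesis using n by (simp add: rdef field_simps)
  qed
  \<comment> \<open>The identity that makes the powers of \<open>t\<close> cancel; it characterises the critical exponent.\<close>
  have rp: "r * (p / n) = r - p" using n by (simp add: rdef field_simps)
  define \<omega> where "\<omega> = measure lborel (ball (0::'a) 1)"
  have \<omega>: "\<omega> > 0" unfolding \<omega>_def by simp
  obtain I where I: "(\<integral>\<^sup>+x. ennreal (\<bar>v x\<bar> powr r) \<partial>lborel) = ennreal I" "0 \<le> I"
    using fin by (cases "\<integral>\<^sup>+x. ennreal (\<bar>v x\<bar> powr r) \<partial>lborel") (auto simp: r_def n_def)
  define c0 where "c0 = 2 * (2 / \<omega>) powr (p / n)"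
  have c0: "c0 > 0" using \<omega> by (simp add: c0_def)
  define \<Psi> where "\<Psi> t x = ennreal (norm (v' x) powr p) * indicator {z. t \<le> \<bar>v z\<bar> \<and> \<bar>v z\<bar> \<le> 2 * t} x" for t x
  have level: "ennreal (t powr (r - 1)) * emeasure lborel {x. 2 * t < \<bar>v x\<bar>}
      \<le> ennreal (c0 * I powr (p / n)) * (ennreal (1 / t) * (\<integral>\<^sup>+x. \<Psi> t x \<partial>lborel))" if t: "t > 0" for t
  proof -
    have "ennreal (t powr r) * emeasure lborel {x. t < \<bar>v x\<bar>} = (\<integral>\<^sup>+x. ennreal (t powr r) * indicator {x. t < \<bar>v x\<bar>} x \<partial>lborel)"
      by (subst nn_integral_cmult_indicator) auto
    also have "\<dots> \<le> (\<integral>\<^sup>+x. ennreal (\<bar>v x\<bar> powr r) \<partial>lborel)"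
      using r1 t by (intro nn_integral_mono) (auto split: split_indicator intro!: ennreal_leI powr_mono2)
    finally have cheb: "ennreal (t powr r) * emeasure lborel {x. t < \<bar>v x\<bar>} \<le> ennreal I" using I by simp
    then have "emeasure lborel {x. t < \<bar>v x\<bar>} \<noteq> top"
      using t by (auto simp: ennreal_mult_top top_unique)
    then obtain m where m: "emeasure lborel {x. t < \<bar>v x\<bar>} = ennreal m" "0 \<le> m"
      by (cases "emeasure lborel {x. t < \<bar>v x\<bar>}") auto
    have mI: "m \<le> I * t powr (- r)"
      using cheb m I t by (simp add: ennreal_mult[symmetric] powr_minus field_simps)
    have "m powr (p / n) \<le> (I * t powr (- r)) powr (p / n)"
      using mI m p n by (intro powr_mono2) auto
    also have "\<dots> = I powr (p / n) * t powr (p - r)"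
      using I rp by (simp add: powr_mult powr_powr)
    finally have mp: "m powr (p / n) \<le> I powr (p / n) * t powr (p - r)" .
    have "2 * (2 * m / \<omega>) powr (p / n) = c0 * m powr (p / n)"
      using m \<omega> by (simp add: c0_def powr_mult powr_divide)
    also have "\<dots> \<le> c0 * (I powr (p / n) * t powr (p - r))"
      using mp c0 by (intro mult_left_mono) auto
    finally have coef: "2 * (2 * m / \<omega>) powr (p / n) \<le> c0 * I powr (p / n) * t powr (p - r)" by (simp add: mult_ac)
    have "t powr (r - 1) = t powr (r - 1 - p) * t powr p"
      by (simp add: powr_add[symmetric])
    then have "ennreal (t powr (r - 1)) * emeasure lborel {x. 2 * t < \<bar>v x\<bar>}
      = ennreal (t powr (r - 1 - p)) * (ennreal (t powr p) * emeasure lborel {x. 2 * t < \<bar>v x\<bar>})"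
      by (simp add: ennreal_mult mult.assoc)
    also have "\<dots> \<le> ennreal (t powr (r - 1 - p)) * (ennreal (2 * (2 * m / \<omega>) powr (p / n)) * (\<integral>\<^sup>+x. \<Psi> t x \<partial>lborel))"
      unfolding \<Psi>_def \<omega>_def n_def
      by (intro mult_left_mono superlevel_halving[OF v p(1) dim t m]) auto
    also have "\<dots> \<le> ennreal (t powr (r - 1 - p)) * (ennreal (c0 * I powr (p / n) * t powr (p - r)) * (\<integral>\<^sup>+x. \<Psi> t x \<partial>lborel))"
      by (intro mult_left_mono mult_right_mono ennreal_leI coef) auto
    also have "\<dots> = ennreal (t powr (r - 1 - p) * (c0 * I powr (p / n) * t powr (p - r))) * (\<integral>\<^sup>+x. \<Psi> t x \<partial>lborel)"
      using c0 by (simp add: ennreal_mult mult.assoc)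
    also have "t powr (r - 1 - p) * (c0 * I powr (p / n) * t powr (p - r)) = c0 * I powr (p / n) * (1 / t)"
    proof -
      have "t powr (r - 1 - p) * t powr (p - r) = 1 / t"
        using t by (simp add: powr_add[symmetric] powr_minus divide_inverse)
      then show ?thesis by (simp add: mult_ac)
    qed
    also have "ennreal (c0 * I powr (p / n) * (1 / t)) * (\<integral>\<^sup>+x. \<Psi> t x \<partial>lborel)
      = ennreal (c0 * I powr (p / n)) * (ennreal (1 / t) * (\<integral>\<^sup>+x. \<Psi> t x \<partial>lborel))"
      by (subst ennreal_mult) (use t c0 in \<open>auto simp: mult.assoc\<close>)
    finally show ?thesis .
  qed
  define L where "L = {(t, x). 0 < t \<and> 2 * t < \<bar>v x\<bar>}"
  define K where "K = {(t, x). 0 < t \<and> t \<le> \<bar>v x\<bar> \<and> \<bar>v x\<bar> \<le> 2 * t}"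
  have LK: "L = {z \<in> space (borel \<Otimes>\<^sub>M borel). 0 < fst z \<and> 2 * fst z < \<bar>v (snd z)\<bar>}"
    "K = {z \<in> space (borel \<Otimes>\<^sub>M borel). 0 < fst z \<and> fst z \<le> \<bar>v (snd z)\<bar> \<and> \<bar>v (snd z)\<bar> \<le> 2 * fst z}"
    by (auto simp: L_def K_def space_pair_measure)
  have [measurable]: "L \<in> sets (borel \<Otimes>\<^sub>M borel)" "K \<in> sets (borel \<Otimes>\<^sub>M borel)"
    unfolding LK by measurable
  have "ennreal (2 powr (- r) / r) * ennreal I = (\<integral>\<^sup>+x. ennreal (2 powr (- r) / r) * ennreal (\<bar>v x\<bar> powr r) \<partial>lborel)"
    unfolding I(1)[symmetric] by (intro nn_integral_cmult[symmetric]) measurable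
  also have "\<dots> = (\<integral>\<^sup>+x. (\<integral>\<^sup>+t. ennreal (t powr (r - 1)) * indicator {0..\<bar>v x\<bar> / 2} t \<partial>lborel) \<partial>lborel)"
    using r1 by (intro nn_integral_cong) (simp add: nn_integral_powr_sub_one powr_divide powr_minus ennreal_mult[symmetric] field_simps)
  also have "\<dots> \<le> (\<integral>\<^sup>+x. (\<integral>\<^sup>+t. ennreal (t powr (r - 1)) * indicator L (t, x) \<partial>lborel) \<partial>lborel)"
  proof (rule nn_integral_mono, rule nn_integral_mono_AE)
    fix x
    have "AE t in lborel. t \<noteq> (0::real)" "AE t in lborel. t \<noteq> \<bar>v x\<bar> / 2" by (rule AE_lborel_singleton)+
    then show "AE t in lborel. ennreal (t powr (r - 1)) * indicator {0..\<bar>v x\<bar> / 2} t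
       \<le> ennreal (t powr (r - 1)) * indicator L (t, x)"
      by eventually_elim (auto simp: L_def split: split_indicator)
  qed
  also have "\<dots> = (\<integral>\<^sup>+t. (\<integral>\<^sup>+x. ennreal (t powr (r - 1)) * indicator L (t, x) \<partial>lborel) \<partial>lborel)"
    by (rule lborel_pair.Fubini') measurable
  also have "\<dots> \<le> (\<integral>\<^sup>+t. (\<integral>\<^sup>+x. ennreal (c0 * I powr (p / n)) * (ennreal (1 / t) * (ennreal (norm (v' x) powr p) * indicator K (t, x))) \<partial>lborel) \<partial>lborel)"
  proof (rule nn_integral_mono)
    fix t :: real
    show "(\<integral>\<^sup>+x. ennreal (t powr (r - 1)) * indicator L (t, x) \<partial>lborel)
      \<le> (\<integral>\<^sup>+x. ennreal (c0 * I powr (p / n)) * (ennreal (1 / t) * (ennreal (norm (v' x) powr p) * indicator K (t, x))) \<partial>lborel)"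
    proof (cases "t > 0")
      case True
      have "(\<integral>\<^sup>+x. ennreal (t powr (r - 1)) * indicator L (t, x) \<partial>lborel)
         = (\<integral>\<^sup>+x. ennreal (t powr (r - 1)) * indicator {x. 2 * t < \<bar>v x\<bar>} x \<partial>lborel)"
        using True by (intro nn_integral_cong) (auto simp: L_def split: split_indicator)
      also have "\<dots> = ennreal (t powr (r - 1)) * emeasure lborel {x. 2 * t < \<bar>v x\<bar>}"
        by (intro nn_integral_cmult_indicator) measurable
      also note level[OF True]
      also have "ennreal (c0 * I powr (p / n)) * (ennreal (1 / t) * (\<integral>\<^sup>+x. \<Psi> t x \<partial>lborel))
         = (\<integral>\<^sup>+x. ennreal (c0 * I powr (p / n)) * (ennreal (1 / t) * \<Psi> t x) \<partial>lborel)"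
      proof -
        have "\<Psi> t \<in> borel_measurable lborel" unfolding \<Psi>_def by measurable
        then show ?thesis by (simp add: nn_integral_cmult)
      qed
      also have "\<dots> = (\<integral>\<^sup>+x. ennreal (c0 * I powr (p / n)) * (ennreal (1 / t) * (ennreal (norm (v' x) powr p) * indicator K (t, x))) \<partial>lborel)"
        using True by (intro nn_integral_cong) (auto simp: K_def \<Psi>_def split: split_indicator)
      finally show ?thesis .
    qed (simp add: L_def)
  qed
  also have "\<dots> = (\<integral>\<^sup>+x. (\<integral>\<^sup>+t. ennreal (c0 * I powr (p / n)) * (ennreal (1 / t) * (ennreal (norm (v' x) powr p) * indicator K (t, x))) \<partial>lborel) \<partial>lborel)"
    by (rule lborel_pair.Fubini'[symmetric]) measurable
  also have "\<dots> \<le> (\<integral>\<^sup>+x. ennreal (c0 * I powr (p / n) * ln 2) * ennreal (norm (v' x) powr p) \<partial>lborel)"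
  proof (intro nn_integral_mono)
    fix x
    have "(\<integral>\<^sup>+t. ennreal (c0 * I powr (p / n)) * (ennreal (1 / t) * (ennreal (norm (v' x) powr p) * indicator K (t, x))) \<partial>lborel)
      = (\<integral>\<^sup>+t. ennreal (c0 * I powr (p / n)) * ennreal (norm (v' x) powr p) * (ennreal (1 / t) * indicator K (t, x)) \<partial>lborel)"
      by (intro nn_integral_cong) (simp only: mult_ac)
    also have "\<dots> = ennreal (c0 * I powr (p / n)) * ennreal (norm (v' x) powr p) * (\<integral>\<^sup>+t. ennreal (1 / t) * indicator K (t, x) \<partial>lborel)"
      by (intro nn_integral_cmult) measurable
    also have "\<dots> \<le> ennreal (c0 * I powr (p / n)) * ennreal (norm (v' x) powr p) * ennreal (ln 2)"
    proof (rule mult_left_mono, cases "v x = 0")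
      case True
      have "(\<lambda>t. ennreal (1 / t) * indicator K (t, x)) = (\<lambda>t. 0)"
        using True by (auto simp: K_def split: split_indicator)
      then show "(\<integral>\<^sup>+t. ennreal (1 / t) * indicator K (t, x) \<partial>lborel) \<le> ennreal (ln 2)" by simp
    next
      case False
      have "(\<integral>\<^sup>+t. ennreal (1 / t) * indicator K (t, x) \<partial>lborel)
         \<le> (\<integral>\<^sup>+t. (ennreal (1 / t) * indicator {\<bar>v x\<bar> / 2..\<bar>v x\<bar>} t) \<partial>lborel)"
        by (intro nn_integral_mono) (auto simp: K_def split: split_indicator)
      also have "\<dots> = ennreal (ln 2)" using False by (intro nn_integral_inverse_Icc) simp
      finally show "(\<integral>\<^sup>+t. ennreal (1 / t) * indicator K (t, x) \<partial>lborel) \<le> ennreal (ln 2)" .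
    qed simp
    finally show "(\<integral>\<^sup>+t. ennreal (c0 * I powr (p / n)) * (ennreal (1 / t) * (ennreal (norm (v' x) powr p) * indicator K (t, x))) \<partial>lborel)
      \<le> ennreal (c0 * I powr (p / n) * ln 2) * ennreal (norm (v' x) powr p)"
      using c0 by (simp add: ennreal_mult mult_ac)
  qed
  also have "\<dots> = ennreal (c0 * I powr (p / n) * ln 2) * (\<integral>\<^sup>+x. ennreal (norm (v' x) powr p) \<partial>lborel)"
    by (intro nn_integral_cmult) measurable
  also have "\<dots> \<le> ennreal (c0 * I powr (p / n) * ln 2) * ennreal G"
    by (intro mult_left_mono G) auto
  finally have "2 powr (- r) / r * I \<le> c0 * I powr (p / n) * ln 2 * G"
    using r1 I c0 G by (simp add: ennreal_mult[symmetric])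
  then have main: "I \<le> (r * 2 powr r * c0 * ln 2 * G) * I powr (p / n)"
    using r1 by (simp add: powr_minus field_simps)
  have const: "r * 2 powr r * c0 * ln 2 * G = sobolev_const n p \<omega> * G"
    by (simp add: sobolev_const_def r_def c0_def)
  have "I \<le> (sobolev_const n p \<omega> * G) powr (n / (n - p))"
  proof (cases "I = 0")
    case False
    then have I0: "I > 0" using I by simp
    have "I powr (1 - p / n) = I / I powr (p / n)" using I0 by (simp add: powr_diff)
    also have "\<dots> \<le> sobolev_const n p \<omega> * G"
      using main I0 unfolding const by (simp add: divide_le_eq)
    finally have "(I powr (1 - p / n)) powr (n / (n - p)) \<le> (sobolev_const n p \<omega> * G) powr (n / (n - p))"
      using n by (intro powr_mono2) auto
    moreover have "(1 - p / n) * (n / (n - p)) = 1" using n by (simp add: field_simps)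
    ultimately show ?thesis using I0 by (simp only: powr_powr) simp
  qed simp
  then show ?thesis using I by (simp add: r_def n_def \<omega>_def ennreal_leI)
qed

section \<open>The Hardy inequality\<close>

text \<open>Let \<open>F\<close> be the left side. Replacing \<open>w x\<close> by \<open>w (2 * x)\<close> multiplies \<open>F\<close> by
  \<open>l powr p < 1\<close>, by scaling, and the error is controlled by the gradient on the segment from
  \<open>x\<close> to \<open>2 * x\<close>, which is radial and stays away from the origin. Since \<open>F\<close> is finite it can
  be absorbed.\<close>

lemma hardy_inequality:
  fixes w :: "'a::euclidean_space \<Rightarrow> real" and b p l :: real
  assumes w: "punctured_C1 w w'" and p: "1 \<le> p" and b: "b + p < real DIM('a)"
    and fin: "(\<integral>\<^sup>+x. ennreal (\<bar>w x\<bar> powr p * norm x powr (- b - p)) \<partial>lborel) < \<infinity>"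
    and l_def: "l = 2 powr ((b + p - DIM('a)) / p)"
  shows "(\<integral>\<^sup>+x. ennreal (\<bar>w x\<bar> powr p * norm x powr (- b - p)) \<partial>lborel)
    \<le> ennreal ((1 - l) powr (- p)) * (\<integral>\<^sup>+x. ennreal (norm (w' x) powr p * norm x powr (- b)) \<partial>lborel)"
proof -
  note [measurable] = punctured_C1_measurable[OF w]
  define n where "n = real DIM('a)"
  have l: "0 < l" "l < 1"
  proof -
    show "0 < l" by (simp add: l_def)
    have "(b + p - n) / p < 0" using b p by (simp add: n_def divide_neg_pos)
    then have "2 powr ((b + p - n) / p) < 2 powr (0::real)" by (intro powr_less_mono) auto
    then show "l < 1" by (simp add: l_def n_def)
  qed
  define D where "D = (\<integral>\<^sup>+x. ennreal (norm (w' x) powr p * norm x powr (- b)) \<partial>lborel)"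
  define F where "F = (\<integral>\<^sup>+x. ennreal (\<bar>w x\<bar> powr p * norm x powr (- b - p)) \<partial>lborel)"
  have dil: "(\<integral>\<^sup>+x. ennreal (\<bar>w (2 *\<^sub>R x)\<bar> powr p * norm x powr (- b - p)) \<partial>lborel) = ennreal (l powr p) * F"
  proof -
    have "(\<integral>\<^sup>+x. ennreal (\<bar>w (2 *\<^sub>R x)\<bar> powr p * norm x powr (- b - p)) \<partial>lborel)
       = (\<integral>\<^sup>+x. ennreal (2 powr (b + p)) * ennreal (\<bar>w (2 *\<^sub>R x)\<bar> powr p * norm (2 *\<^sub>R x) powr (- b - p)) \<partial>lborel)"
    proof (intro nn_integral_cong)
      fix x :: 'a
      have "norm (2 *\<^sub>R x) powr (- b - p) = 2 powr (- b - p) * norm x powr (- b - p)"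
        by (simp add: powr_mult)
      moreover have "2 powr (b + p) * 2 powr (- b - p) = (1::real)" by (simp add: powr_add[symmetric])
      ultimately show "ennreal (\<bar>w (2 *\<^sub>R x)\<bar> powr p * norm x powr (- b - p))
         = ennreal (2 powr (b + p)) * ennreal (\<bar>w (2 *\<^sub>R x)\<bar> powr p * norm (2 *\<^sub>R x) powr (- b - p))"
        by (subst ennreal_mult[symmetric]) (auto simp: algebra_simps)
    qed
    also have "\<dots> = ennreal (2 powr (b + p)) * (\<integral>\<^sup>+x. ennreal (\<bar>w (2 *\<^sub>R x)\<bar> powr p * norm (2 *\<^sub>R x) powr (- b - p)) \<partial>lborel)"
      by (intro nn_integral_cmult) measurable
    also have "(\<integral>\<^sup>+x. ennreal (\<bar>w (2 *\<^sub>R x)\<bar> powr p * norm (2 *\<^sub>R x) powr (- b - p)) \<partial>lborel) = ennreal (2 powr (- n)) * F"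
      unfolding F_def n_def
      by (rule nn_integral_dilate[of "\<lambda>x. ennreal (\<bar>w x\<bar> powr p * norm x powr (- b - p))" 2]) auto
    also have "ennreal (2 powr (b + p)) * (ennreal (2 powr (- n)) * F) = ennreal (l powr p) * F"
    proof -
      have "2 powr (b + p) * 2 powr (- n) = l powr p"
        using p by (simp add: l_def n_def powr_powr powr_add[symmetric])
      then show ?thesis by (simp add: mult.assoc[symmetric] ennreal_mult[symmetric])
    qed
    finally show ?thesis .
  qed
  have inc: "(\<integral>\<^sup>+x. ennreal (\<bar>w x - w (2 *\<^sub>R x)\<bar> powr p * norm x powr (- b - p)) \<partial>lborel) \<le> D"
  proof -
    define f where "f z = ennreal (norm (w' z) powr p * norm z powr (- b))" for z
    have [measurable]: "f \<in> borel_measurable borel" unfolding f_def by measurable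
    have "(\<integral>\<^sup>+x. ennreal (\<bar>w x - w (2 *\<^sub>R x)\<bar> powr p * norm x powr (- b - p)) \<partial>lborel)
      \<le> (\<integral>\<^sup>+x. (\<integral>\<^sup>+s. ennreal ((1 + s) powr b) * f ((1 + s) *\<^sub>R x) * indicator {0..1} s \<partial>lborel) \<partial>lborel)"
    proof (intro nn_integral_mono_AE)
      have "AE x in lborel. x \<noteq> (0::'a)" by (rule AE_lborel_singleton)
      then show "AE x in lborel. ennreal (\<bar>w x - w (2 *\<^sub>R x)\<bar> powr p * norm x powr (- b - p))
         \<le> (\<integral>\<^sup>+s. ennreal ((1 + s) powr b) * f ((1 + s) *\<^sub>R x) * indicator {0..1} s \<partial>lborel)"
      proof eventually_elim
        case (elim x)
        have "ennreal (\<bar>w (x + 1 *\<^sub>R x) - w (x + 0 *\<^sub>R x)\<bar> powr p)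
          \<le> ennreal (norm x powr p) * (\<integral>\<^sup>+s. ennreal (norm (w' (x + s *\<^sub>R x)) powr p) * indicator {0..1} s \<partial>lborel)"
        proof (rule segment_powr_bound[OF w p])
          fix t :: real assume "t \<in> {0..1}"
          then have "(1 + t) *\<^sub>R x \<noteq> 0" using elim by auto
          then show "x + t *\<^sub>R x \<noteq> 0" by (simp add: scaleR_add_left)
        qed auto
        then have "ennreal (norm x powr (- b - p)) * ennreal (\<bar>w x - w (2 *\<^sub>R x)\<bar> powr p)
          \<le> ennreal (norm x powr (- b - p)) * (ennreal (norm x powr p) * (\<integral>\<^sup>+s. ennreal (norm (w' (x + s *\<^sub>R x)) powr p) * indicator {0..1} s \<partial>lborel))"
          by (intro mult_left_mono) (auto simp: scaleR_2 abs_minus_commute)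
        also have "\<dots> = ennreal (norm x powr (- b)) * (\<integral>\<^sup>+s. ennreal (norm (w' (x + s *\<^sub>R x)) powr p) * indicator {0..1} s \<partial>lborel)"
          using elim by (simp add: mult.assoc[symmetric] ennreal_mult[symmetric] powr_add[symmetric])
        also have "\<dots> = (\<integral>\<^sup>+s. ennreal (norm x powr (- b)) * (ennreal (norm (w' (x + s *\<^sub>R x)) powr p) * indicator {0..1} s) \<partial>lborel)"
          by (intro nn_integral_cmult[symmetric]) measurable
        also have "\<dots> = (\<integral>\<^sup>+s. ennreal ((1 + s) powr b) * f ((1 + s) *\<^sub>R x) * indicator {0..1} s \<partial>lborel)"
        proof (intro nn_integral_cong)
          fix s :: real
          show "ennreal (norm x powr (- b)) * (ennreal (norm (w' (x + s *\<^sub>R x)) powr p) * indicator {0..1} s)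
             = ennreal ((1 + s) powr b) * f ((1 + s) *\<^sub>R x) * indicator {0..1} s"
          proof (cases "s \<in> {0..1}")
            case True
            have "norm ((1 + s) *\<^sub>R x) powr (- b) = (1 + s) powr (- b) * norm x powr (- b)"
              using True by (simp add: powr_mult)
            moreover have "(1 + s) powr b * (1 + s) powr (- b) = 1" using True by (simp add: powr_add[symmetric])
            ultimately have "(1 + s) powr b * (norm (w' ((1 + s) *\<^sub>R x)) powr p * norm ((1 + s) *\<^sub>R x) powr (- b))
               = norm x powr (- b) * norm (w' (x + s *\<^sub>R x)) powr p"
              by (simp add: scaleR_add_left algebra_simps)
            then show ?thesis using True by (simp add: f_def ennreal_mult[symmetric])
          qed simp
        qed
        finally show ?case by (simp add: ennreal_mult mult.commute)
      qed
    qed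
    also have "\<dots> = (\<integral>\<^sup>+s. (\<integral>\<^sup>+x. ennreal ((1 + s) powr b) * f ((1 + s) *\<^sub>R x) * indicator {0..1} s \<partial>lborel) \<partial>lborel)"
      by (rule lborel_pair.Fubini'[symmetric]) measurable
    also have "\<dots> \<le> (\<integral>\<^sup>+s. D * indicator {0..1::real} s \<partial>lborel)"
    proof (intro nn_integral_mono)
      fix s :: real
      show "(\<integral>\<^sup>+x. ennreal ((1 + s) powr b) * f ((1 + s) *\<^sub>R x) * indicator {0..1} s \<partial>lborel) \<le> D * indicator {0..1} s"
      proof (cases "s \<in> {0..1}")
        case True
        have "(\<integral>\<^sup>+x. ennreal ((1 + s) powr b) * f ((1 + s) *\<^sub>R x) \<partial>lborel) = ennreal ((1 + s) powr b) * (ennreal ((1 + s) powr (- n)) * D)"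
          unfolding n_def D_def f_def[symmetric] using True
          by (subst nn_integral_cmult, measurable) (subst nn_integral_dilate, auto)
        also have "\<dots> = ennreal ((1 + s) powr (b - n)) * D"
          by (simp add: mult.assoc[symmetric] ennreal_mult[symmetric] powr_add[symmetric])
        also have "\<dots> \<le> 1 * D"
        proof (intro mult_right_mono)
          have "(1 + s) powr (b - n) \<le> (1 + s) powr 0" using True b p by (intro powr_mono) (auto simp: n_def)
          then show "ennreal ((1 + s) powr (b - n)) \<le> 1" using True by (simp add: ennreal_le_1)
        qed simp
        finally show ?thesis using True by simp
      qed simp
    qed
    also have "\<dots> = D" by (simp add: nn_integral_cmult_indicator)
    finally show ?thesis .
  qed
  have mm: "(\<lambda>x. ennreal (\<bar>w (2 *\<^sub>R x)\<bar> powr p * norm x powr (- b - p))) \<in> borel_measurable lborel"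
      "(\<lambda>x. ennreal (\<bar>w x - w (2 *\<^sub>R x)\<bar> powr p * norm x powr (- b - p))) \<in> borel_measurable lborel"
    by measurable
  \<comment> \<open>With weight \<open>l\<close> the first term becomes \<open>l powr (1 - p) * (l powr p * F) = l * F\<close>.\<close>
  have "F \<le> (\<integral>\<^sup>+x. (ennreal (l powr (1 - p)) * ennreal (\<bar>w (2 *\<^sub>R x)\<bar> powr p * norm x powr (- b - p))
       + ennreal ((1 - l) powr (1 - p)) * ennreal (\<bar>w x - w (2 *\<^sub>R x)\<bar> powr p * norm x powr (- b - p))) \<partial>lborel)"
    unfolding F_def
  proof (intro nn_integral_mono)
    fix x :: 'a
    have "\<bar>w x\<bar> powr p \<le> (\<bar>w (2 *\<^sub>R x)\<bar> + \<bar>w x - w (2 *\<^sub>R x)\<bar>) powr p"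
      using p by (intro powr_mono2) auto
    also have "\<dots> \<le> l powr (1 - p) * \<bar>w (2 *\<^sub>R x)\<bar> powr p + (1 - l) powr (1 - p) * \<bar>w x - w (2 *\<^sub>R x)\<bar> powr p"
      by (rule powr_add_le_weighted) (use p l in auto)
    finally have "\<bar>w x\<bar> powr p * norm x powr (- b - p)
      \<le> (l powr (1 - p) * \<bar>w (2 *\<^sub>R x)\<bar> powr p + (1 - l) powr (1 - p) * \<bar>w x - w (2 *\<^sub>R x)\<bar> powr p) * norm x powr (- b - p)"
      by (intro mult_right_mono) auto
    then show "ennreal (\<bar>w x\<bar> powr p * norm x powr (- b - p))
      \<le> ennreal (l powr (1 - p)) * ennreal (\<bar>w (2 *\<^sub>R x)\<bar> powr p * norm x powr (- b - p))
       + ennreal ((1 - l) powr (1 - p)) * ennreal (\<bar>w x - w (2 *\<^sub>R x)\<bar> powr p * norm x powr (- b - p))"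
      by (simp add: ennreal_mult[symmetric] ennreal_plus[symmetric] algebra_simps del: ennreal_plus)
  qed
  also have "\<dots> = ennreal (l powr (1 - p)) * (ennreal (l powr p) * F)
      + ennreal ((1 - l) powr (1 - p)) * (\<integral>\<^sup>+x. ennreal (\<bar>w x - w (2 *\<^sub>R x)\<bar> powr p * norm x powr (- b - p)) \<partial>lborel)"
    unfolding dil[symmetric]
    by (rule nn_integral_lincomb[OF mm])
  also have "\<dots> \<le> ennreal (l powr (1 - p)) * (ennreal (l powr p) * F) + ennreal ((1 - l) powr (1 - p)) * D"
    by (intro add_mono mult_left_mono inc) auto
  also have "ennreal (l powr (1 - p)) * (ennreal (l powr p) * F) = ennreal l * F"
    using l by (simp add: mult.assoc[symmetric] ennreal_mult[symmetric] powr_add[symmetric])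
  finally have main: "F \<le> ennreal l * F + ennreal ((1 - l) powr (1 - p)) * D" .
  show ?thesis
  proof (cases "D = \<infinity>")
    case True
    then show ?thesis using l unfolding D_def[symmetric] by (simp add: ennreal_mult_top)
  next
    case False
    then obtain d where d: "D = ennreal d" "0 \<le> d" by (cases D) auto
    obtain f where f: "F = ennreal f" "0 \<le> f" using fin unfolding F_def[symmetric] by (cases F) auto
    have "f \<le> l * f + (1 - l) powr (1 - p) * d"
      using main l d f by (simp add: ennreal_mult[symmetric] ennreal_plus[symmetric] del: ennreal_plus)
    then have "(1 - l) * f \<le> (1 - l) powr (1 - p) * d" by (simp add: algebra_simps)
    moreover have "(1 - l) powr (1 - p) = (1 - l) * (1 - l) powr (- p)" using l
      by (simp add: powr_mult_base)
    ultimately have "(1 - l) * f \<le> (1 - l) * ((1 - l) powr (- p) * d)" by (simp add: mult_ac)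
    then have "f \<le> (1 - l) powr (- p) * d" using l by simp
    then show ?thesis unfolding F_def[symmetric] D_def[symmetric] d(1) f(1)
      using d by (simp add: ennreal_mult[symmetric] ennreal_leI)
  qed
qed

section \<open>Completions and compact embeddings\<close>

text \<open>The data from which a completion is formed; functions at distance zero are identified
  there.\<close>

locale function_seminorm =
  fixes V :: "('a \<Rightarrow> real) set" and nrm :: "('a \<Rightarrow> real) \<Rightarrow> real"
  assumes lincomb: "\<And>f g a b. f \<in> V \<Longrightarrow> g \<in> V \<Longrightarrow> (\<lambda>x. a * f x + b * g x) \<in> V"
    and nonneg: "\<And>f. f \<in> V \<Longrightarrow> 0 \<le> nrm f"
    and scale: "\<And>f c. f \<in> V \<Longrightarrow> nrm (\<lambda>x. c * f x) = \<bar>c\<bar> * nrm f"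
    and triangle: "\<And>f g. f \<in> V \<Longrightarrow> g \<in> V \<Longrightarrow> nrm (\<lambda>x. f x + g x) \<le> nrm f + nrm g"
begin

lemma diff_in: "f \<in> V \<Longrightarrow> g \<in> V \<Longrightarrow> (\<lambda>x. f x - g x) \<in> V"
  using lincomb[of f g 1 "-1"] by simp

lemma scale_in: "f \<in> V \<Longrightarrow> (\<lambda>x. c * f x) \<in> V"
  using lincomb[of f f c 0] by simp

lemma diff_commute:
  assumes "f \<in> V" "g \<in> V"
  shows "nrm (\<lambda>x. f x - g x) = nrm (\<lambda>x. g x - f x)"
  using scale[OF diff_in[OF assms], of "-1"] by (simp add: algebra_simps)

lemma diff_self: "f \<in> V \<Longrightarrow> nrm (\<lambda>x. f x - f x) = 0"
  using scale[of f 0] by simp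

lemma diff_triangle:
  assumes "f \<in> V" "g \<in> V" "h \<in> V"
  shows "nrm (\<lambda>x. f x - h x) \<le> nrm (\<lambda>x. f x - g x) + nrm (\<lambda>x. g x - h x)"
  using triangle[OF diff_in[OF assms(1,2)] diff_in[OF assms(2,3)]] by simp

lemma reverse_triangle:
  assumes "f \<in> V" "g \<in> V"
  shows "\<bar>nrm f - nrm g\<bar> \<le> nrm (\<lambda>x. f x - g x)"
proof -
  have "nrm f \<le> nrm (\<lambda>x. f x - g x) + nrm g"
    using triangle[OF diff_in[OF assms] assms(2)] by simp
  moreover have "nrm g \<le> nrm (\<lambda>x. f x - g x) + nrm f"
    using triangle[OF diff_in[OF assms(2,1)] assms(1)] diff_commute[OF assms] by simp
  ultimately show ?thesis by simp
qed

lemma norm_tendsto_zero: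
  assumes "\<And>n::nat. f n \<in> V" "\<And>n. nrm (f n) \<le> h n" "h \<longlonglongrightarrow> 0"
  shows "(\<lambda>n. nrm (f n)) \<longlonglongrightarrow> 0"
  by (rule Lim_null_comparison[OF _ assms(3)]) (use assms nonneg in \<open>auto intro!: always_eventually\<close>)

lemma cauchy_seqsD: "f \<in> cauchy_seqs V nrm \<Longrightarrow> f n \<in> V"
  by (simp add: cauchy_seqs_def)

lemma cauchy_seqs_convergent_norm:
  assumes "f \<in> cauchy_seqs V nrm"
  shows "convergent (\<lambda>n. nrm (f n))"
proof (rule Cauchy_convergent, rule metric_CauchyI)
  fix e :: real assume "0 < e"
  then obtain M where M: "\<And>m n. m \<ge> M \<Longrightarrow> n \<ge> M \<Longrightarrow> nrm (\<lambda>x. f m x - f n x) < e"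
    using assms unfolding cauchy_seqs_def by blast
  show "\<exists>M. \<forall>m\<ge>M. \<forall>n\<ge>M. dist (nrm (f m)) (nrm (f n)) < e"
  proof (intro exI[of _ M] allI impI)
    fix m n assume "M \<le> m" "M \<le> n"
    then show "dist (nrm (f m)) (nrm (f n)) < e"
      using M[of m n] reverse_triangle[OF cauchy_seqsD[OF assms] cauchy_seqsD[OF assms], of m n]
      by (simp add: dist_real_def)
  qed
qed

lemma lincomb_diff_le:
  assumes "f \<in> V" "g \<in> V" "f' \<in> V" "g' \<in> V"
  shows "nrm (\<lambda>x. (a * f x + b * g x) - (a * f' x + b * g' x))
    \<le> \<bar>a\<bar> * nrm (\<lambda>x. f x - f' x) + \<bar>b\<bar> * nrm (\<lambda>x. g x - g' x)"
proof -
  have "nrm (\<lambda>x. a * (f x - f' x) + b * (g x - g' x))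
     \<le> nrm (\<lambda>x. a * (f x - f' x)) + nrm (\<lambda>x. b * (g x - g' x))"
    using assms by (intro triangle scale_in diff_in)
  then show ?thesis
    using assms by (simp add: scale diff_in) (simp add: algebra_simps)
qed

lemma cauchy_seqs_lincomb:
  assumes f: "f \<in> cauchy_seqs V nrm" and g: "g \<in> cauchy_seqs V nrm"
  shows "(\<lambda>n x. a * f n x + b * g n x) \<in> cauchy_seqs V nrm"
  unfolding cauchy_seqs_def mem_Collect_eq
proof (intro conjI allI impI)
  show "(\<lambda>x. a * f n x + b * g n x) \<in> V" for n
    using f g by (intro lincomb cauchy_seqsD)
  fix e :: real assume e: "0 < e"
  define d where "d = e / (\<bar>a\<bar> + \<bar>b\<bar> + 1)"
  have d: "d > 0" "(\<bar>a\<bar> + \<bar>b\<bar>) * d < e"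
    using e by (auto simp: d_def field_simps)
  obtain M where M: "\<And>m n. m \<ge> M \<Longrightarrow> n \<ge> M \<Longrightarrow> nrm (\<lambda>x. f m x - f n x) < d"
    using f d unfolding cauchy_seqs_def by blast
  obtain M' where M': "\<And>m n. m \<ge> M' \<Longrightarrow> n \<ge> M' \<Longrightarrow> nrm (\<lambda>x. g m x - g n x) < d"
    using g d unfolding cauchy_seqs_def by blast
  show "\<exists>M. \<forall>m\<ge>M. \<forall>n\<ge>M. nrm (\<lambda>x. a * f m x + b * g m x - (a * f n x + b * g n x)) < e"
  proof (intro exI[of _ "max M M'"] allI impI)
    fix m n assume mn: "max M M' \<le> m" "max M M' \<le> n"
    have "nrm (\<lambda>x. a * f m x + b * g m x - (a * f n x + b * g n x))
       \<le> \<bar>a\<bar> * nrm (\<lambda>x. f m x - f n x) + \<bar>b\<bar> * nrm (\<lambda>x. g m x - g n x)"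
      using f g by (intro lincomb_diff_le cauchy_seqsD)
    also have "\<dots> \<le> \<bar>a\<bar> * d + \<bar>b\<bar> * d"
      using M[of m n] M'[of m n] mn by (intro add_mono mult_left_mono) auto
    also have "\<dots> < e" using d by (simp add: algebra_simps)
    finally show "nrm (\<lambda>x. a * f m x + b * g m x - (a * f n x + b * g n x)) < e" .
  qed
qed

lemma equiv_null_rel: "equiv (cauchy_seqs V nrm) (null_rel V nrm)"
proof (rule equivI)
  show "null_rel V nrm \<subseteq> cauchy_seqs V nrm \<times> cauchy_seqs V nrm" by (auto simp: null_rel_def)
  show "refl_on (cauchy_seqs V nrm) (null_rel V nrm)"
    by (auto simp: refl_on_def null_rel_def diff_self[OF cauchy_seqsD, simplified])
  show "sym (null_rel V nrm)"
    by (rule symI) (auto simp: null_rel_def diff_commute[OF cauchy_seqsD cauchy_seqsD])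
  show "trans (null_rel V nrm)"
  proof (rule transI)
    fix f g h assume fg: "(f, g) \<in> null_rel V nrm" and gh: "(g, h) \<in> null_rel V nrm"
    have V: "f n \<in> V" "g n \<in> V" "h n \<in> V" for n
      using fg gh by (auto simp: null_rel_def intro: cauchy_seqsD)
    have "(\<lambda>n. nrm (\<lambda>x. f n x - g n x) + nrm (\<lambda>x. g n x - h n x)) \<longlonglongrightarrow> 0 + 0"
      using fg gh by (intro tendsto_add) (auto simp: null_rel_def)
    then have "(\<lambda>n. nrm (\<lambda>x. f n x - h n x)) \<longlonglongrightarrow> 0"
      by (intro norm_tendsto_zero[OF diff_in[OF V(1,3)] diff_triangle[OF V]]) simp
    then show "(f, h) \<in> null_rel V nrm" using fg gh by (simp add: null_rel_def)
  qed
qed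

lemma completion_memD:
  assumes "X \<in> completion V nrm" "f \<in> X"
  shows "f \<in> cauchy_seqs V nrm" "X = null_rel V nrm `` {f}"
proof -
  obtain g where g: "g \<in> cauchy_seqs V nrm" "X = null_rel V nrm `` {g}"
    using assms(1) unfolding completion_def by (rule quotientE)
  then have "(g, f) \<in> null_rel V nrm" using assms(2) by simp
  then show "f \<in> cauchy_seqs V nrm" "X = null_rel V nrm `` {f}"
    using g equiv_class_eq[OF equiv_null_rel] by (auto simp: null_rel_def)
qed

lemma completion_class:
  assumes "f \<in> cauchy_seqs V nrm"
  shows "null_rel V nrm `` {f} \<in> completion V nrm" "f \<in> null_rel V nrm `` {f}"
  using assms quotientI[of f "cauchy_seqs V nrm"] equiv_class_self[OF equiv_null_rel]
  by (auto simp: completion_def)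

lemma completion_nonempty: "X \<in> completion V nrm \<Longrightarrow> \<exists>f. f \<in> X"
  unfolding completion_def by (metis completion_class(2) quotientE)

lemma null_rel_norm_limit:
  assumes "(f, g) \<in> null_rel V nrm" "(\<lambda>n. nrm (f n)) \<longlonglongrightarrow> r"
  shows "(\<lambda>n. nrm (g n)) \<longlonglongrightarrow> r"
proof -
  have "(\<lambda>n. nrm (f n) - nrm (g n)) \<longlonglongrightarrow> 0"
  proof (rule Lim_null_comparison)
    show "\<forall>\<^sub>F n in sequentially. norm (nrm (f n) - nrm (g n)) \<le> nrm (\<lambda>x. f n x - g n x)"
      using assms(1) by (auto simp: null_rel_def intro!: always_eventually reverse_triangle dest: cauchy_seqsD)
    show "(\<lambda>n. nrm (\<lambda>x. f n x - g n x)) \<longlonglongrightarrow> 0" using assms(1) by (simp add: null_rel_def)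
  qed
  from tendsto_diff[OF assms(2) this] show ?thesis by simp
qed

text \<open>The definite description in \<open>compl_norm\<close> is meaningful because equivalent Cauchy
  sequences have the same limit of norms.\<close>

lemma compl_norm_limit:
  assumes X: "X \<in> completion V nrm" and f: "f \<in> X"
  shows "(\<lambda>n. nrm (f n)) \<longlonglongrightarrow> compl_norm nrm X"
proof -
  obtain r where r: "(\<lambda>n. nrm (f n)) \<longlonglongrightarrow> r"
    using cauchy_seqs_convergent_norm[OF completion_memD(1)[OF assms]] by (auto simp: convergent_def)
  have all: "(\<lambda>n. nrm (g n)) \<longlonglongrightarrow> r" if "g \<in> X" for g
    using that completion_memD(2)[OF assms] null_rel_norm_limit[OF _ r] by auto
  have "compl_norm nrm X = r"
    unfolding compl_norm_def
    by (rule the_equality) (use all f LIMSEQ_unique in blast)+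
  then show ?thesis using r by simp
qed

lemma compl_lincomb_class:
  assumes X: "X \<in> completion V nrm" "f \<in> X" and Y: "Y \<in> completion V nrm" "g \<in> Y"
  shows "compl_lincomb V nrm a X b Y = null_rel V nrm `` {\<lambda>n x. a * f n x + b * g n x}"
proof -
  have "null_rel V nrm `` {\<lambda>n x. a * f' n x + b * g' n x} = null_rel V nrm `` {\<lambda>n x. a * f n x + b * g n x}"
    if "f' \<in> X" "g' \<in> Y" for f' g'
  proof (rule equiv_class_eq[OF equiv_null_rel])
    have ff: "(f', f) \<in> null_rel V nrm" "(g', g) \<in> null_rel V nrm"
      using completion_memD(2)[OF X(1) that(1)] completion_memD(2)[OF Y(1) that(2)] X Y by auto
    then have c: "f' \<in> cauchy_seqs V nrm" "f \<in> cauchy_seqs V nrm" "g' \<in> cauchy_seqs V nrm" "g \<in> cauchy_seqs V nrm"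
      by (auto simp: null_rel_def)
    have "(\<lambda>n. \<bar>a\<bar> * nrm (\<lambda>x. f' n x - f n x) + \<bar>b\<bar> * nrm (\<lambda>x. g' n x - g n x)) \<longlonglongrightarrow> \<bar>a\<bar> * 0 + \<bar>b\<bar> * 0"
      using ff by (intro tendsto_intros) (auto simp: null_rel_def)
    then have "(\<lambda>n. nrm (\<lambda>x. a * f' n x + b * g' n x - (a * f n x + b * g n x))) \<longlonglongrightarrow> 0"
      by (intro norm_tendsto_zero[OF _ lincomb_diff_le] diff_in lincomb cauchy_seqsD c) simp
    then show "(\<lambda>n x. a * f' n x + b * g' n x, \<lambda>n x. a * f n x + b * g n x) \<in> null_rel V nrm"
      using c by (simp add: null_rel_def cauchy_seqs_lincomb)
  qed
  then show ?thesis unfolding compl_lincomb_def using X(2) Y(2) by blast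
qed

end

text \<open>Sequential precompactness forces a bound \<open>n2 u \<le> C * n1 u\<close>: otherwise rescaling produces
  an \<open>n1\<close>-bounded sequence on which \<open>n2\<close> tends to infinity along every subsequence. Hence
  Cauchy sequences and null sequences transfer from \<open>n1\<close> to \<open>n2\<close> and the induced map is well
  defined. For compactness each class is replaced by a late term of one of its
  representatives, which is a single element of \<open>V\<close>.\<close>

lemma compact_embeddingI:
  assumes 1: "function_seminorm V n1" and 2: "function_seminorm V n2"
    and comp: "\<And>u :: nat \<Rightarrow> 'a \<Rightarrow> real. (\<And>k. u k \<in> V) \<Longrightarrow> (\<exists>B. \<forall>k. n1 (u k) \<le> B) \<Longrightarrow>
        \<exists>r :: nat \<Rightarrow> nat. strict_mono r \<and> (\<lambda>k. u (r k)) \<in> cauchy_seqs V n2"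
    and clos: "\<And>u. u \<in> cauchy_seqs V n1 \<Longrightarrow> (\<lambda>k. n2 (u k)) \<longlonglongrightarrow> 0 \<Longrightarrow> (\<lambda>k. n1 (u k)) \<longlonglongrightarrow> 0"
  shows "compact_embedding V n1 n2"
proof -
  interpret N1: function_seminorm V n1 by fact
  interpret N2: function_seminorm V n2 by fact
  have "\<exists>C. \<forall>u\<in>V. n2 u \<le> C * n1 u"
  proof (rule ccontr)
    assume neg: "\<not> ?thesis"
    have "\<exists>w\<in>V. n1 w \<le> 1 \<and> real k \<le> n2 w" for k :: nat
    proof -
      obtain u where u: "u \<in> V" "n2 u > real k * n1 u"
        using neg by (meson not_le)
      show ?thesis
      proof (cases "n1 u = 0")
        case True
        then have "n2 u > 0" using u by simp
        then show ?thesis using u True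
          using N1.scale[OF u(1), of "real k / n2 u"] N2.scale[OF u(1), of "real k / n2 u"]
            nonzero_divide_eq_eq[of "n2 u" "real k" "real k / n2 u"]
          by (intro bexI[of _ "\<lambda>x. (real k / n2 u) * u x"] N1.scale_in)
             (simp_all del: times_divide_eq_left)
      next
        case False
        have "n1 u > 0" using N1.nonneg[OF u(1)] False by simp
        have "n1 (\<lambda>x. (1 / n1 u) * u x) \<le> 1"
          unfolding N1.scale[OF u(1)] using \<open>n1 u > 0\<close> by simp
        moreover have "real k \<le> n2 (\<lambda>x. (1 / n1 u) * u x)"
          unfolding N2.scale[OF u(1)] using \<open>n1 u > 0\<close> u(2) by (simp add: field_simps)
        ultimately show ?thesis using N1.scale_in[OF u(1)] by blast
      qed
    qed
    then obtain w where w: "\<And>k. w k \<in> V" "\<And>k. n1 (w k) \<le> 1" "\<And>k. real k \<le> n2 (w k)" by metis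
    obtain r where r: "strict_mono r" "(\<lambda>k. w (r k)) \<in> cauchy_seqs V n2"
      using comp[of w] w by blast
    have "convergent (\<lambda>k. n2 (w (r k)))"
      using N2.cauchy_seqs_convergent_norm[OF r(2)] by simp
    then have "Bseq (\<lambda>k. n2 (w (r k)))" by (rule convergent_imp_Bseq)
    then obtain B where "\<And>k. norm (n2 (w (r k))) \<le> B" unfolding Bseq_def by blast
    then have B: "n2 (w (r k)) \<le> B" for k by (metis abs_le_D1 real_norm_def)
    obtain k :: nat where "B < real k" using reals_Archimedean2 by blast
    also have "real k \<le> real (r k)" using seq_suble[OF r(1)] by simp
    also have "\<dots> \<le> n2 (w (r k))" by (rule w)
    also have "\<dots> \<le> B" by (rule B)
    finally show False by simp
  qed
  then obtain C0 where C0: "\<And>u. u \<in> V \<Longrightarrow> n2 u \<le> C0 * n1 u" by blast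
  define C where "C = max C0 1"
  have C: "C > 0" "\<And>u. u \<in> V \<Longrightarrow> n2 u \<le> C * n1 u"
  proof -
    show "C > 0" by (simp add: C_def)
    fix u assume u: "u \<in> V"
    have "C0 * n1 u \<le> C * n1 u" using N1.nonneg[OF u] by (intro mult_right_mono) (auto simp: C_def)
    then show "n2 u \<le> C * n1 u" using C0[OF u] by simp
  qed
  have cauchy: "f \<in> cauchy_seqs V n2" if f: "f \<in> cauchy_seqs V n1" for f
    unfolding cauchy_seqs_def mem_Collect_eq
  proof (intro conjI allI impI)
    show "f n \<in> V" for n using f by (rule N1.cauchy_seqsD)
    fix e :: real assume "0 < e"
    then have "e / C > 0" using C by simp
    then obtain M where M: "\<And>m n. m \<ge> M \<Longrightarrow> n \<ge> M \<Longrightarrow> n1 (\<lambda>x. f m x - f n x) < e / C"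
      using f unfolding cauchy_seqs_def by blast
    show "\<exists>M. \<forall>m\<ge>M. \<forall>n\<ge>M. n2 (\<lambda>x. f m x - f n x) < e"
    proof (intro exI[of _ M] allI impI)
      fix m n assume "M \<le> m" "M \<le> n"
      then have "C * n1 (\<lambda>x. f m x - f n x) < e" using M[of m n] C(1) by (simp add: field_simps)
      then show "n2 (\<lambda>x. f m x - f n x) < e"
        using C(2)[OF N1.diff_in[OF N1.cauchy_seqsD[OF f] N1.cauchy_seqsD[OF f]], of m n] by simp
    qed
  qed
  have null: "(f, g) \<in> null_rel V n2" if fg: "(f, g) \<in> null_rel V n1" for f g
  proof -
    have c: "f \<in> cauchy_seqs V n1" "g \<in> cauchy_seqs V n1" using fg by (auto simp: null_rel_def)
    have "(\<lambda>n. C * n1 (\<lambda>x. f n x - g n x)) \<longlonglongrightarrow> C * 0"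
      using fg by (intro tendsto_intros) (simp add: null_rel_def)
    then have "(\<lambda>n. n2 (\<lambda>x. f n x - g n x)) \<longlonglongrightarrow> 0"
      by (intro N2.norm_tendsto_zero[OF _ C(2)] N1.diff_in N1.cauchy_seqsD c) simp
    then show ?thesis using cauchy c by (simp add: null_rel_def)
  qed
  define \<iota> where "\<iota> = induced_map V n2"
  have \<iota>: "\<iota> X = null_rel V n2 `` {f}" if X: "X \<in> completion V n1" "f \<in> X" for X f
  proof -
    have "(f, g) \<in> null_rel V n2" if "g \<in> X" for g
      using that N1.completion_memD(2)[OF X] null by auto
    then have "null_rel V n2 `` {g} = null_rel V n2 `` {f}" if "g \<in> X" for g
      using that equiv_class_eq[OF N2.equiv_null_rel] by blast
    then show ?thesis using X(2) unfolding \<iota>_def induced_map_def by blast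
  qed
  have \<iota>_in: "\<iota> X \<in> completion V n2" "f \<in> \<iota> X" if "X \<in> completion V n1" "f \<in> X" for X f
    using \<iota>[OF that] N2.completion_class[OF cauchy[OF N1.completion_memD(1)[OF that]]] by auto
  show ?thesis
    unfolding compact_embedding_def Let_def \<iota>_def[symmetric]
  proof (intro conjI)
    show "\<iota> \<in> completion V n1 \<rightarrow> completion V n2"
      using \<iota>_in(1) N1.completion_nonempty by blast
    show "inj_on \<iota> (completion V n1)"
    proof (rule inj_onI)
      fix X Y assume X: "X \<in> completion V n1" and Y: "Y \<in> completion V n1" and eq: "\<iota> X = \<iota> Y"
      obtain f g where f: "f \<in> X" and g: "g \<in> Y" using N1.completion_nonempty X Y by metis
      have fc: "f \<in> cauchy_seqs V n1" and gc: "g \<in> cauchy_seqs V n1"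
        using N1.completion_memD(1) X Y f g by auto
      have "f \<in> null_rel V n2 `` {g}" using eq \<iota>_in(2)[OF X f] \<iota>[OF Y g] by simp
      then have "(\<lambda>n. n2 (\<lambda>x. g n x - f n x)) \<longlonglongrightarrow> 0" by (simp add: null_rel_def)
      moreover have "(\<lambda>n x. g n x - f n x) \<in> cauchy_seqs V n1"
        using N1.cauchy_seqs_lincomb[OF gc fc, of 1 "-1"] by simp
      ultimately have "(\<lambda>n. n1 (\<lambda>x. g n x - f n x)) \<longlonglongrightarrow> 0" by (rule clos[rotated])
      then have "(g, f) \<in> null_rel V n1" using fc gc by (simp add: null_rel_def)
      then show "X = Y"
        using N1.completion_memD(2)[OF X f] N1.completion_memD(2)[OF Y g] equiv_class_eq[OF N1.equiv_null_rel] by metis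
    qed
    show "\<forall>X\<in>completion V n1. \<forall>Y\<in>completion V n1. \<forall>a b.
        \<iota> (compl_lincomb V n1 a X b Y) = compl_lincomb V n2 a (\<iota> X) b (\<iota> Y)"
    proof (intro ballI allI)
      fix X Y a b assume X: "X \<in> completion V n1" and Y: "Y \<in> completion V n1"
      obtain f g where f: "f \<in> X" and g: "g \<in> Y" using N1.completion_nonempty X Y by metis
      have c: "(\<lambda>n x. a * f n x + b * g n x) \<in> cauchy_seqs V n1"
        using N1.completion_memD(1) X Y f g by (intro N1.cauchy_seqs_lincomb) auto
      have "\<iota> (compl_lincomb V n1 a X b Y) = null_rel V n2 `` {\<lambda>n x. a * f n x + b * g n x}"
        unfolding N1.compl_lincomb_class[OF X f Y g] by (rule \<iota>[OF N1.completion_class[OF c]])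
      also have "\<dots> = compl_lincomb V n2 a (\<iota> X) b (\<iota> Y)"
        by (rule N2.compl_lincomb_class[OF \<iota>_in[OF X f] \<iota>_in[OF Y g], symmetric])
      finally show "\<iota> (compl_lincomb V n1 a X b Y) = compl_lincomb V n2 a (\<iota> X) b (\<iota> Y)" .
    qed
    show "\<exists>C. \<forall>X\<in>completion V n1. compl_norm n2 (\<iota> X) \<le> C * compl_norm n1 X"
    proof (intro exI[of _ C] ballI)
      fix X assume X: "X \<in> completion V n1"
      obtain f where f: "f \<in> X" using N1.completion_nonempty X by metis
      show "compl_norm n2 (\<iota> X) \<le> C * compl_norm n1 X"
      proof (rule LIMSEQ_le)
        show "(\<lambda>n. n2 (f n)) \<longlonglongrightarrow> compl_norm n2 (\<iota> X)"
          by (rule N2.compl_norm_limit[OF \<iota>_in[OF X f]])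
        show "(\<lambda>n. C * n1 (f n)) \<longlonglongrightarrow> C * compl_norm n1 X"
          by (intro tendsto_intros N1.compl_norm_limit[OF X f])
        show "\<exists>N. \<forall>n\<ge>N. n2 (f n) \<le> C * n1 (f n)"
          using C(2) N1.cauchy_seqsD[OF N1.completion_memD(1)[OF X f]] by blast
      qed
    qed
    show "\<forall>X. (\<forall>k. X k \<in> completion V n1) \<and> (\<exists>B. \<forall>k. compl_norm n1 (X k) \<le> B) \<longrightarrow>
        (\<exists>r :: nat \<Rightarrow> nat. strict_mono r \<and>
           (\<exists>Y\<in>completion V n2. (\<lambda>k. compl_dist V n2 (\<iota> (X (r k))) Y) \<longlonglongrightarrow> 0))"
    proof (intro allI impI, elim conjE exE)
      fix X :: "nat \<Rightarrow> (nat \<Rightarrow> 'a \<Rightarrow> real) set" and B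
      assume X: "\<forall>k. X k \<in> completion V n1" and B: "\<forall>k. compl_norm n1 (X k) \<le> B"
      have "\<forall>k. \<exists>f. f \<in> X k" using N1.completion_nonempty X by blast
      from choice[OF this] obtain f where f: "\<And>k. f k \<in> X k" by blast
      have c1: "f k \<in> cauchy_seqs V n1" for k using N1.completion_memD(1) X f by blast
      have "\<exists>m. n1 (f k m) \<le> B + 1 \<and> (\<forall>n\<ge>m. n2 (\<lambda>x. f k n x - f k m x) \<le> 1 / real (Suc k))" for k
      proof -
        have "(\<lambda>n. n1 (f k n)) \<longlonglongrightarrow> compl_norm n1 (X k)" using N1.compl_norm_limit X f by blast
        then have "\<forall>\<^sub>F n in sequentially. n1 (f k n) < B + 1"
          by (rule order_tendstoD) (use B in \<open>smt (verit)\<close>)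
        then obtain M where M: "\<And>n. n \<ge> M \<Longrightarrow> n1 (f k n) < B + 1" by (auto simp: eventually_sequentially)
        have "1 / real (Suc k) > 0" by simp
        then obtain M' where M': "\<And>m n. m \<ge> M' \<Longrightarrow> n \<ge> M' \<Longrightarrow> n2 (\<lambda>x. f k m x - f k n x) < 1 / real (Suc k)"
          using cauchy[OF c1[of k]] unfolding cauchy_seqs_def by blast
        show ?thesis
          using M[of "max M M'"] M'[of _ "max M M'"] by (intro exI[of _ "max M M'"]) (auto intro: less_imp_le)
      qed
      then obtain N where N: "\<And>k. n1 (f k (N k)) \<le> B + 1"
        "\<And>k n. n \<ge> N k \<Longrightarrow> n2 (\<lambda>x. f k n x - f k (N k) x) \<le> 1 / real (Suc k)" by metis
      define g where "g k = f k (N k)" for k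
      have gV: "g k \<in> V" for k unfolding g_def by (rule N1.cauchy_seqsD[OF c1])
      obtain r where r: "strict_mono r" "(\<lambda>k. g (r k)) \<in> cauchy_seqs V n2"
        using comp[of g] gV N(1) unfolding g_def[symmetric] by blast
      define Y where "Y = null_rel V n2 `` {\<lambda>k. g (r k)}"
      have Y: "Y \<in> completion V n2" "(\<lambda>k. g (r k)) \<in> Y"
        unfolding Y_def by (rule N2.completion_class[OF r(2)])+
      have dist_limit: "(\<lambda>n. n2 (\<lambda>x. f (r k) n x - g (r n) x)) \<longlonglongrightarrow> compl_dist V n2 (\<iota> (X (r k))) Y" for k
      proof -
        have Xk: "\<iota> (X (r k)) \<in> completion V n2" "f (r k) \<in> \<iota> (X (r k))" using \<iota>_in X f by blast+
        have c: "(\<lambda>n x. 1 * f (r k) n x + (- 1) * g (r n) x) \<in> cauchy_seqs V n2"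
          using cauchy[OF c1] r(2) by (rule N2.cauchy_seqs_lincomb)
        have "(\<lambda>n. n2 (\<lambda>x. 1 * f (r k) n x + (- 1) * g (r n) x)) \<longlonglongrightarrow> compl_dist V n2 (\<iota> (X (r k))) Y"
          unfolding compl_dist_def N2.compl_lincomb_class[OF Xk Y]
          by (rule N2.compl_norm_limit[OF N2.completion_class[OF c]])
        then show ?thesis by simp
      qed
      have "(\<lambda>k. compl_dist V n2 (\<iota> (X (r k))) Y) \<longlonglongrightarrow> 0"
      proof (rule LIMSEQ_I)
        fix e :: real assume e: "0 < e"
        then have "e / 4 > 0" by simp
        then obtain M where M: "\<And>m n. m \<ge> M \<Longrightarrow> n \<ge> M \<Longrightarrow> n2 (\<lambda>x. g (r m) x - g (r n) x) < e / 4"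
          using r(2) unfolding cauchy_seqs_def by blast
        obtain K :: nat where K: "1 / real (Suc K) < e / 4"
          using nat_approx_posE[OF \<open>e / 4 > 0\<close>] by blast
        show "\<exists>no. \<forall>k\<ge>no. norm (compl_dist V n2 (\<iota> (X (r k))) Y - 0) < e"
        proof (intro exI[of _ "max M K"] allI impI)
          fix k assume k: "max M K \<le> k"
          have rk: "K \<le> r k" using seq_suble[OF r(1), of k] k by simp
          have ev: "n2 (\<lambda>x. f (r k) n x - g (r n) x) \<le> e / 2" if n: "n \<ge> max M (N (r k))" for n
          proof -
            have "n2 (\<lambda>x. f (r k) n x - g (r n) x)
              \<le> n2 (\<lambda>x. f (r k) n x - g (r k) x) + n2 (\<lambda>x. g (r k) x - g (r n) x)"
              by (intro N2.diff_triangle gV N1.cauchy_seqsD[OF c1])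
            also have "n2 (\<lambda>x. f (r k) n x - g (r k) x) \<le> 1 / real (Suc (r k))"
              unfolding g_def using n by (intro N(2)) simp
            also have "\<dots> \<le> 1 / real (Suc K)" using rk by (intro divide_left_mono) auto
            finally show ?thesis using M[of k n] K k n by simp
          qed
          have "compl_dist V n2 (\<iota> (X (r k))) Y \<le> e / 2"
            by (rule LIMSEQ_le_const2[OF dist_limit]) (use ev in blast)
          moreover have "0 \<le> compl_dist V n2 (\<iota> (X (r k))) Y"
            by (rule LIMSEQ_le_const[OF dist_limit])
               (use N2.nonneg[OF N2.diff_in[OF N1.cauchy_seqsD[OF c1] gV]] in blast)
          ultimately show "norm (compl_dist V n2 (\<iota> (X (r k))) Y - 0) < e" using e by simp
        qed
      qed
      then show "\<exists>r :: nat \<Rightarrow> nat. strict_mono r \<and>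
           (\<exists>Y\<in>completion V n2. (\<lambda>k. compl_dist V n2 (\<iota> (X (r k))) Y) \<longlonglongrightarrow> 0)"
        using r(1) Y(1) by blast
    qed
  qed
qed

section \<open>Kolmogorov compactness\<close>

text \<open>Diagonal sequence: total boundedness, stated with subsequences, gives Cauchy
  subsequences.\<close>

lemma cauchy_subsequence_of_small_subsequences:
  fixes d :: "'b \<Rightarrow> 'b \<Rightarrow> real" and u :: "nat \<Rightarrow> 'b"
  assumes small: "\<And>e (s :: nat \<Rightarrow> nat). 0 < e \<Longrightarrow> strict_mono s \<Longrightarrow>
     \<exists>r :: nat \<Rightarrow> nat. strict_mono r \<and> (\<exists>N. \<forall>m\<ge>N. \<forall>n\<ge>N. d (u (s (r m))) (u (s (r n))) < e)"
  shows "\<exists>r :: nat \<Rightarrow> nat. strict_mono r \<and> (\<forall>e>0. \<exists>N. \<forall>m\<ge>N. \<forall>n\<ge>N. d (u (r m)) (u (r n)) < e)"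
proof -
  define P where "P k s \<longleftrightarrow> (\<exists>N. \<forall>m\<ge>N. \<forall>n\<ge>N. d (u (s m)) (u (s n)) < 1 / real (Suc k))" for k and s :: "nat \<Rightarrow> nat"
  interpret D: subseqs P
  proof
    fix k and s :: "nat \<Rightarrow> nat" assume "strict_mono s"
    with small[of "1 / real (Suc k)" s] show "\<exists>r'. strict_mono r' \<and> P k (s \<circ> r')"
      by (simp add: P_def o_def)
  qed
  have diag: "P k (D.diagseq \<circ> ((+) (Suc k)))" for k
  proof (rule D.diagseq_holds)
    fix r s :: "nat \<Rightarrow> nat" and n assume r: "strict_mono r" and "P n s"
    then obtain N where N: "\<And>m m'. m \<ge> N \<Longrightarrow> m' \<ge> N \<Longrightarrow> d (u (s m)) (u (s m')) < 1 / real (Suc n)"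
      unfolding P_def by blast
    then show "P n (s \<circ> r)"
      unfolding P_def using seq_suble[OF r] by (intro exI[of _ N]) (auto intro!: N order_trans[OF _ seq_suble[OF r]])
  qed
  have "\<exists>N. \<forall>m\<ge>N. \<forall>n\<ge>N. d (u (D.diagseq m)) (u (D.diagseq n)) < e" if e: "e > 0" for e
  proof -
    obtain k :: nat where k: "1 / real (Suc k) < e" using nat_approx_posE[OF e] by blast
    from diag[of k] obtain N where
      N: "\<And>m n. m \<ge> N \<Longrightarrow> n \<ge> N \<Longrightarrow> d (u (D.diagseq (Suc k + m))) (u (D.diagseq (Suc k + n))) < 1 / real (Suc k)"
      unfolding P_def o_def by blast
    show ?thesis
    proof (intro exI[of _ "Suc k + N"] allI impI)
      fix m n assume "Suc k + N \<le> m" "Suc k + N \<le> n"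
      then have "N \<le> m - Suc k" "N \<le> n - Suc k" "Suc k \<le> m" "Suc k \<le> n" by arith+
      then show "d (u (D.diagseq m)) (u (D.diagseq n)) < e"
        using N[of "m - Suc k" "n - Suc k"] k by simp
    qed
  qed
  then show ?thesis using D.subseq_diagseq by blast
qed

lemma set_integrable_of_powr:
  fixes g :: "'a \<Rightarrow> real"
  assumes p: "1 \<le> p" and [measurable]: "g \<in> borel_measurable M" "S \<in> sets M"
    and S: "emeasure M S < \<infinity>" and fin: "(\<integral>\<^sup>+x. ennreal (\<bar>g x\<bar> powr p) * indicator S x \<partial>M) < \<infinity>"
  shows "set_integrable M S g"
  unfolding set_integrable_def
proof (rule integrableI_bounded)
  have "(\<integral>\<^sup>+x. ennreal (norm (indicator S x *\<^sub>R g x)) \<partial>M)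
    \<le> (\<integral>\<^sup>+x. (indicator S x + ennreal (\<bar>g x\<bar> powr p) * indicator S x) \<partial>M)"
  proof (intro nn_integral_mono)
    fix x
    have "\<bar>g x\<bar> \<le> 1 + \<bar>g x\<bar> powr p"
    proof (cases "\<bar>g x\<bar> \<le> 1")
      case False
      then have "\<bar>g x\<bar> powr 1 \<le> \<bar>g x\<bar> powr p" using p by (intro powr_mono) auto
      then show ?thesis by simp
    qed (simp add: add_increasing2)
    then have "ennreal \<bar>g x\<bar> \<le> 1 + ennreal (\<bar>g x\<bar> powr p)"
      by (simp flip: ennreal_1 ennreal_plus add: ennreal_leI)
    then show "ennreal (norm (indicator S x *\<^sub>R g x)) \<le> indicator S x + ennreal (\<bar>g x\<bar> powr p) * indicator S x"
      by (auto split: split_indicator)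
  qed
  also have "\<dots> = emeasure M S + (\<integral>\<^sup>+x. ennreal (\<bar>g x\<bar> powr p) * indicator S x \<partial>M)"
    by (subst nn_integral_add) auto
  also have "\<dots> < \<infinity>" using S fin by simp
  finally show "(\<integral>\<^sup>+x. ennreal (norm (indicator S x *\<^sub>R g x)) \<partial>M) < \<infinity>" .
qed measurable

lemma average_powr_bound:
  fixes g :: "'a \<Rightarrow> real"
  assumes p: "1 \<le> p" and g: "g \<in> borel_measurable M" and S: "S \<in> sets M"
    and c: "emeasure M S = ennreal c" "0 < c"
  shows "ennreal (\<bar>(LINT x:S|M. g x) / c\<bar> powr p) \<le> ennreal (1 / c) * (\<integral>\<^sup>+x. ennreal (\<bar>g x\<bar> powr p) * indicator S x \<partial>M)"
proof -
  have "ennreal (\<bar>(LINT x:S|M. g x) / c\<bar> powr p) = ennreal (c powr (- p)) * ennreal (\<bar>LINT x:S|M. g x\<bar> powr p)"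
    using c by (simp add: powr_divide powr_minus ennreal_mult[symmetric] divide_inverse mult.commute abs_mult abs_inverse inverse_powr powr_mult)
  also have "\<dots> \<le> ennreal (c powr (- p)) * (ennreal (c powr (p - 1)) * (\<integral>\<^sup>+x. ennreal (\<bar>g x\<bar> powr p) * indicator S x \<partial>M))"
    by (intro mult_left_mono jensen_powr assms) auto
  also have "\<dots> = ennreal (c powr (- p) * c powr (p - 1)) * (\<integral>\<^sup>+x. ennreal (\<bar>g x\<bar> powr p) * indicator S x \<partial>M)"
    by (simp add: ennreal_mult mult.assoc)
  also have "c powr (- p) * c powr (p - 1) = 1 / c"
  proof -
    have "c powr (- p) * c powr (p - 1) = c powr (- 1)" by (simp only: powr_add[symmetric]) simp
    then show ?thesis using c by (simp add: powr_minus divide_inverse)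
  qed
  finally show ?thesis .
qed

text \<open>The averages of the \<open>f n\<close> over balls of a fixed small radius \<open>h\<close> are bounded and
  uniformly Lipschitz on compact sets, so some subsequence of them converges uniformly. By the
  translation bound, averaging a difference changes it only by order \<open>h\<close> in \<open>L\<^sup>p\<close>.\<close>

lemma kolmogorov_small_subsequence:
  fixes f :: "nat \<Rightarrow> 'a::euclidean_space \<Rightarrow> real" and p G \<epsilon> \<rho> :: real
  assumes p: "1 \<le> p" and meas[measurable]: "\<And>n. f n \<in> borel_measurable borel"
    and bound: "\<And>R. \<exists>H. \<forall>n. (\<integral>\<^sup>+x. ennreal (\<bar>f n x\<bar> powr p) * indicator (cball 0 R) x \<partial>lborel) \<le> ennreal H"
    and trans: "\<And>n y. (\<integral>\<^sup>+x. ennreal (\<bar>f n (x + y) - f n x\<bar> powr p) \<partial>lborel) \<le> ennreal (G * norm y powr p)"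
    and G: "0 \<le> G" and \<epsilon>: "0 < \<epsilon>"
  shows "\<exists>r :: nat \<Rightarrow> nat. strict_mono r \<and> (\<exists>N. \<forall>m\<ge>N. \<forall>n\<ge>N.
     (\<integral>\<^sup>+x. ennreal (\<bar>f (r m) x - f (r n) x\<bar> powr p) * indicator (cball 0 \<rho>) x \<partial>lborel) \<le> ennreal \<epsilon>)"
proof -
  define G' where "G' = 2 powr p * (G + G)"
  have G': "G' \<ge> 0" using G by (simp add: G'_def)
  define h where "h = (\<epsilon> / (2 * 2 powr p * (G' + 1))) powr (1 / p)"
  have h: "h > 0" using \<epsilon> G' by (simp add: h_def)
  have hp: "2 powr p * (G' * h powr p) \<le> \<epsilon> / 2"
  proof -
    have "h powr p = \<epsilon> / (2 * 2 powr p * (G' + 1))"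
      using p \<epsilon> G' by (simp add: h_def powr_powr)
    then have "2 powr p * (G' * h powr p) = (\<epsilon> / 2) * (G' / (G' + 1))"
      using G' by (simp add: divide_simps) (auto simp: algebra_simps)
    also have "\<dots> \<le> (\<epsilon> / 2) * 1" using G' \<epsilon> by (intro mult_left_mono) auto
    finally show ?thesis by simp
  qed
  define B where "B = ball (0::'a) h"
  define c where "c = measure lborel B"
  have c: "emeasure lborel B = ennreal c" "c > 0"
    using h emeasure_lborel_ball_finite[of "0::'a" h] unfolding c_def B_def
    by (auto intro!: emeasure_eq_ennreal_measure)
  have [measurable]: "B \<in> sets borel" "cball (0::'a) R \<in> sets borel" for R by (simp_all add: B_def)
  have local_bound: "(\<integral>\<^sup>+y. ennreal (\<bar>f n (x + y)\<bar> powr p) * indicator B y \<partial>lborel)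
     \<le> (\<integral>\<^sup>+y. ennreal (\<bar>f n y\<bar> powr p) * indicator (cball 0 (norm x + h)) y \<partial>lborel)" for n x
  proof -
    have "(\<integral>\<^sup>+y. ennreal (\<bar>f n (x + y)\<bar> powr p) * indicator B y \<partial>lborel)
       \<le> (\<integral>\<^sup>+y. ennreal (\<bar>f n (y + x)\<bar> powr p) * indicator (cball 0 (norm x + h)) (y + x) \<partial>lborel)"
    proof (intro nn_integral_mono)
      fix y
      have "norm (y + x) \<le> norm x + h" if "y \<in> B"
        using that norm_triangle_ineq[of y x] by (simp add: B_def)
      then show "ennreal (\<bar>f n (x + y)\<bar> powr p) * indicator B y
        \<le> ennreal (\<bar>f n (y + x)\<bar> powr p) * indicator (cball 0 (norm x + h)) (y + x)"
        by (auto split: split_indicator simp: add.commute)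
    qed
    also have "\<dots> = (\<integral>\<^sup>+y. ennreal (\<bar>f n y\<bar> powr p) * indicator (cball 0 (norm x + h)) y \<partial>lborel)"
      by (rule nn_integral_translate[of "\<lambda>y. ennreal (\<bar>f n y\<bar> powr p) * indicator (cball 0 (norm x + h)) y"]) measurable
    finally show ?thesis .
  qed
  have int: "set_integrable lborel B (\<lambda>y. f n (x + y))" for n x
  proof (rule set_integrable_of_powr[OF p])
    obtain H where "(\<integral>\<^sup>+y. ennreal (\<bar>f n y\<bar> powr p) * indicator (cball 0 (norm x + h)) y \<partial>lborel) \<le> ennreal H"
      using bound by blast
    then show "(\<integral>\<^sup>+y. ennreal (\<bar>f n (x + y)\<bar> powr p) * indicator B y \<partial>lborel) < \<infinity>"
      by (intro order_le_less_trans[OF order_trans[OF local_bound[of n x]]]) auto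
  qed (use c in auto)
  define A where "A n x = (LINT y:B|lborel. f n (x + y)) / c" for n x
  obtain H where H: "\<And>n. (\<integral>\<^sup>+x. ennreal (\<bar>f n x\<bar> powr p) * indicator (cball 0 (\<bar>\<rho>\<bar> + h)) x \<partial>lborel) \<le> ennreal H"
    using bound by blast
  have A_bound: "norm (A n x) \<le> (max H 0 / c) powr (1 / p)" if x: "x \<in> cball 0 \<rho>" for n x
  proof -
    have "ennreal (\<bar>A n x\<bar> powr p) \<le> ennreal (1 / c) * (\<integral>\<^sup>+y. ennreal (\<bar>f n (x + y)\<bar> powr p) * indicator B y \<partial>lborel)"
      unfolding A_def by (rule average_powr_bound[OF p]) (use c in auto)
    also have "\<dots> \<le> ennreal (1 / c) * (\<integral>\<^sup>+y. ennreal (\<bar>f n y\<bar> powr p) * indicator (cball 0 (norm x + h)) y \<partial>lborel)"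
      by (intro mult_left_mono local_bound) auto
    also have "\<dots> \<le> ennreal (1 / c) * (\<integral>\<^sup>+y. ennreal (\<bar>f n y\<bar> powr p) * indicator (cball 0 (\<bar>\<rho>\<bar> + h)) y \<partial>lborel)"
      using x by (intro mult_left_mono nn_integral_mono) (auto split: split_indicator)
    also have "\<dots> \<le> ennreal (1 / c) * ennreal (max H 0)"
      by (intro mult_left_mono order_trans[OF H] ennreal_leI) auto
    finally have "\<bar>A n x\<bar> powr p \<le> max H 0 / c"
      using c by (simp add: ennreal_mult[symmetric])
    then have "(\<bar>A n x\<bar> powr p) powr (1 / p) \<le> (max H 0 / c) powr (1 / p)"
      using p by (intro powr_mono2) auto
    then show ?thesis using p by (simp add: powr_powr)
  qed
  have A_lipschitz: "norm (A n x - A n x') \<le> (G / c) powr (1 / p) * norm (x - x')" for n x x'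
  proof -
    have "A n x - A n x' = (LINT y:B|lborel. f n (x + y) - f n (x' + y)) / c"
      unfolding A_def using int by (simp add: set_integral_diff diff_divide_distrib)
    then have "ennreal (\<bar>A n x - A n x'\<bar> powr p)
      \<le> ennreal (1 / c) * (\<integral>\<^sup>+y. ennreal (\<bar>f n (x + y) - f n (x' + y)\<bar> powr p) * indicator B y \<partial>lborel)"
      using average_powr_bound[OF p, of "\<lambda>y. f n (x + y) - f n (x' + y)" lborel B c] c by simp
    also have "\<dots> \<le> ennreal (1 / c) * (\<integral>\<^sup>+y. ennreal (\<bar>f n ((y + x') + (x - x')) - f n (y + x')\<bar> powr p) \<partial>lborel)"
      by (intro mult_left_mono nn_integral_mono) (auto split: split_indicator simp: algebra_simps)
    also have "(\<integral>\<^sup>+y. ennreal (\<bar>f n ((y + x') + (x - x')) - f n (y + x')\<bar> powr p) \<partial>lborel)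
       = (\<integral>\<^sup>+y. ennreal (\<bar>f n (y + (x - x')) - f n y\<bar> powr p) \<partial>lborel)"
      by (rule nn_integral_translate[of "\<lambda>y. ennreal (\<bar>f n (y + (x - x')) - f n y\<bar> powr p)"]) measurable
    also have "ennreal (1 / c) * \<dots> \<le> ennreal (1 / c) * ennreal (G * norm (x - x') powr p)"
      by (intro mult_left_mono trans) auto
    finally have "\<bar>A n x - A n x'\<bar> powr p \<le> (G / c) * norm (x - x') powr p"
      using c G by (simp add: ennreal_mult[symmetric])
    then have "(\<bar>A n x - A n x'\<bar> powr p) powr (1 / p) \<le> ((G / c) * norm (x - x') powr p) powr (1 / p)"
      using p by (intro powr_mono2) auto
    then show ?thesis using p G c by (simp add: powr_powr powr_mult powr_divide)
  qed
  define L where "L = (G / c) powr (1 / p)"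
  have L: "L \<ge> 0" by (simp add: L_def)
  obtain g r where g: "strict_mono (r :: nat \<Rightarrow> nat)"
      "\<And>e. 0 < e \<Longrightarrow> \<exists>N. \<forall>n x. n \<ge> N \<and> x \<in> cball 0 \<rho> \<longrightarrow> norm (A (r n) x - g x) < e"
  proof (rule Arzela_Ascoli[of "cball 0 \<rho>" A "(max H 0 / c) powr (1 / p)"])
    show "norm (A n x) \<le> (max H 0 / c) powr (1 / p)" if "x \<in> cball 0 \<rho>" for n x
      by (rule A_bound[OF that])
    show "\<exists>d>0. \<forall>n y. y \<in> cball 0 \<rho> \<and> norm (x - y) < d \<longrightarrow> norm (A n x - A n y) < e"
      if "x \<in> cball 0 \<rho>" "0 < e" for x e
    proof (intro exI[of _ "e / (L + 1)"] conjI allI impI)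
      show "0 < e / (L + 1)" using that L by simp
      fix n y assume "y \<in> cball 0 \<rho> \<and> norm (x - y) < e / (L + 1)"
      then have "norm (x - y) * (L + 1) < e" using L by (simp add: less_divide_eq)
      moreover have "norm (A n x - A n y) \<le> L * norm (x - y)" unfolding L_def by (rule A_lipschitz)
      ultimately show "norm (A n x - A n y) < e"
        using norm_ge_zero[of "x - y"] mult.commute[of L "norm (x - y)"]
        unfolding distrib_left mult_1_right by linarith
    qed
  qed auto
  define b where "b = measure lborel (cball (0::'a) \<rho>)"
  have b: "emeasure lborel (cball (0::'a) \<rho>) = ennreal b" "b \<ge> 0"
    using emeasure_lborel_cball_finite[of "0::'a" \<rho>] unfolding b_def
    by (auto intro!: emeasure_eq_ennreal_measure)
  define \<delta> where "\<delta> = (\<epsilon> / (2 * 2 powr p * (b + 1))) powr (1 / p)"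
  have \<delta>: "\<delta> > 0" using \<epsilon> b by (simp add: \<delta>_def)
  have \<delta>p: "2 powr p * (b * \<delta> powr p) \<le> \<epsilon> / 2"
  proof -
    have "\<delta> powr p = \<epsilon> / (2 * 2 powr p * (b + 1))"
      using p \<epsilon> b by (simp add: \<delta>_def powr_powr)
    then have "2 powr p * (b * \<delta> powr p) = (\<epsilon> / 2) * (b / (b + 1))"
      using b by (simp add: divide_simps) (auto simp: algebra_simps)
    also have "\<dots> \<le> (\<epsilon> / 2) * 1" using b \<epsilon> by (intro mult_left_mono) auto
    finally show ?thesis by simp
  qed
  obtain N where N: "\<And>n x. n \<ge> N \<Longrightarrow> x \<in> cball 0 \<rho> \<Longrightarrow> norm (A (r n) x - g x) < \<delta> / 2"
    using g(2)[of "\<delta> / 2"] \<delta> by auto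
  have main: "(\<integral>\<^sup>+x. ennreal (\<bar>f (r m) x - f (r n) x\<bar> powr p) * indicator (cball 0 \<rho>) x \<partial>lborel) \<le> ennreal \<epsilon>"
    if mn: "m \<ge> N" "n \<ge> N" for m n
  proof -
    define V where "V x = f (r m) x - f (r n) x" for x
    have [measurable]: "V \<in> borel_measurable borel" unfolding V_def by measurable
    have V_trans: "(\<integral>\<^sup>+x. ennreal (\<bar>V x - V (x + y)\<bar> powr p) \<partial>lborel) \<le> ennreal (G' * norm y powr p)" for y
    proof -
      have "(\<integral>\<^sup>+x. ennreal (\<bar>V x - V (x + y)\<bar> powr p) \<partial>lborel)
        \<le> (\<integral>\<^sup>+x. ennreal (2 powr p) * (ennreal (\<bar>f (r m) (x + y) - f (r m) x\<bar> powr p) + ennreal (\<bar>f (r n) (x + y) - f (r n) x\<bar> powr p)) \<partial>lborel)"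
      proof (intro nn_integral_mono)
        fix x
        have "\<bar>V x - V (x + y)\<bar> powr p \<le> (\<bar>f (r m) (x + y) - f (r m) x\<bar> + \<bar>f (r n) (x + y) - f (r n) x\<bar>) powr p"
          using p by (intro powr_mono2) (auto simp: V_def)
        also have "\<dots> \<le> 2 powr p * (\<bar>f (r m) (x + y) - f (r m) x\<bar> powr p + \<bar>f (r n) (x + y) - f (r n) x\<bar> powr p)"
          by (rule powr_add_le_double) (use p in auto)
        finally show "ennreal (\<bar>V x - V (x + y)\<bar> powr p)
          \<le> ennreal (2 powr p) * (ennreal (\<bar>f (r m) (x + y) - f (r m) x\<bar> powr p) + ennreal (\<bar>f (r n) (x + y) - f (r n) x\<bar> powr p))"
          by (simp add: ennreal_mult[symmetric] ennreal_plus[symmetric] ennreal_leI del: ennreal_plus)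
      qed
      also have "\<dots> = ennreal (2 powr p) * ((\<integral>\<^sup>+x. ennreal (\<bar>f (r m) (x + y) - f (r m) x\<bar> powr p) \<partial>lborel)
          + (\<integral>\<^sup>+x. ennreal (\<bar>f (r n) (x + y) - f (r n) x\<bar> powr p) \<partial>lborel))"
        by (simp add: nn_integral_cmult nn_integral_add)
      also have "\<dots> \<le> ennreal (2 powr p) * (ennreal (G * norm y powr p) + ennreal (G * norm y powr p))"
        by (intro mult_left_mono add_mono trans) auto
      also have "\<dots> = ennreal (G' * norm y powr p)"
        using G by (simp add: G'_def ennreal_mult[symmetric] ennreal_plus[symmetric] algebra_simps del: ennreal_plus)
      finally show ?thesis .
    qed
    have AV: "A (r m) x - A (r n) x = (LINT y:B|lborel. V (x + y)) / c" for x
      unfolding A_def V_def using int by (simp add: set_integral_diff diff_divide_distrib)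
    have V_int: "set_integrable lborel B (\<lambda>y. V (x + y))" for x
      unfolding V_def using int by (intro set_integral_diff)
    have split: "V x = (LINT y:B|lborel. V x - V (x + y)) / c + (A (r m) x - A (r n) x)" for x
    proof -
      have const: "set_integrable lborel B (\<lambda>y. V x)"
        unfolding set_integrable_def using c by (simp add: integrable_indicator_iff)
      have "(LINT y:B|lborel. V x - V (x + y)) = c * V x - (LINT y:B|lborel. V (x + y))"
        using const V_int[of x] c by (simp add: set_integral_diff set_integral_const c_def)
      then show ?thesis unfolding AV using c by (simp add: field_simps)
    qed
    have "(\<integral>\<^sup>+x. ennreal (\<bar>V x\<bar> powr p) * indicator (cball 0 \<rho>) x \<partial>lborel)
      \<le> (\<integral>\<^sup>+x. (ennreal (2 powr p / c) * (\<integral>\<^sup>+y. ennreal (\<bar>V x - V (x + y)\<bar> powr p) * indicator B y \<partial>lborel)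
             + ennreal (2 powr p * \<delta> powr p) * indicator (cball 0 \<rho>) x) \<partial>lborel)"
    proof (intro nn_integral_mono)
      fix x :: 'a
      show "ennreal (\<bar>V x\<bar> powr p) * indicator (cball 0 \<rho>) x
        \<le> ennreal (2 powr p / c) * (\<integral>\<^sup>+y. ennreal (\<bar>V x - V (x + y)\<bar> powr p) * indicator B y \<partial>lborel)
             + ennreal (2 powr p * \<delta> powr p) * indicator (cball 0 \<rho>) x"
      proof (cases "x \<in> cball 0 \<rho>")
        case True
        let ?D = "(LINT y:B|lborel. V x - V (x + y)) / c"
        have "\<bar>A (r m) x - A (r n) x\<bar> \<le> \<delta>"
          using N[OF mn(1) True] N[OF mn(2) True] unfolding real_norm_def by argo
        then have "\<bar>V x\<bar> powr p \<le> (\<bar>?D\<bar> + \<delta>) powr p"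
          using p split[of x] by (intro powr_mono2) argo+
        also have "\<dots> \<le> 2 powr p * (\<bar>?D\<bar> powr p + \<delta> powr p)"
          by (rule powr_add_le_double) (use p \<delta> in auto)
        finally have "ennreal (\<bar>V x\<bar> powr p) \<le> ennreal (2 powr p) * ennreal (\<bar>?D\<bar> powr p) + ennreal (2 powr p * \<delta> powr p)"
          by (simp add: ennreal_mult[symmetric] ennreal_plus[symmetric] algebra_simps ennreal_leI del: ennreal_plus)
        also have "ennreal (2 powr p) * ennreal (\<bar>?D\<bar> powr p)
           \<le> ennreal (2 powr p) * (ennreal (1 / c) * (\<integral>\<^sup>+y. ennreal (\<bar>V x - V (x + y)\<bar> powr p) * indicator B y \<partial>lborel))"
          by (intro mult_left_mono average_powr_bound[OF p]) (use c in auto)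
        also have "\<dots> = ennreal (2 powr p / c) * (\<integral>\<^sup>+y. ennreal (\<bar>V x - V (x + y)\<bar> powr p) * indicator B y \<partial>lborel)"
          using c by (simp add: mult.assoc[symmetric] ennreal_mult[symmetric])
        finally show ?thesis using True by (simp add: add_mono)
      qed simp
    qed
    also have "\<dots> = ennreal (2 powr p / c) * (\<integral>\<^sup>+x. (\<integral>\<^sup>+y. ennreal (\<bar>V x - V (x + y)\<bar> powr p) * indicator B y \<partial>lborel) \<partial>lborel)
        + ennreal (2 powr p * \<delta> powr p) * ennreal b"
      by (subst nn_integral_add, measurable) (simp add: nn_integral_cmult nn_integral_cmult_indicator b)
    also have "(\<integral>\<^sup>+x. (\<integral>\<^sup>+y. ennreal (\<bar>V x - V (x + y)\<bar> powr p) * indicator B y \<partial>lborel) \<partial>lborel)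
       = (\<integral>\<^sup>+y. (\<integral>\<^sup>+x. ennreal (\<bar>V x - V (x + y)\<bar> powr p) * indicator B y \<partial>lborel) \<partial>lborel)"
      by (rule lborel_pair.Fubini') measurable
    also have "\<dots> = (\<integral>\<^sup>+y. (\<integral>\<^sup>+x. ennreal (\<bar>V x - V (x + y)\<bar> powr p) \<partial>lborel) * indicator B y \<partial>lborel)"
      by (intro nn_integral_cong nn_integral_multc) measurable
    also have "ennreal (2 powr p / c) * \<dots> + ennreal (2 powr p * \<delta> powr p) * ennreal b
      \<le> ennreal (2 powr p / c) * (\<integral>\<^sup>+y. ennreal (G' * h powr p) * indicator B y \<partial>lborel) + ennreal (2 powr p * \<delta> powr p) * ennreal b"
    proof (intro add_mono mult_left_mono nn_integral_mono)
      fix y :: 'a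
      show "(\<integral>\<^sup>+x. ennreal (\<bar>V x - V (x + y)\<bar> powr p) \<partial>lborel) * indicator B y \<le> ennreal (G' * h powr p) * indicator B y"
      proof (cases "y \<in> B")
        case True
        have "G' * norm y powr p \<le> G' * h powr p"
          using True G' p by (intro mult_left_mono powr_mono2) (auto simp: B_def)
        then show ?thesis using True order_trans[OF V_trans ennreal_leI] by simp
      qed simp
    qed auto
    also have "\<dots> = ennreal (2 powr p * (G' * h powr p) + 2 powr p * (b * \<delta> powr p))"
    proof -
      have "(\<integral>\<^sup>+y. ennreal (G' * h powr p) * indicator B y \<partial>lborel) = ennreal (G' * h powr p) * ennreal c"
        using c by (simp add: nn_integral_cmult_indicator)
      moreover have "2 powr p / c * (G' * h powr p * c) = 2 powr p * (G' * h powr p)" using c by simp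
      ultimately show ?thesis
        using c b G' by (simp add: ennreal_mult[symmetric] ennreal_plus[symmetric] mult_ac del: ennreal_plus)
    qed
    also have "\<dots> \<le> ennreal \<epsilon>" using hp \<delta>p by (intro ennreal_leI) simp
    finally show ?thesis by (simp add: V_def)
  qed
  show ?thesis using g(1) main by blast
qed

section \<open>Test functions and weighted norms\<close>

lemma GDERIV_unique:
  assumes "GDERIV u x :> D" "GDERIV u x :> D'"
  shows "D = D'"
proof -
  have "(\<lambda>h. h \<bullet> D) = (\<lambda>h. h \<bullet> D')"
    using assms unfolding gderiv_def by (rule has_derivative_unique)
  then show ?thesis by (metis vector_eq_ldot)
qed

lemma gradient_eqI: "GDERIV u x :> D \<Longrightarrow> gradient u x = D"
  unfolding gradient_def by (rule the_equality) (auto intro: GDERIV_unique)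

text \<open>A linear functional on the Euclidean space is the inner product with its adjoint
  evaluated at 1, so the definite description in \<open>gradient\<close> denotes.\<close>

lemma GDERIV_gradient:
  assumes "u differentiable (at x)"
  shows "GDERIV u x :> gradient u x"
proof -
  obtain f' where f': "(u has_derivative f') (at x)" using assms by (auto simp: differentiable_def)
  then have "linear f'" by (rule has_derivative_linear)
  then have "h \<bullet> adjoint f' 1 = f' h" for h using adjoint_works[of f' h 1] by simp
  then have "f' = (\<lambda>h. h \<bullet> adjoint f' 1)" by auto
  then have D: "GDERIV u x :> adjoint f' 1" using f' unfolding gderiv_def by simp
  show ?thesis unfolding gradient_eqI[OF D] by (rule D)
qed

lemma smooth_differentiable: "smooth u \<Longrightarrow> u differentiable (at x)"
  using smooth_def[of u] by (metis fold_simps(1))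

lemma smooth_partial: "smooth u \<Longrightarrow> smooth (partial j u)"
  unfolding smooth_def by (metis fold_simps(2))

lemma smooth_GDERIV: "smooth u \<Longrightarrow> GDERIV u x :> gradient u x"
  by (intro GDERIV_gradient smooth_differentiable)

text \<open>Each component of the gradient is a partial derivative, hence again differentiable.\<close>

lemma smooth_continuous_gradient:
  assumes "smooth u"
  shows "continuous_on UNIV (gradient u)"
proof -
  have "isCont (\<lambda>x. gradient u x $ j) x" for j x
  proof -
    have "(\<lambda>x. gradient u x $ j) differentiable (at x)"
      using smooth_differentiable[OF smooth_partial[OF assms], of j x] by (simp add: partial_def[abs_def])
    then show ?thesis by (rule differentiable_imp_continuous_within)
  qed
  then have "continuous_on UNIV (\<lambda>x. \<chi> j. gradient u x $ j)"
    by (intro continuous_on_vec_lambda continuous_at_imp_continuous_on) auto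
  then show ?thesis by simp
qed

lemma smooth_continuous:
  assumes "smooth u"
  shows "continuous_on UNIV u"
  using smooth_differentiable[OF assms]
  by (intro continuous_at_imp_continuous_on ballI differentiable_imp_continuous_within)

lemma GDERIV_lincomb:
  assumes "GDERIV u x :> D" "GDERIV w x :> E"
  shows "GDERIV (\<lambda>x. a * u x + b * w x) x :> a *\<^sub>R D + b *\<^sub>R E"
  using GDERIV_add[OF GDERIV_mult[OF GDERIV_const[of a x] assms(1)] GDERIV_mult[OF GDERIV_const[of b x] assms(2)]]
  by simp

lemma gradient_lincomb:
  assumes "smooth u" "smooth w"
  shows "gradient (\<lambda>x. a * u x + b * w x) x = a *\<^sub>R gradient u x + b *\<^sub>R gradient w x"
  by (intro gradient_eqI GDERIV_lincomb smooth_GDERIV assms)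

lemma smooth_lincomb:
  assumes "smooth u" "smooth w"
  shows "smooth (\<lambda>x. a * u x + b * w x)"
proof -
  have "fold partial js (\<lambda>x. a * u x + b * w x) = (\<lambda>x. a * fold partial js u x + b * fold partial js w x)"
    if "smooth u" "smooth w" for js and u w :: "real^'n \<Rightarrow> real"
    using that
  proof (induction js arbitrary: u w)
    case (Cons j js)
    have "partial j (\<lambda>x. a * u x + b * w x) = (\<lambda>x. a * partial j u x + b * partial j w x)"
      using Cons.prems by (auto simp: partial_def gradient_lincomb)
    then show ?case using Cons.IH[OF smooth_partial smooth_partial, OF Cons.prems] by simp
  qed simp
  from this[OF assms] show ?thesis
    using assms unfolding smooth_def
    by (simp add: differentiable_add differentiable_cmult_left_iff differentiable_mult)
qed

lemma test_functions_smooth: "u \<in> test_functions \<Omega> \<Longrightarrow> smooth u"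
  by (simp add: test_functions_def)

lemma test_functions_lincomb:
  assumes u: "u \<in> test_functions \<Omega>" and w: "w \<in> test_functions \<Omega>"
  shows "(\<lambda>x. a * u x + b * w x) \<in> test_functions \<Omega>"
proof -
  have sub: "closure {x. a * u x + b * w x \<noteq> 0} \<subseteq> closure {x. u x \<noteq> 0} \<union> closure {x. w x \<noteq> 0}"
    unfolding closure_Un[symmetric] by (intro closure_mono) auto
  have "compact (closure {x. u x \<noteq> 0} \<union> closure {x. w x \<noteq> 0})"
    using u w by (intro compact_Un) (auto simp: test_functions_def)
  then have "compact (closure {x. a * u x + b * w x \<noteq> 0})"
    using sub by (meson bounded_subset closed_closure compact_eq_bounded_closed)
  then show ?thesis
    using sub u w smooth_lincomb by (auto simp: test_functions_def)
qed

lemma zero_outside_support: "x \<notin> closure {x. u x \<noteq> 0} \<Longrightarrow> u x = 0"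
  using subsetD[OF closure_subset, of x "{x. u x \<noteq> 0}"] by auto

lemma gradient_zero_outside_support:
  assumes "x \<notin> closure {x. u x \<noteq> 0}"
  shows "gradient u x = 0"
proof (rule gradient_eqI)
  have "(u has_derivative (\<lambda>h. 0)) (at x)"
  proof (rule has_derivative_transform_within_open[where s = "- closure {x. u x \<noteq> 0}" and f = "\<lambda>x. 0"])
    show "((\<lambda>x. 0) has_derivative (\<lambda>h. 0)) (at x)" by simp
    show "open (- closure {x. u x \<noteq> 0})" by auto
    show "x \<in> - closure {x. u x \<noteq> 0}" using assms by simp
    show "0 = u y" if "y \<in> - closure {x. u x \<noteq> 0}" for y
      using that zero_outside_support[of y u] by simp
  qed
  then show "GDERIV u x :> 0" by (simp add: gderiv_def)
qed

definition bounded_with_bounded_support :: "('a::euclidean_space \<Rightarrow> 'b::euclidean_space) \<Rightarrow> bool" where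
  "bounded_with_bounded_support F \<longleftrightarrow> F \<in> borel_measurable borel \<and>
     (\<exists>M R. \<forall>x. norm (F x) \<le> M \<and> (R < norm x \<longrightarrow> F x = 0))"

lemma bounded_supportI:
  assumes "continuous_on UNIV F" "compact K" "\<And>x. x \<notin> K \<Longrightarrow> F x = 0"
  shows "bounded_with_bounded_support F"
proof -
  obtain M where M: "\<And>x. x \<in> K \<Longrightarrow> norm (F x) \<le> M"
    using compact_imp_bounded[OF compact_continuous_image[OF continuous_on_subset[OF assms(1)] assms(2)]]
    by (auto simp: bounded_iff)
  obtain R where R: "\<And>x. x \<in> K \<Longrightarrow> norm x \<le> R"
    using compact_imp_bounded[OF assms(2)] by (auto simp: bounded_iff)
  have "norm (F x) \<le> max M 0 \<and> (R < norm x \<longrightarrow> F x = 0)" for x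
    using M[of x] R[of x] assms(3)[of x] by (cases "x \<in> K") auto
  then show ?thesis
    unfolding bounded_with_bounded_support_def
    using borel_measurable_continuous_onI[OF assms(1)] by blast
qed

lemma test_function_bounded_support:
  assumes "u \<in> test_functions \<Omega>"
  shows "bounded_with_bounded_support u" "bounded_with_bounded_support (gradient u)"
proof -
  have K: "compact (closure {x. u x \<noteq> 0})" using assms by (simp add: test_functions_def)
  show "bounded_with_bounded_support u"
    by (rule bounded_supportI[OF smooth_continuous[OF test_functions_smooth[OF assms]] K])
       (rule zero_outside_support)
  show "bounded_with_bounded_support (gradient u)"
    by (rule bounded_supportI[OF smooth_continuous_gradient[OF test_functions_smooth[OF assms]] K])
       (rule gradient_zero_outside_support)
qed

lemma test_function_zero_outside:
  assumes "u \<in> test_functions \<Omega>" "x \<notin> \<Omega>"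
  shows "u x = 0" "gradient u x = 0"
proof -
  have "x \<notin> closure {x. u x \<noteq> 0}" using assms by (auto simp: test_functions_def)
  then show "u x = 0" "gradient u x = 0"
    by (rule zero_outside_support, rule gradient_zero_outside_support)
qed

text \<open>Common form of the two norms: the Lebesgue norm of \<open>u\<close> and the Sobolev norm, which is
  the weighted norm of its gradient.\<close>

definition weighted_norm :: "('a::euclidean_space) set \<Rightarrow> real \<Rightarrow> real \<Rightarrow> ('a \<Rightarrow> 'b::euclidean_space) \<Rightarrow> real" where
  "weighted_norm S p b F = (LINT x:S|lborel. norm (F x) powr p / norm x powr b) powr (1 / p)"

lemma bounded_support_weight_finite:
  fixes F :: "'a::euclidean_space \<Rightarrow> 'b::euclidean_space" and b p :: real
  assumes F: "bounded_with_bounded_support F" and b: "b < DIM('a)" and p: "0 \<le> p"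
  shows "(\<integral>\<^sup>+x. ennreal (norm (F x) powr p * norm x powr (- b)) \<partial>lborel) < \<infinity>"
proof -
  obtain M R where MR: "\<And>x. norm (F x) \<le> M" "\<And>x. R < norm x \<Longrightarrow> F x = 0"
    using F unfolding bounded_with_bounded_support_def by blast
  have [measurable]: "F \<in> borel_measurable borel" using F by (simp add: bounded_with_bounded_support_def)
  have [measurable]: "cball (0::'a) r \<in> sets borel" for r by simp
  have "(\<integral>\<^sup>+x. ennreal (norm (F x) powr p * norm x powr (- b)) \<partial>lborel)
    \<le> (\<integral>\<^sup>+x. ennreal (M powr p) * (ennreal (norm x powr (- b)) * indicator (cball (0::'a) R) x) \<partial>lborel)"
  proof (intro nn_integral_mono)
    fix x
    have "norm (F x) powr p \<le> M powr p" using MR(1)[of x] p by (intro powr_mono2) auto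
    then have "norm (F x) powr p * norm x powr (- b) \<le> M powr p * norm x powr (- b)"
      by (intro mult_right_mono) auto
    then show "ennreal (norm (F x) powr p * norm x powr (- b)) \<le> ennreal (M powr p) * (ennreal (norm x powr (- b)) * indicator (cball 0 R) x)"
      using MR(2)[of x] by (auto split: split_indicator simp: ennreal_mult[symmetric] intro!: ennreal_leI)
  qed
  also have "\<dots> = ennreal (M powr p) * (\<integral>\<^sup>+x. ennreal (norm x powr (- b)) * indicator (cball (0::'a) R) x \<partial>lborel)"
    by (intro nn_integral_cmult) measurable
  also have "\<dots> < \<infinity>"
    using nn_integral_norm_powr_ball_finite[OF b, of R] by (simp add: ennreal_mult_less_top)
  finally show ?thesis .
qed

text \<open>The norms are defined by Bochner integrals with value 0 as a default. For bounded
  functions of bounded support and an integrable weight they agree with the nonnegative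
  integrals that the estimates use.\<close>

lemma weighted_norm_nn_integral:
  fixes F :: "'a::euclidean_space \<Rightarrow> 'b::euclidean_space" and b p :: real
  assumes F: "bounded_with_bounded_support F" and b: "b < DIM('a)" and p: "0 < p"
    and S: "S \<in> sets borel"
  shows "(\<integral>\<^sup>+x. ennreal (norm (F x) powr p * norm x powr (- b)) * indicator S x \<partial>lborel) = ennreal (weighted_norm S p b F powr p)"
proof -
  have [measurable]: "F \<in> borel_measurable borel" "S \<in> sets borel" using F S by (auto simp: bounded_with_bounded_support_def)
  let ?f = "\<lambda>x. indicator S x *\<^sub>R (norm (F x) powr p / norm x powr b)"
  have eq: "ennreal (norm (F x) powr p * norm x powr (- b)) * indicator S x = ennreal (?f x)" for x
    by (auto split: split_indicator simp: powr_minus divide_inverse)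
  have "integrable lborel ?f"
  proof (rule integrableI_bounded)
    have "(\<integral>\<^sup>+x. ennreal (norm (?f x)) \<partial>lborel) \<le> (\<integral>\<^sup>+x. ennreal (norm (F x) powr p * norm x powr (- b)) \<partial>lborel)"
      by (intro nn_integral_mono) (auto split: split_indicator simp: powr_minus divide_inverse)
    also have "\<dots> < \<infinity>" using bounded_support_weight_finite[OF F b] p by simp
    finally show "(\<integral>\<^sup>+x. ennreal (norm (?f x)) \<partial>lborel) < \<infinity>" .
  qed measurable
  then have "(\<integral>\<^sup>+x. ennreal (?f x) \<partial>lborel) = ennreal (\<integral>x. ?f x \<partial>lborel)"
    by (intro nn_integral_eq_integral) auto
  moreover have "(\<integral>x. ?f x \<partial>lborel) \<ge> 0" by (rule Bochner_Integration.integral_nonneg) simp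
  ultimately show ?thesis
    unfolding eq weighted_norm_def set_lebesgue_integral_def using p by (simp add: powr_powr)
qed

lemma weighted_norm_nonneg: "0 \<le> weighted_norm S p b F"
  by (simp add: weighted_norm_def)

lemma bounded_support_add:
  assumes "bounded_with_bounded_support F" "bounded_with_bounded_support G"
  shows "bounded_with_bounded_support (\<lambda>x. F x + G x)"
proof -
  obtain M R where MR: "\<And>x. norm (F x) \<le> M" "\<And>x. R < norm x \<Longrightarrow> F x = 0"
    using assms(1) unfolding bounded_with_bounded_support_def by blast
  obtain M' R' where MR': "\<And>x. norm (G x) \<le> M'" "\<And>x. R' < norm x \<Longrightarrow> G x = 0"
    using assms(2) unfolding bounded_with_bounded_support_def by blast
  have "norm (F x + G x) \<le> M + M' \<and> (max R R' < norm x \<longrightarrow> F x + G x = 0)" for x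
    using MR[of x] MR'[of x] by (auto intro: norm_triangle_le)
  moreover have "(\<lambda>x. F x + G x) \<in> borel_measurable borel"
    using assms unfolding bounded_with_bounded_support_def by (intro borel_measurable_add) auto
  ultimately show ?thesis unfolding bounded_with_bounded_support_def by blast
qed

lemma weighted_norm_scale:
  assumes "0 < p"
  shows "weighted_norm S p b (\<lambda>x. c *\<^sub>R F x) = \<bar>c\<bar> * weighted_norm S p b F"
proof -
  have "(LINT x:S|lborel. norm (c *\<^sub>R F x) powr p / norm x powr b)
     = (LINT x:S|lborel. \<bar>c\<bar> powr p * (norm (F x) powr p / norm x powr b))"
    by (simp add: powr_mult)
  also have "\<dots> = \<bar>c\<bar> powr p * (LINT x:S|lborel. norm (F x) powr p / norm x powr b)"
    by (rule set_integral_mult_right)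
  finally show ?thesis
    using assms by (simp add: weighted_norm_def powr_mult powr_powr)
qed

text \<open>Minkowski's inequality. The weights in \<open>powr_add_le_weighted\<close> are taken proportional to
  the two norms, each enlarged by \<open>e / 2\<close> so that they are positive.\<close>

lemma weighted_norm_triangle:
  fixes F G :: "'a::euclidean_space \<Rightarrow> 'b::euclidean_space" and b p :: real
  assumes F: "bounded_with_bounded_support F" and G: "bounded_with_bounded_support G"
    and b: "b < DIM('a)" and p: "1 \<le> p" and S: "S \<in> sets borel"
  shows "weighted_norm S p b (\<lambda>x. F x + G x) \<le> weighted_norm S p b F + weighted_norm S p b G"
proof (rule field_le_epsilon)
  fix e :: real assume e: "0 < e"
  have [measurable]: "F \<in> borel_measurable borel" "G \<in> borel_measurable borel" "S \<in> sets borel"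
    using F G S by (auto simp: bounded_with_bounded_support_def)
  let ?N = "weighted_norm S p b"
  define A where "A = ?N F + e / 2"
  define B where "B = ?N G + e / 2"
  have AB: "A > 0" "B > 0" "?N F \<le> A" "?N G \<le> B"
    using e weighted_norm_nonneg[of S p b F] weighted_norm_nonneg[of S p b G] by (auto simp: A_def B_def)
  define l where "l = A / (A + B)"
  have l: "0 < l" "l < 1" "1 - l = B / (A + B)" using AB by (auto simp: l_def field_simps)
  have w: "X powr p * (X / (A + B)) powr (1 - p) = X * (A + B) powr (p - 1)" if "X > 0" for X
  proof -
    have "X powr p * (X / (A + B)) powr (1 - p) = (X powr p * X powr (1 - p)) * (A + B) powr (- (1 - p))"
      using that AB by (simp only: powr_divide powr_minus) (simp add: divide_inverse)
    also have "X powr p * X powr (1 - p) = X" using that by (simp add: powr_add[symmetric])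
    finally show ?thesis by simp
  qed
  let ?I = "\<lambda>H. (\<integral>\<^sup>+x. ennreal (norm (H x :: 'b) powr p * norm x powr (- b)) * indicator S x \<partial>lborel)"
  have "?I (\<lambda>x. F x + G x) \<le> (\<integral>\<^sup>+x. (ennreal (l powr (1 - p)) * (ennreal (norm (F x) powr p * norm x powr (- b)) * indicator S x)
     + ennreal ((1 - l) powr (1 - p)) * (ennreal (norm (G x) powr p * norm x powr (- b)) * indicator S x)) \<partial>lborel)"
  proof (intro nn_integral_mono)
    fix x
    have "norm (F x + G x) powr p \<le> (norm (F x) + norm (G x)) powr p"
      using p by (intro powr_mono2 norm_triangle_ineq) auto
    also have "\<dots> \<le> l powr (1 - p) * norm (F x) powr p + (1 - l) powr (1 - p) * norm (G x) powr p"
      by (rule powr_add_le_weighted) (use p l in auto)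
    finally have "norm (F x + G x) powr p * norm x powr (- b)
       \<le> (l powr (1 - p) * norm (F x) powr p + (1 - l) powr (1 - p) * norm (G x) powr p) * norm x powr (- b)"
      by (intro mult_right_mono) auto
    then show "ennreal (norm (F x + G x) powr p * norm x powr (- b)) * indicator S x
       \<le> ennreal (l powr (1 - p)) * (ennreal (norm (F x) powr p * norm x powr (- b)) * indicator S x)
         + ennreal ((1 - l) powr (1 - p)) * (ennreal (norm (G x) powr p * norm x powr (- b)) * indicator S x)"
      by (auto split: split_indicator simp: ennreal_mult[symmetric] ennreal_plus[symmetric] algebra_simps simp del: ennreal_plus)
  qed
  also have "\<dots> = ennreal (l powr (1 - p)) * ?I F + ennreal ((1 - l) powr (1 - p)) * ?I G"
    by (rule nn_integral_lincomb) measurable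
  finally have step: "?I (\<lambda>x. F x + G x) \<le> ennreal (l powr (1 - p)) * ?I F + ennreal ((1 - l) powr (1 - p)) * ?I G" .
  have IF: "?I F = ennreal (?N F powr p)" by (rule weighted_norm_nn_integral[OF F b _ S]) (use p in simp)
  have IG: "?I G = ennreal (?N G powr p)" by (rule weighted_norm_nn_integral[OF G b _ S]) (use p in simp)
  have IFG: "?I (\<lambda>x. F x + G x) = ennreal (?N (\<lambda>x. F x + G x) powr p)"
    by (rule weighted_norm_nn_integral[OF bounded_support_add[OF F G] b _ S]) (use p in simp)
  have "?N (\<lambda>x. F x + G x) powr p \<le> l powr (1 - p) * ?N F powr p + (1 - l) powr (1 - p) * ?N G powr p"
    using step unfolding IF IG IFG by (simp add: ennreal_mult[symmetric] ennreal_plus[symmetric] del: ennreal_plus)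
  also have "\<dots> \<le> l powr (1 - p) * A powr p + (1 - l) powr (1 - p) * B powr p"
    using AB p weighted_norm_nonneg[of S p b] by (intro add_mono mult_left_mono powr_mono2) auto
  also have "\<dots> = (A + B) * (A + B) powr (p - 1)"
  proof -
    have "l powr (1 - p) * A powr p = A * (A + B) powr (p - 1)"
      using w[OF AB(1)] by (simp add: l_def mult.commute)
    moreover have "(1 - l) powr (1 - p) * B powr p = B * (A + B) powr (p - 1)"
      using w[OF AB(2)] unfolding l(3) by (simp add: mult.commute)
    ultimately show ?thesis by (simp only: distrib_right)
  qed
  also have "\<dots> = (A + B) powr p" using AB by (simp add: powr_mult_base)
  finally have "(?N (\<lambda>x. F x + G x) powr p) powr (1 / p) \<le> ((A + B) powr p) powr (1 / p)"
    by (rule powr_mono2[rotated 2]) (use p in auto)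
  then have "?N (\<lambda>x. F x + G x) \<le> A + B"
    using p AB weighted_norm_nonneg[of S p b] by (simp add: powr_powr)
  then show "?N (\<lambda>x. F x + G x) \<le> ?N F + ?N G + e" by (simp add: A_def B_def)
qed

lemma sobolev_norm_weighted: "sobolev_norm \<Omega> p \<mu> u = weighted_norm \<Omega> p \<mu> (gradient u)"
  by (simp add: sobolev_norm_def weighted_norm_def)

lemma lebesgue_norm_weighted: "lebesgue_norm \<Omega> q s u = weighted_norm \<Omega> q s u"
  by (simp add: lebesgue_norm_def weighted_norm_def)

lemma sobolev_norm_seminorm:
  fixes \<Omega> :: "(real^'n) set" and p q s \<mu> :: real
  assumes "open \<Omega>" "1 \<le> p" "\<mu> < CARD('n)"
  shows "function_seminorm (test_functions \<Omega>) (sobolev_norm \<Omega> p \<mu>)"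
proof
  fix f g :: "real^'n \<Rightarrow> real" and a b c :: real assume f: "f \<in> test_functions \<Omega>"
  show "0 \<le> sobolev_norm \<Omega> p \<mu> f" by (simp add: sobolev_norm_weighted weighted_norm_nonneg)
  have "gradient (\<lambda>x. c * f x) = (\<lambda>x. c *\<^sub>R gradient f x)"
    using gradient_lincomb[OF test_functions_smooth[OF f] test_functions_smooth[OF f], of c 0] by auto
  then show "sobolev_norm \<Omega> p \<mu> (\<lambda>x. c * f x) = \<bar>c\<bar> * sobolev_norm \<Omega> p \<mu> f"
    using assms by (simp add: sobolev_norm_weighted weighted_norm_scale)
  assume g: "g \<in> test_functions \<Omega>"
  show "(\<lambda>x. a * f x + b * g x) \<in> test_functions \<Omega>" using f g by (rule test_functions_lincomb)
  have "gradient (\<lambda>x. f x + g x) = (\<lambda>x. gradient f x + gradient g x)"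
    using gradient_lincomb[OF test_functions_smooth[OF f] test_functions_smooth[OF g], of 1 1] by auto
  then show "sobolev_norm \<Omega> p \<mu> (\<lambda>x. f x + g x) \<le> sobolev_norm \<Omega> p \<mu> f + sobolev_norm \<Omega> p \<mu> g"
    using assms f g
    by (simp add: sobolev_norm_weighted weighted_norm_triangle test_function_bounded_support(2))
qed

lemma lebesgue_norm_seminorm:
  fixes \<Omega> :: "(real^'n) set" and p q s \<mu> :: real
  assumes "open \<Omega>" "1 \<le> q" "s < CARD('n)"
  shows "function_seminorm (test_functions \<Omega>) (lebesgue_norm \<Omega> q s)"
proof
  fix f g :: "real^'n \<Rightarrow> real" and a b c :: real assume f: "f \<in> test_functions \<Omega>"
  show "0 \<le> lebesgue_norm \<Omega> q s f" by (simp add: lebesgue_norm_weighted weighted_norm_nonneg)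
  show "lebesgue_norm \<Omega> q s (\<lambda>x. c * f x) = \<bar>c\<bar> * lebesgue_norm \<Omega> q s f"
    using assms weighted_norm_scale[of q \<Omega> s c f] by (simp add: lebesgue_norm_weighted)
  assume g: "g \<in> test_functions \<Omega>"
  show "(\<lambda>x. a * f x + b * g x) \<in> test_functions \<Omega>" using f g by (rule test_functions_lincomb)
  show "lebesgue_norm \<Omega> q s (\<lambda>x. f x + g x) \<le> lebesgue_norm \<Omega> q s f + lebesgue_norm \<Omega> q s g"
    using assms f g
    by (simp add: lebesgue_norm_weighted weighted_norm_triangle test_function_bounded_support(1))
qed

lemma sobolev_norm_nn_integral:
  fixes \<Omega> :: "(real^'n) set" and p q s \<mu> :: real
  assumes "open \<Omega>" "0 < p" "\<mu> < CARD('n)" "u \<in> test_functions \<Omega>"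
  shows "(\<integral>\<^sup>+x. ennreal (norm (gradient u x) powr p * norm x powr (- \<mu>)) \<partial>lborel) = ennreal (sobolev_norm \<Omega> p \<mu> u powr p)"
proof -
  have "(\<integral>\<^sup>+x. ennreal (norm (gradient u x) powr p * norm x powr (- \<mu>)) \<partial>lborel)
     = (\<integral>\<^sup>+x. ennreal (norm (gradient u x) powr p * norm x powr (- \<mu>)) * indicator \<Omega> x \<partial>lborel)"
    using test_function_zero_outside(2)[OF assms(4)] assms(2)
    by (intro nn_integral_cong) (auto split: split_indicator)
  also have "\<dots> = ennreal (sobolev_norm \<Omega> p \<mu> u powr p)"
    unfolding sobolev_norm_weighted using assms
    by (intro weighted_norm_nn_integral test_function_bounded_support(2)[OF assms(4)]) auto
  finally show ?thesis .
qed

lemma lebesgue_norm_nn_integral: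
  fixes \<Omega> :: "(real^'n) set" and p q s \<mu> :: real
  assumes "open \<Omega>" "0 < q" "s < CARD('n)" "u \<in> test_functions \<Omega>"
  shows "(\<integral>\<^sup>+x. ennreal (\<bar>u x\<bar> powr q * norm x powr (- s)) \<partial>lborel) = ennreal (lebesgue_norm \<Omega> q s u powr q)"
proof -
  have "(\<integral>\<^sup>+x. ennreal (\<bar>u x\<bar> powr q * norm x powr (- s)) \<partial>lborel)
     = (\<integral>\<^sup>+x. ennreal (norm (u x) powr q * norm x powr (- s)) * indicator \<Omega> x \<partial>lborel)"
    using test_function_zero_outside(1)[OF assms(4)] assms(2)
    by (intro nn_integral_cong) (auto split: split_indicator)
  also have "\<dots> = ennreal (lebesgue_norm \<Omega> q s u powr q)"
    unfolding lebesgue_norm_weighted using assms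
    by (intro weighted_norm_nn_integral test_function_bounded_support(1)[OF assms(4)]) auto
  finally show ?thesis .
qed

lemma punctured_C1_smooth: "smooth u \<Longrightarrow> punctured_C1 u (gradient u)"
  unfolding punctured_C1_def
  using smooth_GDERIV smooth_continuous_gradient continuous_on_subset by blast

text \<open>The product rule; the second term is the derivative of \<open>norm x powr (- a)\<close>, which is
  radial.\<close>

lemma punctured_C1_radial_mult:
  fixes u :: "real^'n \<Rightarrow> real"
  assumes "smooth u"
  shows "punctured_C1 (\<lambda>x. norm x powr (- a) * u x)
    (\<lambda>x. norm x powr (- a) *\<^sub>R gradient u x - (a * norm x powr (- a - 2) * u x) *\<^sub>R x)"
  unfolding punctured_C1_def
proof (intro conjI allI impI)
  fix x :: "real^'n" assume x: "x \<noteq> 0"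
  have "DERIV (\<lambda>t. t powr (- a)) (norm x) :> (- a) * norm x powr (- a - 1)"
    using x by (auto intro!: derivative_eq_intros)
  then have w: "GDERIV (\<lambda>x. norm x powr (- a)) x :> ((- a) * norm x powr (- a - 1)) *\<^sub>R sgn x"
    by (rule GDERIV_DERIV_compose[OF GDERIV_norm[OF x]])
  have "norm x powr (- a - 1) = norm x powr (- a - 2) * norm x"
  proof -
    have "norm x powr (- a - 2) * norm x powr 1 = norm x powr (- a - 1)"
      by (subst powr_add[symmetric]) (rule arg_cong[of _ _ "(powr) (norm x)"], simp)
    then show ?thesis using x by simp
  qed
  then have w': "((- a) * norm x powr (- a - 1)) *\<^sub>R sgn x = - (a * norm x powr (- a - 2)) *\<^sub>R x"
    using x by (simp add: sgn_div_norm)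
  with GDERIV_mult[OF w[unfolded w'] smooth_GDERIV[OF assms]]
  show "GDERIV (\<lambda>x. norm x powr (- a) * u x) x :>
    norm x powr (- a) *\<^sub>R gradient u x - (a * norm x powr (- a - 2) * u x) *\<^sub>R x"
    by (simp add: mult_ac)
next
  show "continuous_on (- {0}) (\<lambda>x. norm x powr (- a) *\<^sub>R gradient u x - (a * norm x powr (- a - 2) * u x) *\<^sub>R x)"
    using smooth_continuous_gradient[OF assms] smooth_continuous[OF assms]
    by (intro continuous_intros) (auto intro: continuous_on_subset)
qed

section \<open>Weighted inequalities for test functions\<close>

text \<open>A crude form of the weighted mean inequality. Integrated, it bounds the interpolated
  integral by the sum of the integrals at the two endpoints.\<close>

lemma powr_interpolation_le:
  fixes X Y \<theta> :: real
  assumes "0 \<le> X" "0 \<le> Y" "0 \<le> \<theta>" "\<theta> \<le> 1"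
  shows "X powr (1 - \<theta>) * Y powr \<theta> \<le> X + Y"
proof -
  have "X powr (1 - \<theta>) * Y powr \<theta> \<le> max X Y powr (1 - \<theta>) * max X Y powr \<theta>"
    using assms by (intro mult_mono powr_mono2) auto
  also have "\<dots> = max X Y powr 1" by (simp add: powr_add[symmetric])
  also have "\<dots> \<le> X + Y" using assms by auto
  finally show ?thesis .
qed

locale weighted_sobolev =
  fixes \<Omega> :: "(real^'n) set" and N p \<mu> :: real
  assumes N: "N = real CARD('n)" and dim: "2 \<le> CARD('n)" and open_domain: "open \<Omega>"
    and p: "1 \<le> p" "p < N" and \<mu>: "\<mu> < N - p"
begin

abbreviation test :: "(real^'n \<Rightarrow> real) set" where "test \<equiv> test_functions \<Omega>"

definition energy :: "(real^'n \<Rightarrow> real) \<Rightarrow> real" where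
  "energy u = sobolev_norm \<Omega> p \<mu> u powr p"

text \<open>The substitution that moves the weight of the gradient into the function.\<close>

definition flat :: "(real^'n \<Rightarrow> real) \<Rightarrow> real^'n \<Rightarrow> real" where
  "flat u x = norm x powr (- (\<mu> / p)) * u x"

definition flat_gradient :: "(real^'n \<Rightarrow> real) \<Rightarrow> real^'n \<Rightarrow> real^'n" where
  "flat_gradient u x = norm x powr (- (\<mu> / p)) *\<^sub>R gradient u x - ((\<mu> / p) * norm x powr (- (\<mu> / p) - 2) * u x) *\<^sub>R x"

text \<open>The constant of \<open>hardy_inequality\<close> for the weight exponent \<open>b\<close>.\<close>

definition hardy_const :: "real \<Rightarrow> real" where
  "hardy_const b = (1 - 2 powr ((b + p - N) / p)) powr (- p)"

definition flat_const :: real where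
  "flat_const = 2 powr p * (1 + \<bar>\<mu> / p\<bar> powr p * hardy_const \<mu>)"

lemma energy_nonneg: "0 \<le> energy u" by (simp add: energy_def)

lemma hardy_const_nonneg: "0 \<le> hardy_const b" by (simp add: hardy_const_def)

lemma flat_const_nonneg: "0 \<le> flat_const"
  unfolding flat_const_def by (intro mult_nonneg_nonneg add_nonneg_nonneg hardy_const_nonneg) auto

lemma energy_nn_integral:
  assumes "u \<in> test"
  shows "(\<integral>\<^sup>+x. ennreal (norm (gradient u x) powr p * norm x powr (- \<mu>)) \<partial>lborel) = ennreal (energy u)"
  unfolding energy_def using p \<mu> N by (intro sobolev_norm_nn_integral open_domain assms) auto

lemma flat_punctured_C1: "u \<in> test \<Longrightarrow> punctured_C1 (flat u) (flat_gradient u)"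
  unfolding flat_def[abs_def] flat_gradient_def[abs_def]
  by (intro punctured_C1_radial_mult test_functions_smooth)

lemma flat_powr:
  "\<bar>flat u x\<bar> powr r * norm x powr b = \<bar>u x\<bar> powr r * norm x powr (b - \<mu> / p * r)"
proof -
  have "norm x powr (b - \<mu> / p * r) = norm x powr (- (\<mu> / p) * r) * norm x powr b"
    by (simp add: powr_add[symmetric])
  then show ?thesis by (simp add: flat_def abs_mult powr_mult powr_powr)
qed

lemma test_weight_finite:
  assumes "u \<in> test" "b < N" "0 \<le> r"
  shows "(\<integral>\<^sup>+x. ennreal (\<bar>u x\<bar> powr r * norm x powr (- b)) \<partial>lborel) < \<infinity>"
  using bounded_support_weight_finite[OF test_function_bounded_support(1)[OF assms(1)], of b r] assms N by simp

lemma hardy_test: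
  assumes u: "u \<in> test"
  shows "(\<integral>\<^sup>+x. ennreal (\<bar>u x\<bar> powr p * norm x powr (- \<mu> - p)) \<partial>lborel) \<le> ennreal (hardy_const \<mu> * energy u)"
proof -
  have "(\<integral>\<^sup>+x. ennreal (\<bar>u x\<bar> powr p * norm x powr (- \<mu> - p)) \<partial>lborel)
    \<le> ennreal (hardy_const \<mu>) * (\<integral>\<^sup>+x. ennreal (norm (gradient u x) powr p * norm x powr (- \<mu>)) \<partial>lborel)"
    unfolding hardy_const_def
  proof (rule hardy_inequality[OF punctured_C1_smooth[OF test_functions_smooth[OF u]] p(1)])
    show "(\<integral>\<^sup>+x. ennreal (\<bar>u x\<bar> powr p * norm x powr (- \<mu> - p)) \<partial>lborel) < \<infinity>"
      using test_weight_finite[OF u, of "\<mu> + p" p] p \<mu> by simp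
  qed (use \<mu> N in auto)
  also have "\<dots> = ennreal (hardy_const \<mu> * energy u)"
    unfolding energy_nn_integral[OF u] by (simp add: ennreal_mult hardy_const_nonneg energy_nonneg)
  finally show ?thesis .
qed

lemma norm_radial_term:
  "norm ((\<mu> / p * norm x powr (- (\<mu> / p) - 2) * u x) *\<^sub>R (x :: real^'n)) = \<bar>\<mu> / p\<bar> * (norm x powr (- (\<mu> / p) - 1) * \<bar>u x\<bar>)"
proof -
  have "norm x powr (- (\<mu> / p) - 1) = norm x powr (- (\<mu> / p) - 2) * norm x"
  proof (cases "x = 0")
    case False
    have "norm x powr (- (\<mu> / p) - 2) * norm x powr 1 = norm x powr (- (\<mu> / p) - 1)"
      by (subst powr_add[symmetric]) (rule arg_cong[of _ _ "(powr) (norm x)"], simp)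
    then show ?thesis using False by simp
  qed simp
  then show ?thesis by (simp add: abs_mult mult_ac)
qed

lemma radial_term_powr:
  "(\<bar>\<mu> / p\<bar> * (norm x powr (- (\<mu> / p) - 1) * \<bar>u x\<bar>)) powr p
    = \<bar>\<mu> / p\<bar> powr p * (\<bar>u x\<bar> powr p * norm (x :: real^'n) powr (- \<mu> - p))"
proof -
  have "(- (\<mu> / p) - 1) * p = - \<mu> - p" using p by (simp add: field_simps)
  then show ?thesis by (simp add: powr_mult powr_powr mult_ac del: abs_divide)
qed

lemma weighted_gradient_powr:
  "norm (norm x powr (- (\<mu> / p)) *\<^sub>R gradient u x) powr p = norm (gradient u x) powr p * norm (x :: real^'n) powr (- \<mu>)"
  using p by (simp add: powr_mult powr_powr mult.commute)

text \<open>The gradient of \<open>flat u\<close> consists of the weighted gradient of \<open>u\<close> and a radial term of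
  size \<open>|u| / |x|\<close> times the weight, which Hardy's inequality controls.\<close>

lemma flat_gradient_bound:
  assumes u: "u \<in> test"
  shows "(\<integral>\<^sup>+x. ennreal (norm (flat_gradient u x) powr p) \<partial>lborel) \<le> ennreal (flat_const * energy u)"
proof -
  have [measurable]: "u \<in> borel_measurable borel" "gradient u \<in> borel_measurable borel"
    using test_function_bounded_support[OF u] by (auto simp: bounded_with_bounded_support_def)
  have "(\<integral>\<^sup>+x. ennreal (norm (flat_gradient u x) powr p) \<partial>lborel)
    \<le> (\<integral>\<^sup>+x. (ennreal (2 powr p) * ennreal (norm (gradient u x) powr p * norm x powr (- \<mu>))
       + ennreal (2 powr p * \<bar>\<mu> / p\<bar> powr p) * ennreal (\<bar>u x\<bar> powr p * norm x powr (- \<mu> - p))) \<partial>lborel)"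
  proof (intro nn_integral_mono)
    fix x :: "real^'n"
    let ?A = "norm (norm x powr (- (\<mu> / p)) *\<^sub>R gradient u x)"
    let ?B = "\<bar>\<mu> / p\<bar> * (norm x powr (- (\<mu> / p) - 1) * \<bar>u x\<bar>)"
    have "norm (flat_gradient u x) \<le> ?A + ?B"
      unfolding flat_gradient_def norm_radial_term[symmetric] by (rule norm_triangle_ineq4)
    then have "norm (flat_gradient u x) powr p \<le> (?A + ?B) powr p"
      using p by (intro powr_mono2) auto
    also have "\<dots> \<le> 2 powr p * (?A powr p + ?B powr p)"
      by (rule powr_add_le_double) (use p in auto)
    finally show "ennreal (norm (flat_gradient u x) powr p) \<le> ennreal (2 powr p) * ennreal (norm (gradient u x) powr p * norm x powr (- \<mu>))
       + ennreal (2 powr p * \<bar>\<mu> / p\<bar> powr p) * ennreal (\<bar>u x\<bar> powr p * norm x powr (- \<mu> - p))"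
      unfolding weighted_gradient_powr radial_term_powr
      by (simp add: ennreal_mult[symmetric] ennreal_plus[symmetric] distrib_left mult.assoc ennreal_leI del: ennreal_plus abs_divide)
  qed
  also have "\<dots> = ennreal (2 powr p) * (\<integral>\<^sup>+x. ennreal (norm (gradient u x) powr p * norm x powr (- \<mu>)) \<partial>lborel)
     + ennreal (2 powr p * \<bar>\<mu> / p\<bar> powr p) * (\<integral>\<^sup>+x. ennreal (\<bar>u x\<bar> powr p * norm x powr (- \<mu> - p)) \<partial>lborel)"
    by (rule nn_integral_lincomb) measurable
  also have "\<dots> \<le> ennreal (2 powr p) * ennreal (energy u) + ennreal (2 powr p * \<bar>\<mu> / p\<bar> powr p) * ennreal (hardy_const \<mu> * energy u)"
    unfolding energy_nn_integral[OF u] by (intro add_left_mono mult_left_mono hardy_test u) auto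
  also have "\<dots> = ennreal (flat_const * energy u)"
    by (simp add: ennreal_mult[symmetric] ennreal_plus[symmetric] hardy_const_nonneg energy_nonneg flat_const_def algebra_simps del: ennreal_plus abs_divide)
  finally show ?thesis .
qed

lemma flat_hardy_weight:
  "\<bar>flat u x\<bar> powr p * norm x powr (- 0 - p) = \<bar>u x\<bar> powr p * norm x powr (- \<mu> - p)"
proof -
  have "- 0 - p - \<mu> / p * p = - \<mu> - p" using p by simp
  then show ?thesis by (simp only: flat_powr)
qed

text \<open>Converse of \<open>flat_gradient_bound\<close>: the same radial term is now controlled by Hardy's
  inequality for \<open>flat u\<close> with trivial weight.\<close>

lemma energy_le_flat_gradient:
  assumes u: "u \<in> test"
  shows "ennreal (energy u) \<le> ennreal (2 powr p * (1 + \<bar>\<mu> / p\<bar> powr p * hardy_const 0))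
     * (\<integral>\<^sup>+x. ennreal (norm (flat_gradient u x) powr p) \<partial>lborel)"
proof -
  note [measurable] = punctured_C1_measurable[OF flat_punctured_C1[OF u]]
  have [measurable]: "u \<in> borel_measurable borel" "gradient u \<in> borel_measurable borel"
    using test_function_bounded_support[OF u] by (auto simp: bounded_with_bounded_support_def)
  define D where "D = (\<integral>\<^sup>+x. ennreal (norm (flat_gradient u x) powr p) \<partial>lborel)"
  have "(\<integral>\<^sup>+x. ennreal (\<bar>flat u x\<bar> powr p * norm x powr (- 0 - p)) \<partial>lborel)
     \<le> ennreal (hardy_const 0) * (\<integral>\<^sup>+x. ennreal (norm (flat_gradient u x) powr p * norm x powr (- 0)) \<partial>lborel)"
    unfolding hardy_const_def
  proof (rule hardy_inequality[OF flat_punctured_C1[OF u] p(1)])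
    show "(\<integral>\<^sup>+x. ennreal (\<bar>flat u x\<bar> powr p * norm x powr (- 0 - p)) \<partial>lborel) < \<infinity>"
      unfolding flat_hardy_weight using test_weight_finite[OF u, of "\<mu> + p" p] p \<mu> by simp
  qed (use p N in auto)
  also have "\<dots> \<le> ennreal (hardy_const 0) * D"
    unfolding D_def
  proof (intro mult_left_mono nn_integral_mono ennreal_leI)
    fix x :: "real^'n"
    show "norm (flat_gradient u x) powr p * norm x powr (- 0) \<le> norm (flat_gradient u x) powr p"
      by (cases "x = 0") auto
  qed auto
  finally have H: "(\<integral>\<^sup>+x. ennreal (\<bar>u x\<bar> powr p * norm x powr (- \<mu> - p)) \<partial>lborel) \<le> ennreal (hardy_const 0) * D"
    unfolding flat_hardy_weight .
  have "ennreal (energy u) = (\<integral>\<^sup>+x. ennreal (norm (gradient u x) powr p * norm x powr (- \<mu>)) \<partial>lborel)"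
    by (simp add: energy_nn_integral[OF u])
  also have "\<dots> \<le> (\<integral>\<^sup>+x. (ennreal (2 powr p) * ennreal (norm (flat_gradient u x) powr p)
       + ennreal (2 powr p * \<bar>\<mu> / p\<bar> powr p) * ennreal (\<bar>u x\<bar> powr p * norm x powr (- \<mu> - p))) \<partial>lborel)"
  proof (intro nn_integral_mono)
    fix x :: "real^'n"
    let ?A = "norm (flat_gradient u x)"
    let ?R = "(\<mu> / p * norm x powr (- (\<mu> / p) - 2) * u x) *\<^sub>R x"
    let ?B = "\<bar>\<mu> / p\<bar> * (norm x powr (- (\<mu> / p) - 1) * \<bar>u x\<bar>)"
    have "norm x powr (- (\<mu> / p)) *\<^sub>R gradient u x = flat_gradient u x + ?R"
      by (simp add: flat_gradient_def)
    then have "norm (norm x powr (- (\<mu> / p)) *\<^sub>R gradient u x) \<le> ?A + ?B"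
      unfolding norm_radial_term[symmetric] by (simp only: norm_triangle_ineq)
    then have "norm (norm x powr (- (\<mu> / p)) *\<^sub>R gradient u x) powr p \<le> (?A + ?B) powr p"
      using p by (intro powr_mono2) auto
    also have "\<dots> \<le> 2 powr p * (?A powr p + ?B powr p)"
      by (rule powr_add_le_double) (use p in auto)
    finally show "ennreal (norm (gradient u x) powr p * norm x powr (- \<mu>)) \<le> ennreal (2 powr p) * ennreal (norm (flat_gradient u x) powr p)
       + ennreal (2 powr p * \<bar>\<mu> / p\<bar> powr p) * ennreal (\<bar>u x\<bar> powr p * norm x powr (- \<mu> - p))"
      unfolding weighted_gradient_powr radial_term_powr
      by (simp add: ennreal_mult[symmetric] ennreal_plus[symmetric] distrib_left mult.assoc ennreal_leI del: ennreal_plus abs_divide)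
  qed
  also have "\<dots> = ennreal (2 powr p) * D
     + ennreal (2 powr p * \<bar>\<mu> / p\<bar> powr p) * (\<integral>\<^sup>+x. ennreal (\<bar>u x\<bar> powr p * norm x powr (- \<mu> - p)) \<partial>lborel)"
    unfolding D_def by (rule nn_integral_lincomb) measurable
  also have "\<dots> \<le> ennreal (2 powr p) * D + ennreal (2 powr p * \<bar>\<mu> / p\<bar> powr p) * (ennreal (hardy_const 0) * D)"
    by (intro add_left_mono mult_left_mono H) auto
  also have "\<dots> = ennreal (2 powr p * (1 + \<bar>\<mu> / p\<bar> powr p * hardy_const 0)) * D"
  proof -
    have "ennreal (2 powr p * (1 + \<bar>\<mu> / p\<bar> powr p * hardy_const 0))
       = ennreal (2 powr p) + ennreal (2 powr p * \<bar>\<mu> / p\<bar> powr p) * ennreal (hardy_const 0)"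
      by (simp add: ennreal_mult[symmetric] ennreal_plus[symmetric] hardy_const_nonneg algebra_simps del: ennreal_plus abs_divide)
    then show ?thesis by (simp only: distrib_right mult.assoc)
  qed
  finally show ?thesis by (simp add: D_def)
qed

lemma flat_translation_bound:
  assumes u: "u \<in> test"
  shows "(\<integral>\<^sup>+x. ennreal (\<bar>flat u (x + y) - flat u x\<bar> powr p) \<partial>lborel) \<le> ennreal (flat_const * energy u * norm y powr p)"
proof -
  have "(\<integral>\<^sup>+x. ennreal (\<bar>flat u (x + y) - flat u x\<bar> powr p) \<partial>lborel)
    \<le> ennreal (norm y powr p) * (\<integral>\<^sup>+x. ennreal (norm (flat_gradient u x) powr p) \<partial>lborel)"
    using dim by (intro translation_powr_bound[OF flat_punctured_C1[OF u] p(1)]) simp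
  also have "\<dots> \<le> ennreal (norm y powr p) * ennreal (flat_const * energy u)"
    by (intro mult_left_mono flat_gradient_bound u) auto
  also have "\<dots> = ennreal (flat_const * energy u * norm y powr p)"
    by (simp add: ennreal_mult[symmetric] flat_const_nonneg energy_nonneg mult.commute)
  finally show ?thesis .
qed

lemma flat_sobolev:
  assumes u: "u \<in> test"
  shows "(\<integral>\<^sup>+x. ennreal (\<bar>flat u x\<bar> powr crit_exp N p) \<partial>lborel)
    \<le> ennreal ((sobolev_const N p (measure lborel (ball (0::real^'n) 1)) * (flat_const * energy u)) powr (N / (N - p)))"
proof -
  let ?r = "crit_exp N p"
  have r: "0 \<le> ?r" using p by (simp add: crit_exp_def)
  have "\<mu> / p * ?r < N"
  proof -
    have "\<mu> / p * ?r = N * (\<mu> / (N - p))" using p by (simp add: crit_exp_def)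
    also have "\<dots> < N * 1" using p \<mu> by (intro mult_strict_left_mono) (auto simp: divide_less_eq)
    finally show ?thesis by simp
  qed
  moreover have "(\<integral>\<^sup>+x. ennreal (\<bar>flat u x\<bar> powr ?r) \<partial>lborel) \<le> (\<integral>\<^sup>+x. ennreal (\<bar>u x\<bar> powr ?r * norm x powr (- (\<mu> / p * ?r))) \<partial>lborel)"
  proof (intro nn_integral_mono ennreal_leI)
    fix x :: "real^'n"
    show "\<bar>flat u x\<bar> powr ?r \<le> \<bar>u x\<bar> powr ?r * norm x powr (- (\<mu> / p * ?r))"
      by (simp add: flat_def abs_mult powr_mult powr_powr)
  qed
  ultimately have "(\<integral>\<^sup>+x. ennreal (\<bar>flat u x\<bar> powr ?r) \<partial>lborel) < \<infinity>"
    using test_weight_finite[OF u, of "\<mu> / p * ?r" ?r] r by (meson order_le_less_trans)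
  then show ?thesis
    using sobolev_inequality[OF flat_punctured_C1[OF u] p(1) _ _ _ flat_gradient_bound[OF u]] p dim N
      flat_const_nonneg energy_nonneg by simp
qed

text \<open>The pairs of exponents (of \<open>|u|\<close> and of the weight) in Hardy's inequality, in Sobolev's
  inequality for \<open>flat u\<close> and in the claim lie on one line: \<open>s = \<mu> + p\<close> is Hardy and
  \<open>s = N * \<mu> / (N - p)\<close> is Sobolev.\<close>

lemma caffarelli_kohn_nirenberg:
  assumes u: "u \<in> test" and s: "N * \<mu> / (N - p) \<le> s" "s \<le> \<mu> + p"
  shows "(\<integral>\<^sup>+x. ennreal (\<bar>u x\<bar> powr weighted_crit_exp N p s \<mu> * norm x powr (- s)) \<partial>lborel)
    \<le> ennreal (hardy_const \<mu> * energy u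
       + (sobolev_const N p (measure lborel (ball (0::real^'n) 1)) * (flat_const * energy u)) powr (N / (N - p)))"
proof -
  note [measurable] = punctured_C1_measurable[OF flat_punctured_C1[OF u]]
  have [measurable]: "u \<in> borel_measurable borel"
    using test_function_bounded_support[OF u] by (auto simp: bounded_with_bounded_support_def)
  let ?q = "weighted_crit_exp N p s \<mu>" and ?r = "crit_exp N p"
  \<comment> \<open>\<open>\<theta>\<close> is the position of \<open>s\<close> between the Hardy endpoint (0) and the Sobolev endpoint (1).\<close>
  define \<theta> where "\<theta> = (\<mu> + p - s) * (N - p) / (p * (N - p - \<mu>))"
  have pos: "N - p > 0" "N - p - \<mu> > 0" "p > 0" using p \<mu> by auto
  have \<theta>0: "0 \<le> \<theta>" using s pos by (simp add: \<theta>_def)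
  have \<theta>1: "\<theta> \<le> 1"
  proof -
    have "(\<mu> + p - s) * (N - p) \<le> (\<mu> + p - N * \<mu> / (N - p)) * (N - p)"
      using s pos by (intro mult_right_mono) auto
    also have "\<dots> = p * (N - p - \<mu>)" using pos by (simp add: field_simps)
    finally show ?thesis using pos by (simp add: \<theta>_def)
  qed
  have \<theta>p: "\<theta> * (p * (N - p - \<mu>)) = (\<mu> + p - s) * (N - p)" using pos by (simp add: \<theta>_def)
  have eq_s: "(- \<mu> - p) * (1 - \<theta>) + - (\<mu> / p * ?r) * \<theta> = - s"
  proof -
    define k where "k = \<mu> / p * ?r"
    have k: "k * (N - p) = N * \<mu>" using pos by (simp add: k_def crit_exp_def)
    have "((- \<mu> - p) * (1 - \<theta>) + - k * \<theta>) * (N - p)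
        = (- \<mu> - p) * (N - p) + \<theta> * ((\<mu> + p) * (N - p) - k * (N - p))"
      by (simp add: algebra_simps)
    also have "\<dots> = (- \<mu> - p) * (N - p) + \<theta> * (p * (N - p - \<mu>))"
      unfolding k by (simp add: algebra_simps)
    also have "\<dots> = (- s) * (N - p)" unfolding \<theta>p by (simp add: algebra_simps)
    finally have e: "((- \<mu> - p) * (1 - \<theta>) + - k * \<theta>) * (N - p) = (- s) * (N - p)" .
    have "N - p \<noteq> 0" using pos by simp
    from iffD1[OF mult_right_cancel[OF this] e] show ?thesis unfolding k_def .
  qed
  have eq_q: "p * (1 - \<theta>) + ?r * \<theta> = ?q"
  proof -
    have "(p * (1 - \<theta>) + ?r * \<theta>) * (N - p) = p * (N - p) + p * (\<theta> * p)"
      using pos by (simp add: crit_exp_def field_simps)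
    then have "(p * (1 - \<theta>) + ?r * \<theta>) * (N - p) * (N - p - \<mu>) = p * (N - p) * (N - p - \<mu>) + p * (\<theta> * (p * (N - p - \<mu>)))"
      by (simp add: algebra_simps)
    also have "\<dots> = p * (N - s) * (N - p)" unfolding \<theta>p by (simp add: algebra_simps)
    also have "\<dots> = ?q * (N - p) * (N - p - \<mu>)" using pos by (simp add: weighted_crit_exp_def)
    finally have e: "(p * (1 - \<theta>) + ?r * \<theta>) * (N - p) * (N - p - \<mu>) = ?q * (N - p) * (N - p - \<mu>)" .
    have ne: "N - p \<noteq> 0" "N - p - \<mu> \<noteq> 0" using pos by auto
    show ?thesis by (rule iffD1[OF mult_right_cancel[OF ne(1)] iffD1[OF mult_right_cancel[OF ne(2)] e]])
  qed
  have "(\<integral>\<^sup>+x. ennreal (\<bar>u x\<bar> powr ?q * norm x powr (- s)) \<partial>lborel)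
    \<le> (\<integral>\<^sup>+x. (ennreal (\<bar>u x\<bar> powr p * norm x powr (- \<mu> - p)) + ennreal (\<bar>flat u x\<bar> powr ?r)) \<partial>lborel)"
  proof (intro nn_integral_mono)
    fix x :: "real^'n"
    let ?X = "\<bar>u x\<bar> powr p * norm x powr (- \<mu> - p)" and ?Y = "\<bar>flat u x\<bar> powr ?r"
    have Y: "?Y = \<bar>u x\<bar> powr ?r * norm x powr (- (\<mu> / p * ?r))"
      by (simp add: flat_def abs_mult powr_mult powr_powr)
    have "?X powr (1 - \<theta>) * ?Y powr \<theta>
       = \<bar>u x\<bar> powr (p * (1 - \<theta>) + ?r * \<theta>) * norm x powr ((- \<mu> - p) * (1 - \<theta>) + - (\<mu> / p * ?r) * \<theta>)"
      unfolding Y by (simp only: powr_mult powr_powr powr_add mult_ac)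
    also have "\<dots> = \<bar>u x\<bar> powr ?q * norm x powr (- s)" unfolding eq_s eq_q ..
    finally have "\<bar>u x\<bar> powr ?q * norm x powr (- s) \<le> ?X + ?Y"
      using powr_interpolation_le[of ?X ?Y \<theta>] \<theta>0 \<theta>1 by simp
    then show "ennreal (\<bar>u x\<bar> powr ?q * norm x powr (- s)) \<le> ennreal ?X + ennreal ?Y"
      by (simp add: ennreal_plus[symmetric] ennreal_leI del: ennreal_plus)
  qed
  also have "\<dots> = (\<integral>\<^sup>+x. ennreal (\<bar>u x\<bar> powr p * norm x powr (- \<mu> - p)) \<partial>lborel) + (\<integral>\<^sup>+x. ennreal (\<bar>flat u x\<bar> powr ?r) \<partial>lborel)"
    by (intro nn_integral_add) measurable
  also have "\<dots> \<le> ennreal (hardy_const \<mu> * energy u)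
       + ennreal ((sobolev_const N p (measure lborel (ball (0::real^'n) 1)) * (flat_const * energy u)) powr (N / (N - p)))"
    by (intro add_mono hardy_test flat_sobolev u)
  finally show ?thesis by (simp add: hardy_const_nonneg energy_nonneg)
qed

end

section \<open>Compactness and injectivity of the embedding\<close>

lemma AE_lborel_translate:
  fixes y :: "'a::euclidean_space"
  assumes "AE x in lborel. P x"
  shows "AE x in lborel. P (x + y)"
proof -
  obtain A where "{x \<in> space lborel. \<not> P x} \<subseteq> A" "emeasure lborel A = 0" "A \<in> sets lborel"
    using assms by (rule AE_E)
  then have A: "emeasure lborel A = 0" "\<And>x. \<not> P x \<Longrightarrow> x \<in> A" and [measurable]: "A \<in> sets borel"
    by auto
  have "(\<integral>\<^sup>+x. indicator A (x + y) \<partial>lborel) = (\<integral>\<^sup>+x. indicator A x \<partial>lborel)"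
    by (rule nn_integral_translate) measurable
  then have "(\<integral>\<^sup>+x. indicator A (x + y) \<partial>lborel) = 0" using A by simp
  then have "AE x in lborel. indicator A (x + y) = (0::ennreal)"
    by (subst (asm) nn_integral_0_iff_AE) auto
  then show ?thesis by eventually_elim (use A(2) in \<open>auto split: split_indicator_asm\<close>)
qed

text \<open>Recovers a bound for a gradient from bounds for its directional derivatives.\<close>

lemma norm_powr_le_sum_components:
  fixes D :: "real^'n"
  assumes p: "1 \<le> p"
  shows "norm D powr p \<le> real CARD('n) powr p * (\<Sum>i\<in>UNIV. \<bar>D $ i\<bar> powr p)"
proof -
  obtain i where i: "\<And>j. \<bar>D $ j\<bar> \<le> \<bar>D $ i\<bar>"
    using obtains_MAX[of "UNIV :: 'n set" "\<lambda>j. \<bar>D $ j\<bar>"] by (metis Max_ge UNIV_I UNIV_not_empty finite_class.finite_UNIV finite_imageI rangeI)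
  have "norm D \<le> (\<Sum>j\<in>UNIV. \<bar>D $ j\<bar>)" by (rule norm_le_l1_cart)
  also have "\<dots> \<le> (\<Sum>j\<in>(UNIV :: 'n set). \<bar>D $ i\<bar>)" by (intro sum_mono i)
  also have "\<dots> = real CARD('n) * \<bar>D $ i\<bar>" by simp
  finally have "norm D powr p \<le> (real CARD('n) * \<bar>D $ i\<bar>) powr p" using p by (intro powr_mono2) auto
  also have "\<dots> = real CARD('n) powr p * \<bar>D $ i\<bar> powr p" by (simp add: powr_mult)
  also have "\<dots> \<le> real CARD('n) powr p * (\<Sum>j\<in>UNIV. \<bar>D $ j\<bar> powr p)"
    by (intro mult_left_mono member_le_sum) auto
  finally show ?thesis .
qed

text \<open>Uniform integrability from a bound at a higher exponent \<open>r\<close>: values above \<open>R\<close> are paid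
  by the power \<open>r\<close> with the small factor \<open>R powr (q - r)\<close>. In the second bound values below
  \<open>h\<close> are negligible and those in between are paid by the power \<open>p\<close>.\<close>

lemma subcritical_powr_bound:
  fixes t q r p R h :: real
  assumes t: "0 \<le> t" and R: "0 < R" and h: "0 < h" and q: "1 \<le> q" "q < r" and p: "1 \<le> p"
  shows "t powr q \<le> R powr q + R powr (q - r) * t powr r"
    and "t powr q \<le> h powr q + R powr (q - r) * t powr r + R powr q * h powr (- p) * t powr p"
proof -
  have big: "t powr q \<le> R powr (q - r) * t powr r" if "R \<le> t"
  proof -
    have "t powr q = t powr (q - r) * t powr r" by (simp add: powr_add[symmetric])
    also have "\<dots> \<le> R powr (q - r) * t powr r"
      using that R q by (intro mult_right_mono powr_mono2') auto
    finally show ?thesis .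
  qed
  have small: "t powr q \<le> R powr q" if "t \<le> R" using that t q by (intro powr_mono2) auto
  show "t powr q \<le> R powr q + R powr (q - r) * t powr r"
    using big small by (cases "R \<le> t") (auto intro: add_increasing add_increasing2)
  show "t powr q \<le> h powr q + R powr (q - r) * t powr r + R powr q * h powr (- p) * t powr p"
  proof -
    consider "R \<le> t" | "t \<le> h" | "t \<le> R" "h \<le> t" by linarith
    then show ?thesis
    proof cases
      case 1
      have "0 \<le> h powr q" "0 \<le> R powr q * h powr (- p) * t powr p" by auto
      then show ?thesis using big[OF 1] by linarith
    next
      case 2
      then have "t powr q \<le> h powr q" using t q by (intro powr_mono2) auto
      moreover have "0 \<le> R powr (q - r) * t powr r" "0 \<le> R powr q * h powr (- p) * t powr p" by auto
      ultimately show ?thesis by linarith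
    next
      case 3
      have "1 = h powr (- p) * h powr p" using h by (simp add: powr_add[symmetric])
      also have "\<dots> \<le> h powr (- p) * t powr p" using 3 h p by (intro mult_left_mono powr_mono2) auto
      finally have "R powr q * 1 \<le> R powr q * (h powr (- p) * t powr p)" by (intro mult_left_mono) auto
      then have "t powr q \<le> R powr q * h powr (- p) * t powr p" using small[OF 3(1)] by (simp add: mult.assoc)
      moreover have "0 \<le> R powr (q - r) * t powr r" "0 \<le> h powr q" by auto
      ultimately show ?thesis by linarith
    qed
  qed
qed

lemma annulus_powr_bound:
  fixes b \<rho> t :: real
  assumes "1 \<le> \<rho>" "1 / \<rho> \<le> t" "t \<le> \<rho>"
  shows "t powr b \<le> \<rho> powr \<bar>b\<bar>"
proof (cases "0 \<le> b")
  case True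
  have "0 < t" using assms by (smt (verit) divide_pos_pos)
  then show ?thesis using True assms by (simp add: powr_mono2)
next
  case False
  have t: "0 < 1 / \<rho>" using assms by simp
  have "t powr b \<le> (1 / \<rho>) powr b" using False assms t by (intro powr_mono2') auto
  also have "\<dots> = 1 / \<rho> powr b" using assms by (simp only: powr_divide powr_one_eq_one)
  also have "\<dots> = \<rho> powr \<bar>b\<bar>" using False by (simp add: powr_minus divide_inverse)
  finally show ?thesis .
qed

text \<open>Dominated convergence: the complements of the annuli \<open>1 / \<rho> \<le> norm x \<le> \<rho>\<close> shrink to the
  origin.\<close>

lemma nn_integral_outside_annulus:
  fixes f :: "'a::euclidean_space \<Rightarrow> ennreal"
  assumes [measurable]: "f \<in> borel_measurable borel" and fin: "(\<integral>\<^sup>+x. f x \<partial>lborel) < \<infinity>" and e: "0 < e"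
  shows "\<exists>\<rho>\<ge>1. (\<integral>\<^sup>+x. f x * indicator {x. \<not> (1 / \<rho> \<le> norm x \<and> norm x \<le> \<rho>)} x \<partial>lborel) < ennreal e"
proof -
  define A where "A k = {x::'a. \<not> (1 / real (Suc k) \<le> norm x \<and> norm x \<le> real (Suc k))}" for k
  have [measurable]: "A k \<in> sets borel" for k unfolding A_def by measurable
  have "(\<lambda>k. \<integral>\<^sup>+x. f x * indicator (A k) x \<partial>lborel) \<longlonglongrightarrow> (\<integral>\<^sup>+x. 0 \<partial>(lborel :: 'a measure))"
  proof (rule nn_integral_dominated_convergence[where w = f])
    have "AE x in lborel. x \<noteq> (0::'a)" by (rule AE_lborel_singleton)
    then show "AE x in lborel. (\<lambda>k. f x * indicator (A k) x) \<longlonglongrightarrow> 0"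
    proof eventually_elim
      case (elim x)
      obtain k1 :: nat where k1: "1 / real (Suc k1) < norm x" using nat_approx_posE[of "norm x"] elim by auto
      obtain k2 :: nat where k2: "norm x < real k2" using reals_Archimedean2 by blast
      have "x \<notin> A k" if "k \<ge> max k1 k2" for k
      proof -
        have "1 / real (Suc k) \<le> 1 / real (Suc k1)" using that by (intro divide_left_mono) auto
        then show ?thesis using k1 k2 that by (auto simp: A_def)
      qed
      then have "\<forall>\<^sub>F k in sequentially. f x * indicator (A k) x = 0"
        by (auto simp: eventually_sequentially intro!: exI[of _ "max k1 k2"])
      then show ?case by (rule tendsto_eventually)
    qed
    show "AE x in lborel. f x * indicator (A k) x \<le> f x" for k
      by (auto split: split_indicator)
  qed (use fin in auto)
  then have "\<forall>\<^sub>F k in sequentially. (\<integral>\<^sup>+x. f x * indicator (A k) x \<partial>lborel) < ennreal e"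
    using e by (intro order_tendstoD(2)[where y = 0]) auto
  then obtain k where "(\<integral>\<^sup>+x. f x * indicator (A k) x \<partial>lborel) < ennreal e"
    by (auto simp: eventually_sequentially)
  then show ?thesis unfolding A_def by (intro exI[of _ "real (Suc k)"]) auto
qed

context weighted_sobolev
begin

lemma sobolev_seminorm: "function_seminorm test (sobolev_norm \<Omega> p \<mu>)"
  using sobolev_norm_seminorm[OF open_domain p(1), of \<mu>] \<mu> p N by simp

lemma lebesgue_seminorm: "1 \<le> q \<Longrightarrow> s < N \<Longrightarrow> function_seminorm test (lebesgue_norm \<Omega> q s)"
  using lebesgue_norm_seminorm[OF open_domain, of q s] N by simp

lemma test_diff: "u \<in> test \<Longrightarrow> w \<in> test \<Longrightarrow> (\<lambda>x. u x - w x) \<in> test"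
  using function_seminorm.diff_in[OF sobolev_seminorm] .

lemma flat_diff: "flat (\<lambda>x. u x - w x) x = flat u x - flat w x"
  by (simp add: flat_def right_diff_distrib)

lemma energy_diff_le:
  assumes "u \<in> test" "w \<in> test" "sobolev_norm \<Omega> p \<mu> u \<le> B" "sobolev_norm \<Omega> p \<mu> w \<le> B"
  shows "energy (\<lambda>x. u x - w x) \<le> (2 * B) powr p"
proof -
  interpret S: function_seminorm test "sobolev_norm \<Omega> p \<mu>" by (rule sobolev_seminorm)
  have "sobolev_norm \<Omega> p \<mu> (\<lambda>x. u x + - 1 * w x) \<le> sobolev_norm \<Omega> p \<mu> u + sobolev_norm \<Omega> p \<mu> (\<lambda>x. - 1 * w x)"
    by (intro S.triangle S.scale_in assms)
  also have "sobolev_norm \<Omega> p \<mu> (\<lambda>x. - 1 * w x) = sobolev_norm \<Omega> p \<mu> w"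
    unfolding S.scale[OF assms(2)] by simp
  finally have "sobolev_norm \<Omega> p \<mu> (\<lambda>x. u x - w x) \<le> 2 * B" using assms(3,4) by simp
  then show ?thesis
    unfolding energy_def using p S.nonneg[OF test_diff[OF assms(1,2)]] by (intro powr_mono2) auto
qed

text \<open>On a ball of radius \<open>R\<close> the Hardy weight \<open>norm x powr (- p)\<close> is at least
  \<open>R powr (- p)\<close>.\<close>

lemma flat_ball_bound:
  assumes u: "u \<in> test"
  shows "(\<integral>\<^sup>+x. ennreal (\<bar>flat u x\<bar> powr p) * indicator (cball 0 R) x \<partial>lborel) \<le> ennreal (\<bar>R\<bar> powr p * (hardy_const \<mu> * energy u))"
proof -
  have [measurable]: "u \<in> borel_measurable borel"
    using test_function_bounded_support[OF u] by (auto simp: bounded_with_bounded_support_def)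
  have "(\<integral>\<^sup>+x. ennreal (\<bar>flat u x\<bar> powr p) * indicator (cball 0 R) x \<partial>lborel)
    \<le> (\<integral>\<^sup>+x. ennreal (\<bar>R\<bar> powr p) * ennreal (\<bar>u x\<bar> powr p * norm x powr (- \<mu> - p)) \<partial>lborel)"
  proof (intro nn_integral_mono)
    fix x :: "real^'n"
    show "ennreal (\<bar>flat u x\<bar> powr p) * indicator (cball 0 R) x \<le> ennreal (\<bar>R\<bar> powr p) * ennreal (\<bar>u x\<bar> powr p * norm x powr (- \<mu> - p))"
    proof (cases "norm x \<le> R \<and> x \<noteq> 0")
      case True
      have "1 = norm x powr p * norm x powr (- 0 - p)" using True by (simp add: powr_add[symmetric])
      also have "\<dots> \<le> \<bar>R\<bar> powr p * norm x powr (- 0 - p)" using True p by (intro mult_right_mono powr_mono2) auto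
      finally have "\<bar>flat u x\<bar> powr p * 1 \<le> \<bar>flat u x\<bar> powr p * (\<bar>R\<bar> powr p * norm x powr (- 0 - p))"
        by (intro mult_left_mono) auto
      also have "\<dots> = \<bar>R\<bar> powr p * (\<bar>u x\<bar> powr p * norm x powr (- \<mu> - p))"
        unfolding flat_hardy_weight[symmetric] by (simp only: mult_ac)
      finally show ?thesis using True by (simp add: ennreal_mult[symmetric] ennreal_leI)
    next
      case False
      then show ?thesis by (cases "x = 0") (auto simp: flat_def)
    qed
  qed
  also have "\<dots> = ennreal (\<bar>R\<bar> powr p) * (\<integral>\<^sup>+x. ennreal (\<bar>u x\<bar> powr p * norm x powr (- \<mu> - p)) \<partial>lborel)"
    by (rule nn_integral_cmult) measurable
  also have "\<dots> \<le> ennreal (\<bar>R\<bar> powr p) * ennreal (hardy_const \<mu> * energy u)"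
    by (intro mult_left_mono hardy_test u) auto
  also have "\<dots> = ennreal (\<bar>R\<bar> powr p * (hardy_const \<mu> * energy u))"
    by (simp add: ennreal_mult[symmetric] hardy_const_nonneg energy_nonneg)
  finally show ?thesis .
qed

text \<open>Let \<open>w\<close> be a difference of two members. The integral of \<open>|w| powr q\<close> against the weight
  splits into four parts, each made at most a quarter of \<open>T\<close>: values above \<open>R\<close>, bounded by the
  critical norm; the part outside an annulus, where the weight has small mass; values below
  \<open>h\<close>, bounded through the finite mass of the weight; and the rest, which is bounded by the
  \<open>L\<^sup>p\<close> norm of \<open>flat w\<close> on a ball. Kolmogorov's criterion makes the last part small along a
  subsequence.\<close>

lemma small_subsequence:
  assumes s: "N * \<mu> / (N - p) \<le> s" "s \<le> \<mu> + p" and q: "1 \<le> q" "q < weighted_crit_exp N p s \<mu>"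
    and \<nu>: "(\<integral>\<^sup>+x. ennreal (norm x powr (- s)) * indicator \<Omega> x \<partial>lborel) < \<infinity>"
    and u: "\<And>k :: nat. u k \<in> test" and B: "\<And>k. sobolev_norm \<Omega> p \<mu> (u k) \<le> B" and e: "0 < e"
  shows "\<exists>r :: nat \<Rightarrow> nat. strict_mono r \<and> (\<exists>M. \<forall>m\<ge>M. \<forall>n\<ge>M. lebesgue_norm \<Omega> q s (\<lambda>x. u (r m) x - u (r n) x) < e)"
proof -
  define r where "r = weighted_crit_exp N p s \<mu>"
  have sN: "s < N" using s \<mu> by simp
  have [measurable]: "\<Omega> \<in> sets borel" using open_domain by simp
  have B0: "0 \<le> B" using B[of 0] weighted_norm_nonneg[of \<Omega> p \<mu> "gradient (u 0)"] by (simp add: sobolev_norm_weighted)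
  define E where "E = (2 * B) powr p"
  have energy_u: "energy (u k) \<le> E" for k
    unfolding energy_def E_def using B[of k] B0 p weighted_norm_nonneg[of \<Omega> p \<mu> "gradient (u k)"]
    by (intro powr_mono2) (auto simp: sobolev_norm_weighted)
  have energy_diff: "energy (\<lambda>x. u i x - u j x) \<le> E" for i j
    unfolding E_def by (intro energy_diff_le u B)
  define c where "c = sobolev_const N p (measure lborel (ball (0::real^'n) 1))"
  have c: "0 \<le> c"
  proof -
    have "0 \<le> crit_exp N p" using p by (simp add: crit_exp_def)
    then show ?thesis unfolding c_def sobolev_const_def by (intro mult_nonneg_nonneg) auto
  qed
  define K where "K = hardy_const \<mu> * E + (c * (flat_const * E)) powr (N / (N - p))"
  have E0: "0 \<le> E" by (simp add: E_def)
  have K0: "0 \<le> K" using hardy_const_nonneg E0 by (simp add: K_def)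
  have ckn: "(\<integral>\<^sup>+x. ennreal (\<bar>u i x - u j x\<bar> powr r * norm x powr (- s)) \<partial>lborel) \<le> ennreal K" for i j
  proof -
    have "(\<integral>\<^sup>+x. ennreal (\<bar>u i x - u j x\<bar> powr r * norm x powr (- s)) \<partial>lborel)
      \<le> ennreal (hardy_const \<mu> * energy (\<lambda>x. u i x - u j x) + (c * (flat_const * energy (\<lambda>x. u i x - u j x))) powr (N / (N - p)))"
      unfolding r_def c_def by (intro caffarelli_kohn_nirenberg test_diff u s)
    also have "\<dots> \<le> ennreal K"
      unfolding K_def using energy_diff[of i j] p
      by (intro ennreal_leI add_mono mult_left_mono powr_mono2 mult_nonneg_nonneg hardy_const_nonneg flat_const_nonneg energy_nonneg c) auto
    finally show ?thesis .
  qed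
  define T where "T = (e / 2) powr q"
  have T: "T > 0" using e by (simp add: T_def)
  \<comment> \<open>Since \<open>q < r\<close>, the exponent \<open>q - r\<close> is negative and \<open>R powr (q - r)\<close> is small for large \<open>R\<close>.\<close>
  define R where "R = (T / (4 * (K + 1))) powr (1 / (q - r))"
  have R: "R > 0" using T K0 by (simp add: R_def)
  have RK: "R powr (q - r) * K \<le> T / 4"
  proof -
    have "R powr (q - r) = T / (4 * (K + 1))" using q T K0 by (simp add: R_def powr_powr r_def)
    then have "R powr (q - r) * K = (T / 4) * (K / (K + 1))" using K0 by (simp add: divide_simps)
    also have "\<dots> \<le> (T / 4) * 1" using T K0 by (intro mult_left_mono) auto
    finally show ?thesis by simp
  qed
  obtain \<rho> where \<rho>: "1 \<le> \<rho>"
     "(\<integral>\<^sup>+x. (ennreal (norm x powr (- s)) * indicator \<Omega> x) * indicator {x. \<not> (1 / \<rho> \<le> norm x \<and> norm x \<le> \<rho>)} x \<partial>lborel) < ennreal (T / (4 * R powr q))"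
    using nn_integral_outside_annulus[of "\<lambda>x. ennreal (norm x powr (- s)) * indicator \<Omega> x" "T / (4 * R powr q)"] \<nu> T R by auto
  define A where "A = {x::real^'n. 1 / \<rho> \<le> norm x \<and> norm x \<le> \<rho>}"
  have [measurable]: "A \<in> sets borel" unfolding A_def by measurable
  obtain V where V: "(\<integral>\<^sup>+x. ennreal (norm x powr (- s)) * indicator \<Omega> x \<partial>lborel) = ennreal V" "0 \<le> V"
    using \<nu> by (cases "\<integral>\<^sup>+x. ennreal (norm x powr (- s)) * indicator \<Omega> x \<partial>lborel") auto
  define h where "h = (T / (4 * (V + 1))) powr (1 / q)"
  have h: "h > 0" using T V by (simp add: h_def)
  have hV: "h powr q * V \<le> T / 4"
  proof -
    have "h powr q = T / (4 * (V + 1))" using q T V by (simp add: h_def powr_powr)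
    then have "h powr q * V = (T / 4) * (V / (V + 1))" using V by (simp add: divide_simps)
    also have "\<dots> \<le> (T / 4) * 1" using T V by (intro mult_left_mono) auto
    finally show ?thesis by simp
  qed
  define L where "L = R powr q * h powr (- p) * \<rho> powr \<bar>\<mu> - s\<bar>"
  have L: "L > 0" using R h \<rho> by (simp add: L_def)
  have "\<exists>\<sigma> :: nat \<Rightarrow> nat. strict_mono \<sigma> \<and> (\<exists>M. \<forall>m\<ge>M. \<forall>n\<ge>M.
     (\<integral>\<^sup>+x. ennreal (\<bar>flat (u (\<sigma> m)) x - flat (u (\<sigma> n)) x\<bar> powr p) * indicator (cball 0 \<rho>) x \<partial>lborel) \<le> ennreal (T / (4 * L)))"
  proof (rule kolmogorov_small_subsequence[OF p(1)])
    show "flat (u n) \<in> borel_measurable borel" for n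
      by (rule punctured_C1_measurable[OF flat_punctured_C1[OF u]])
    show "\<exists>H. \<forall>n. (\<integral>\<^sup>+x. ennreal (\<bar>flat (u n) x\<bar> powr p) * indicator (cball 0 R') x \<partial>lborel) \<le> ennreal H" for R'
    proof (intro exI allI)
      fix n
      show "(\<integral>\<^sup>+x. ennreal (\<bar>flat (u n) x\<bar> powr p) * indicator (cball 0 R') x \<partial>lborel) \<le> ennreal (\<bar>R'\<bar> powr p * (hardy_const \<mu> * E))"
        by (rule order_trans[OF flat_ball_bound[OF u]])
           (intro ennreal_leI mult_left_mono energy_u hardy_const_nonneg, auto)
    qed
    show "(\<integral>\<^sup>+x. ennreal (\<bar>flat (u n) (x + y) - flat (u n) x\<bar> powr p) \<partial>lborel) \<le> ennreal (flat_const * E * norm y powr p)" for n y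
      by (rule order_trans[OF flat_translation_bound[OF u]])
         (intro ennreal_leI mult_left_mono mult_right_mono energy_u flat_const_nonneg, auto)
    show "0 \<le> flat_const * E" using flat_const_nonneg E0 by simp
    show "0 < T / (4 * L)" using T L by simp
  qed
  then obtain \<sigma> :: "nat \<Rightarrow> nat" and M where \<sigma>: "strict_mono \<sigma>" and M: "\<And>m n. m \<ge> M \<Longrightarrow> n \<ge> M \<Longrightarrow>
     (\<integral>\<^sup>+x. ennreal (\<bar>flat (u (\<sigma> m)) x - flat (u (\<sigma> n)) x\<bar> powr p) * indicator (cball 0 \<rho>) x \<partial>lborel) \<le> ennreal (T / (4 * L))"
    by blast
  have "lebesgue_norm \<Omega> q s (\<lambda>x. u (\<sigma> m) x - u (\<sigma> n) x) < e" if mn: "m \<ge> M" "n \<ge> M" for m n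
  proof -
    define w where "w x = u (\<sigma> m) x - u (\<sigma> n) x" for x
    have w: "w \<in> test" unfolding w_def[abs_def] by (intro test_diff u)
    have [measurable]: "w \<in> borel_measurable borel"
      using test_function_bounded_support[OF w] by (auto simp: bounded_with_bounded_support_def)
    have [measurable]: "flat w \<in> borel_measurable borel"
      by (rule punctured_C1_measurable[OF flat_punctured_C1[OF w]])
    have [measurable]: "cball (0::real^'n) \<rho> \<in> sets borel" by simp
    let ?W = "\<lambda>x. ennreal (norm x powr (- s)) * indicator \<Omega> x"
    let ?C = "{x::real^'n. \<not> (1 / \<rho> \<le> norm x \<and> norm x \<le> \<rho>)}"
    have [measurable]: "?C \<in> sets borel" by measurable
    have "(\<integral>\<^sup>+x. ennreal (\<bar>w x\<bar> powr q * norm x powr (- s)) \<partial>lborel)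
      \<le> (\<integral>\<^sup>+x. ((ennreal (R powr (q - r)) * ennreal (\<bar>w x\<bar> powr r * norm x powr (- s)) + ennreal (R powr q) * (?W x * indicator ?C x))
          + (ennreal (h powr q) * ?W x + ennreal L * (ennreal (\<bar>flat w x\<bar> powr p) * indicator (cball 0 \<rho>) x))) \<partial>lborel)"
    proof (intro nn_integral_mono)
      fix x :: "real^'n"
      show "ennreal (\<bar>w x\<bar> powr q * norm x powr (- s)) \<le>
        (ennreal (R powr (q - r)) * ennreal (\<bar>w x\<bar> powr r * norm x powr (- s)) + ennreal (R powr q) * (?W x * indicator ?C x))
          + (ennreal (h powr q) * ?W x + ennreal L * (ennreal (\<bar>flat w x\<bar> powr p) * indicator (cball 0 \<rho>) x))"
      proof (cases "x \<in> \<Omega>")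
        case False
        then have "w x = 0" using test_function_zero_outside(1)[OF w] by simp
        then show ?thesis by simp
      next
        case x\<Omega>: True
        show ?thesis
        proof (cases "x \<in> ?C")
          case True
          have "\<bar>w x\<bar> powr q * norm x powr (- s) \<le> (R powr q + R powr (q - r) * \<bar>w x\<bar> powr r) * norm x powr (- s)"
            using subcritical_powr_bound(1)[OF _ R h q(1) _ p(1), of "\<bar>w x\<bar>" r] q by (intro mult_right_mono) (auto simp: r_def)
          then have "ennreal (\<bar>w x\<bar> powr q * norm x powr (- s))
            \<le> ennreal (R powr (q - r)) * ennreal (\<bar>w x\<bar> powr r * norm x powr (- s)) + ennreal (R powr q) * ennreal (norm x powr (- s))"
            by (simp add: ennreal_mult[symmetric] ennreal_plus[symmetric] algebra_simps ennreal_leI del: ennreal_plus)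
          then show ?thesis using True x\<Omega> by (simp add: add_increasing2)
        next
          case False
          then have xA: "1 / \<rho> \<le> norm x" "norm x \<le> \<rho>" by auto
          then have "x \<noteq> 0" using \<rho>(1) by auto
          have "\<bar>w x\<bar> powr p * norm x powr (- s) = \<bar>flat w x\<bar> powr p * norm x powr (\<mu> - s)"
          proof -
            have "- s = (\<mu> - s) - \<mu> / p * p" using p by simp
            then show ?thesis using flat_powr[of w x p "\<mu> - s"] by simp
          qed
          also have "\<dots> \<le> \<bar>flat w x\<bar> powr p * \<rho> powr \<bar>\<mu> - s\<bar>"
            using annulus_powr_bound[OF \<rho>(1) xA] by (intro mult_left_mono) auto
          finally have fl: "R powr q * h powr (- p) * (\<bar>w x\<bar> powr p * norm x powr (- s)) \<le> R powr q * h powr (- p) * (\<bar>flat w x\<bar> powr p * \<rho> powr \<bar>\<mu> - s\<bar>)"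
            by (intro mult_left_mono) auto
          have "\<bar>w x\<bar> powr q * norm x powr (- s)
            \<le> (h powr q + R powr (q - r) * \<bar>w x\<bar> powr r + R powr q * h powr (- p) * \<bar>w x\<bar> powr p) * norm x powr (- s)"
            using subcritical_powr_bound(2)[OF _ R h q(1) _ p(1), of "\<bar>w x\<bar>" r] q by (intro mult_right_mono) (auto simp: r_def)
          also have "\<dots> = R powr (q - r) * (\<bar>w x\<bar> powr r * norm x powr (- s)) + (h powr q * norm x powr (- s) + R powr q * h powr (- p) * (\<bar>w x\<bar> powr p * norm x powr (- s)))"
            by (simp only: algebra_simps)
          also have "\<dots> \<le> R powr (q - r) * (\<bar>w x\<bar> powr r * norm x powr (- s)) + (h powr q * norm x powr (- s) + L * \<bar>flat w x\<bar> powr p)"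
            using fl by (simp add: L_def mult_ac)
          finally have "ennreal (\<bar>w x\<bar> powr q * norm x powr (- s)) \<le> ennreal (R powr (q - r)) * ennreal (\<bar>w x\<bar> powr r * norm x powr (- s))
             + (ennreal (h powr q) * ennreal (norm x powr (- s)) + ennreal L * ennreal (\<bar>flat w x\<bar> powr p))"
            using L by (simp add: ennreal_mult[symmetric] ennreal_plus[symmetric] ennreal_leI del: ennreal_plus)
          then show ?thesis using False xA x\<Omega> by simp
        qed
      qed
    qed
    also have "\<dots> = (ennreal (R powr (q - r)) * (\<integral>\<^sup>+x. ennreal (\<bar>w x\<bar> powr r * norm x powr (- s)) \<partial>lborel)
          + ennreal (R powr q) * (\<integral>\<^sup>+x. ?W x * indicator ?C x \<partial>lborel))
        + (ennreal (h powr q) * (\<integral>\<^sup>+x. ?W x \<partial>lborel) + ennreal L * (\<integral>\<^sup>+x. ennreal (\<bar>flat w x\<bar> powr p) * indicator (cball 0 \<rho>) x \<partial>lborel))"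
    proof -
      have m1: "(\<lambda>x. ennreal (\<bar>w x\<bar> powr r * norm x powr (- s))) \<in> borel_measurable lborel"
        "(\<lambda>x. ?W x * indicator ?C x) \<in> borel_measurable lborel" "?W \<in> borel_measurable lborel"
        "(\<lambda>x. ennreal (\<bar>flat w x\<bar> powr p) * indicator (cball 0 \<rho>) x) \<in> borel_measurable lborel"
        by measurable
      show ?thesis
        using m1 by (subst nn_integral_add) (auto intro!: arg_cong2[of _ _ _ _ "(+)"] nn_integral_lincomb borel_measurable_add borel_measurable_times)
    qed
    also have "\<dots> \<le> (ennreal (R powr (q - r)) * ennreal K + ennreal (R powr q) * ennreal (T / (4 * R powr q)))
        + (ennreal (h powr q) * ennreal V + ennreal L * ennreal (T / (4 * L)))"
    proof (intro add_mono mult_left_mono)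
      show "(\<integral>\<^sup>+x. ennreal (\<bar>w x\<bar> powr r * norm x powr (- s)) \<partial>lborel) \<le> ennreal K" unfolding w_def by (rule ckn)
      show "(\<integral>\<^sup>+x. ennreal (\<bar>flat w x\<bar> powr p) * indicator (cball 0 \<rho>) x \<partial>lborel) \<le> ennreal (T / (4 * L))"
        using M[OF mn] unfolding w_def[abs_def] flat_diff .
    qed (use \<rho>(2) V(1) in auto)
    also have "\<dots> = ennreal ((R powr (q - r) * K + T / 4) + (h powr q * V + T / 4))"
      using K0 V L T R by (simp add: ennreal_mult[symmetric] ennreal_plus[symmetric] del: ennreal_plus)
    also have "\<dots> \<le> ennreal T" using RK hV by (intro ennreal_leI) simp
    finally have "lebesgue_norm \<Omega> q s w powr q \<le> T"
      using lebesgue_norm_nn_integral[OF open_domain _ _ w, of q s] q sN N T by simp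
    then have "(lebesgue_norm \<Omega> q s w powr q) powr (1 / q) \<le> T powr (1 / q)"
      by (rule powr_mono2[rotated 2]) (use q in auto)
    then have "lebesgue_norm \<Omega> q s w \<le> e / 2"
      using q e weighted_norm_nonneg[of \<Omega> q s w] by (simp add: T_def powr_powr lebesgue_norm_weighted)
    then show ?thesis using e by (simp add: w_def[abs_def])
  qed
  then show ?thesis using \<sigma> by blast
qed

lemma bounded_sequence_has_cauchy_subsequence:
  assumes s: "N * \<mu> / (N - p) \<le> s" "s \<le> \<mu> + p" and q: "1 \<le> q" "q < weighted_crit_exp N p s \<mu>"
    and \<nu>: "(\<integral>\<^sup>+x. ennreal (norm x powr (- s)) * indicator \<Omega> x \<partial>lborel) < \<infinity>"
    and u: "\<And>k :: nat. u k \<in> test" and B: "\<exists>B. \<forall>k. sobolev_norm \<Omega> p \<mu> (u k) \<le> B"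
  shows "\<exists>r :: nat \<Rightarrow> nat. strict_mono r \<and> (\<lambda>k. u (r k)) \<in> cauchy_seqs test (lebesgue_norm \<Omega> q s)"
proof -
  obtain B where B: "\<And>k. sobolev_norm \<Omega> p \<mu> (u k) \<le> B" using B by blast
  have "\<exists>r :: nat \<Rightarrow> nat. strict_mono r \<and> (\<forall>e>0. \<exists>M. \<forall>m\<ge>M. \<forall>n\<ge>M. lebesgue_norm \<Omega> q s (\<lambda>x. u (r m) x - u (r n) x) < e)"
  proof (rule cauchy_subsequence_of_small_subsequences[where d = "\<lambda>f g. lebesgue_norm \<Omega> q s (\<lambda>x. f x - g x)" and u = u])
    fix e :: real and \<sigma> :: "nat \<Rightarrow> nat" assume "0 < e"
    from small_subsequence[OF s q \<nu> _ _ this, of "\<lambda>k. u (\<sigma> k)" B] u B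
    show "\<exists>r :: nat \<Rightarrow> nat. strict_mono r \<and> (\<exists>M. \<forall>m\<ge>M. \<forall>n\<ge>M. lebesgue_norm \<Omega> q s (\<lambda>x. u (\<sigma> (r m)) x - u (\<sigma> (r n)) x) < e)"
      by simp
  qed
  then show ?thesis using u unfolding cauchy_seqs_def by simp
qed

text \<open>Convergence in a weighted Lebesgue space gives convergence almost everywhere along a
  subsequence, since the weight is positive off the origin.\<close>

lemma null_sequence_AE_subsequence:
  assumes u: "\<And>k :: nat. u k \<in> test" and s: "s < N" and q: "1 \<le> q"
    and lim: "(\<lambda>k. lebesgue_norm \<Omega> q s (u k)) \<longlonglongrightarrow> 0"
  shows "\<exists>r :: nat \<Rightarrow> nat. strict_mono r \<and> (AE x in lborel. (\<lambda>k. u (r k) x) \<longlonglongrightarrow> 0)"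
proof -
  let ?f = "\<lambda>k x. \<bar>u k x\<bar> powr q * norm x powr (- s)"
  have nn: "(\<integral>\<^sup>+x. ennreal (?f k x) \<partial>lborel) = ennreal (lebesgue_norm \<Omega> q s (u k) powr q)" for k
    using lebesgue_norm_nn_integral[OF open_domain _ _ u, of q s] q s N by simp
  have [measurable]: "u k \<in> borel_measurable borel" for k
    using test_function_bounded_support[OF u] by (auto simp: bounded_with_bounded_support_def)
  have int: "integrable lborel (?f k)" for k
    by (rule integrableI_nn_integral_finite[OF _ _ nn]) auto
  have "(\<integral>x. norm (?f k x) \<partial>lborel) = lebesgue_norm \<Omega> q s (u k) powr q" for k
  proof -
    have "(\<integral>x. norm (?f k x) \<partial>lborel) = (\<integral>x. ?f k x \<partial>lborel)" by (simp add: abs_mult)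
    also have "\<dots> = enn2real (\<integral>\<^sup>+x. ennreal (?f k x) \<partial>lborel)" by (rule integral_eq_nn_integral) auto
    finally show ?thesis unfolding nn by simp
  qed
  moreover have "(\<lambda>k. lebesgue_norm \<Omega> q s (u k) powr q) \<longlonglongrightarrow> 0 powr q"
    by (rule tendsto_powr'[OF lim tendsto_const])
       (use q in \<open>auto intro!: always_eventually simp: lebesgue_norm_weighted weighted_norm_nonneg\<close>)
  ultimately have "(\<lambda>k. \<integral>x. norm (?f k x) \<partial>lborel) \<longlonglongrightarrow> 0" by simp
  from tendsto_L1_AE_subseq[OF int this] obtain r :: "nat \<Rightarrow> nat"
    where r: "strict_mono r" "AE x in lborel. (\<lambda>k. ?f (r k) x) \<longlonglongrightarrow> 0" by blast
  have "AE x in lborel. x \<noteq> (0::real^'n)" by (rule AE_lborel_singleton)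
  with r(2) have "AE x in lborel. (\<lambda>k. u (r k) x) \<longlonglongrightarrow> 0"
  proof eventually_elim
    case (elim x)
    have "(\<lambda>k. (?f (r k) x * norm x powr s) powr (1 / q)) \<longlonglongrightarrow> (0 * norm x powr s) powr (1 / q)"
      using q by (intro tendsto_powr' tendsto_mult elim(1) tendsto_const) auto
    moreover have "(?f (r k) x * norm x powr s) powr (1 / q) = \<bar>u (r k) x\<bar>" for k
    proof -
      have "norm x powr (- s) * norm x powr s = 1" using elim(2) by (simp add: powr_add[symmetric])
      then have "?f (r k) x * norm x powr s = \<bar>u (r k) x\<bar> powr q" by (simp only: mult.assoc mult_1_right)
      then show ?thesis using q by (simp only: powr_powr) simp
    qed
    ultimately have "(\<lambda>k. \<bar>u (r k) x\<bar>) \<longlonglongrightarrow> 0" by simp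
    then show ?case by (rule tendsto_rabs_zero_cancel)
  qed
  then show ?thesis using r(1) by blast
qed

text \<open>Fatou's lemma is used twice: for \<open>k\<close> tending to infinity it turns the translation bounds
  for \<open>u - w k\<close> into one for \<open>u\<close>, and for step lengths tending to zero it turns that one into
  a bound for each partial derivative.\<close>

lemma flat_gradient_of_limit:
  assumes u: "u \<in> test" and w: "\<And>k :: nat. w k \<in> test" and lim: "AE x in lborel. (\<lambda>k. w k x) \<longlonglongrightarrow> 0"
    and E: "\<And>k. energy (\<lambda>x. u x - w k x) \<le> E"
  shows "(\<integral>\<^sup>+x. ennreal (norm (flat_gradient u x) powr p) \<partial>lborel) \<le> ennreal (N powr p * N * (flat_const * E))"
proof -
  have E0: "0 \<le> E" using E[of 0] energy_nonneg[of "\<lambda>x. u x - w 0 x"] by linarith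
  note [measurable] = punctured_C1_measurable[OF flat_punctured_C1[OF u]]
  have diff: "(\<lambda>x. u x - w k x) \<in> test" for k by (intro test_diff u w)
  note mm [measurable] = punctured_C1_measurable(1)[OF flat_punctured_C1[OF diff]]
  have inc: "(\<integral>\<^sup>+x. ennreal (\<bar>flat u (x + y) - flat u x\<bar> powr p) \<partial>lborel) \<le> ennreal (flat_const * E * norm y powr p)" for y
  proof -
    let ?g = "\<lambda>k x. ennreal (\<bar>flat (\<lambda>x. u x - w k x) (x + y) - flat (\<lambda>x. u x - w k x) x\<bar> powr p)"
    have "(\<integral>\<^sup>+x. ennreal (\<bar>flat u (x + y) - flat u x\<bar> powr p) \<partial>lborel) \<le> (\<integral>\<^sup>+x. liminf (\<lambda>k. ?g k x) \<partial>lborel)"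
    proof (rule nn_integral_mono_AE)
      show "AE x in lborel. ennreal (\<bar>flat u (x + y) - flat u x\<bar> powr p) \<le> liminf (\<lambda>k. ?g k x)"
        using lim AE_lborel_translate[OF lim, of y]
      proof eventually_elim
        case (elim x)
        have "(\<lambda>k. flat (\<lambda>x. u x - w k x) z) \<longlonglongrightarrow> flat u z" if "(\<lambda>k. w k z) \<longlonglongrightarrow> 0" for z
          unfolding flat_def using tendsto_mult[OF tendsto_const tendsto_diff[OF tendsto_const that]] by simp
        note this[OF elim(1)] this[OF elim(2)]
        then have "(\<lambda>k. ?g k x) \<longlonglongrightarrow> ennreal (\<bar>flat u (x + y) - flat u x\<bar> powr p)"
          using p by (intro tendsto_ennrealI tendsto_powr' tendsto_rabs tendsto_diff tendsto_const) auto
        from lim_imp_Liminf[OF trivial_limit_sequentially this] show ?case by (simp only: order_refl)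
      qed
    qed
    also have "\<dots> \<le> liminf (\<lambda>k. \<integral>\<^sup>+x. ?g k x \<partial>lborel)" by (rule nn_integral_liminf) measurable
    also have "\<dots> \<le> liminf (\<lambda>k::nat. ennreal (flat_const * E * norm y powr p))"
    proof (intro Liminf_mono always_eventually allI)
      fix k
      show "(\<integral>\<^sup>+x. ?g k x \<partial>lborel) \<le> ennreal (flat_const * E * norm y powr p)"
        by (rule order_trans[OF flat_translation_bound[OF diff]])
           (intro ennreal_leI mult_left_mono mult_right_mono E flat_const_nonneg, auto)
    qed
    also have "\<dots> = ennreal (flat_const * E * norm y powr p)" by (simp add: Liminf_const)
    finally show ?thesis .
  qed
  have comp: "(\<integral>\<^sup>+x. ennreal (\<bar>flat_gradient u x $ i\<bar> powr p) \<partial>lborel) \<le> ennreal (flat_const * E)" for i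
  proof -
    define t where "t j = 1 / real (Suc j)" for j
    have t: "t j > 0" for j by (simp add: t_def)
    let ?g = "\<lambda>j x. ennreal (\<bar>(flat u (x + t j *\<^sub>R axis i 1) - flat u x) / t j\<bar> powr p)"
    have "(\<integral>\<^sup>+x. ennreal (\<bar>flat_gradient u x $ i\<bar> powr p) \<partial>lborel) \<le> (\<integral>\<^sup>+x. liminf (\<lambda>j. ?g j x) \<partial>lborel)"
    proof (rule nn_integral_mono_AE)
      have "AE x in lborel. x \<noteq> (0::real^'n)" by (rule AE_lborel_singleton)
      then show "AE x in lborel. ennreal (\<bar>flat_gradient u x $ i\<bar> powr p) \<le> liminf (\<lambda>j. ?g j x)"
      proof eventually_elim
        case (elim x)
        have "(flat u has_derivative (\<lambda>h. h \<bullet> flat_gradient u x)) (at (x + 0 *\<^sub>R axis i 1))"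
          using flat_punctured_C1[OF u] elim by (simp add: punctured_C1_def gderiv_def)
        moreover have "((\<lambda>\<tau>. x + \<tau> *\<^sub>R axis i 1) has_derivative (\<lambda>h. h *\<^sub>R axis i 1)) (at 0)"
          by (auto intro!: derivative_eq_intros)
        ultimately have "((\<lambda>\<tau>. flat u (x + \<tau> *\<^sub>R axis i 1)) has_derivative (\<lambda>h. (h *\<^sub>R axis i 1) \<bullet> flat_gradient u x)) (at 0)"
          using has_derivative_compose by fast
        moreover have "(\<lambda>h. (h *\<^sub>R axis i 1) \<bullet> flat_gradient u x) = (*) (flat_gradient u x $ i)"
          by (rule ext) (simp add: inner_axis' mult.commute)
        ultimately have "((\<lambda>\<tau>. flat u (x + \<tau> *\<^sub>R axis i 1)) has_real_derivative (flat_gradient u x $ i)) (at 0)"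
          by (simp add: has_field_derivative_def)
        then have "((\<lambda>h. (flat u (x + h *\<^sub>R axis i 1) - flat u x) / h) \<longlongrightarrow> flat_gradient u x $ i) (at 0)"
          by (simp add: DERIV_def)
        moreover have "filterlim t (at 0) sequentially"
          unfolding filterlim_at using t LIMSEQ_inverse_real_of_nat
          by (auto simp: t_def[abs_def] inverse_eq_divide intro!: always_eventually)
        ultimately have "(\<lambda>j. (flat u (x + t j *\<^sub>R axis i 1) - flat u x) / t j) \<longlonglongrightarrow> flat_gradient u x $ i"
          by (rule filterlim_compose)
        then have "(\<lambda>j. ?g j x) \<longlonglongrightarrow> ennreal (\<bar>flat_gradient u x $ i\<bar> powr p)"
          using p by (intro tendsto_ennrealI tendsto_powr' tendsto_rabs tendsto_const) auto
        from lim_imp_Liminf[OF trivial_limit_sequentially this] show ?case by (simp only: order_refl)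
      qed
    qed
    also have "\<dots> \<le> liminf (\<lambda>j. \<integral>\<^sup>+x. ?g j x \<partial>lborel)" by (rule nn_integral_liminf) measurable
    also have "\<dots> \<le> liminf (\<lambda>j::nat. ennreal (flat_const * E))"
    proof (intro Liminf_mono always_eventually allI)
      fix j
      have "(\<integral>\<^sup>+x. ?g j x \<partial>lborel) = (\<integral>\<^sup>+x. ennreal (t j powr (- p)) * ennreal (\<bar>flat u (x + t j *\<^sub>R axis i 1) - flat u x\<bar> powr p) \<partial>lborel)"
      proof (intro nn_integral_cong)
        fix x
        have "\<bar>(flat u (x + t j *\<^sub>R axis i 1) - flat u x) / t j\<bar> = \<bar>flat u (x + t j *\<^sub>R axis i 1) - flat u x\<bar> / t j"
          using t[of j] by simp
        then show "?g j x = ennreal (t j powr (- p)) * ennreal (\<bar>flat u (x + t j *\<^sub>R axis i 1) - flat u x\<bar> powr p)"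
        proof -
          have "(\<bar>flat u (x + t j *\<^sub>R axis i 1) - flat u x\<bar> / t j) powr p
              = t j powr (- p) * \<bar>flat u (x + t j *\<^sub>R axis i 1) - flat u x\<bar> powr p"
            by (subst powr_divide) (use t[of j] in \<open>simp_all add: powr_minus divide_inverse mult.commute less_imp_le\<close>)
          then show ?thesis unfolding \<open>\<bar>_ / t j\<bar> = _\<close> by (simp add: ennreal_mult[symmetric])
        qed
      qed
      also have "\<dots> = ennreal (t j powr (- p)) * (\<integral>\<^sup>+x. ennreal (\<bar>flat u (x + t j *\<^sub>R axis i 1) - flat u x\<bar> powr p) \<partial>lborel)"
        by (rule nn_integral_cmult) measurable
      also have "\<dots> \<le> ennreal (t j powr (- p)) * ennreal (flat_const * E * norm (t j *\<^sub>R axis i 1 :: real^'n) powr p)"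
        by (intro mult_left_mono inc) auto
      also have "\<dots> = ennreal (flat_const * E)"
      proof -
        have "t j powr (- p) * t j powr p = 1" using t[of j] by (simp add: powr_add[symmetric])
        then have "t j powr (- p) * (flat_const * E * t j powr p) = flat_const * E" by (simp add: mult_ac)
        then show ?thesis using t[of j] flat_const_nonneg E0 by (simp add: ennreal_mult[symmetric])
      qed
      finally show "(\<integral>\<^sup>+x. ?g j x \<partial>lborel) \<le> ennreal (flat_const * E)" .
    qed
    also have "\<dots> = ennreal (flat_const * E)" by (simp add: Liminf_const)
    finally show ?thesis .
  qed
  have "(\<integral>\<^sup>+x. ennreal (norm (flat_gradient u x) powr p) \<partial>lborel)
    \<le> (\<integral>\<^sup>+x. ennreal (N powr p) * (\<Sum>i\<in>UNIV. ennreal (\<bar>flat_gradient u x $ i\<bar> powr p)) \<partial>lborel)"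
  proof (intro nn_integral_mono)
    fix x
    have "ennreal (norm (flat_gradient u x) powr p) \<le> ennreal (N powr p * (\<Sum>i\<in>UNIV. \<bar>flat_gradient u x $ i\<bar> powr p))"
      unfolding N by (intro ennreal_leI norm_powr_le_sum_components p)
    also have "\<dots> = ennreal (N powr p) * (\<Sum>i\<in>UNIV. ennreal (\<bar>flat_gradient u x $ i\<bar> powr p))"
      by (simp add: ennreal_mult sum_nonneg sum_ennreal)
    finally show "ennreal (norm (flat_gradient u x) powr p) \<le> ennreal (N powr p) * (\<Sum>i\<in>UNIV. ennreal (\<bar>flat_gradient u x $ i\<bar> powr p))" .
  qed
  also have "\<dots> = ennreal (N powr p) * (\<Sum>i\<in>UNIV. (\<integral>\<^sup>+x. ennreal (\<bar>flat_gradient u x $ i\<bar> powr p) \<partial>lborel))"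
    by (subst nn_integral_cmult, measurable) (subst nn_integral_sum, auto)
  also have "\<dots> \<le> ennreal (N powr p) * (\<Sum>i\<in>(UNIV::'n set). ennreal (flat_const * E))"
    by (intro mult_left_mono sum_mono comp) auto
  also have "\<dots> = ennreal (N powr p * N * (flat_const * E))"
    using flat_const_nonneg E0 by (simp add: N ennreal_mult ennreal_of_nat_eq_real_of_nat mult.assoc)
  finally show ?thesis .
qed

text \<open>A late member \<open>u m\<close> is Sobolev-close to all later ones, and these tend to zero almost
  everywhere along a subsequence. By \<open>flat_gradient_of_limit\<close> the Sobolev norm of \<open>u m\<close> itself
  is then small.\<close>

lemma sobolev_null_of_lebesgue_null:
  assumes u: "u \<in> cauchy_seqs test (sobolev_norm \<Omega> p \<mu>)" and s: "s < N" and q: "1 \<le> q"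
    and lim: "(\<lambda>k. lebesgue_norm \<Omega> q s (u k)) \<longlonglongrightarrow> 0"
  shows "(\<lambda>k. sobolev_norm \<Omega> p \<mu> (u k)) \<longlonglongrightarrow> 0"
proof (rule LIMSEQ_I)
  fix e :: real assume e: "0 < e"
  have uV: "u k \<in> test" for k using u by (simp add: cauchy_seqs_def)
  define C where "C = (2 powr p * (1 + \<bar>\<mu> / p\<bar> powr p * hardy_const 0)) * (N powr p * N * flat_const)"
  have C: "0 \<le> C"
    unfolding C_def using p by (intro mult_nonneg_nonneg add_nonneg_nonneg hardy_const_nonneg flat_const_nonneg) auto
  define k where "k = C powr (1 / p) + 1"
  have k: "k > 0" by (simp add: k_def add_nonneg_pos)
  define d where "d = e / 2 / k"
  have d: "d > 0" "k * d = e / 2" using e k by (simp_all add: d_def)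
  then have Cd: "C powr (1 / p) * d < e" using e by (simp add: k_def distrib_right)
  obtain M where M: "\<And>m n. m \<ge> M \<Longrightarrow> n \<ge> M \<Longrightarrow> sobolev_norm \<Omega> p \<mu> (\<lambda>x. u m x - u n x) < d"
    using u d unfolding cauchy_seqs_def by blast
  obtain r :: "nat \<Rightarrow> nat" where r: "strict_mono r" "AE x in lborel. (\<lambda>k. u (r k) x) \<longlonglongrightarrow> 0"
    using null_sequence_AE_subsequence[OF uV s q lim] by blast
  have "sobolev_norm \<Omega> p \<mu> (u m) < e" if m: "m \<ge> M" for m
  proof -
    have "(\<integral>\<^sup>+x. ennreal (norm (flat_gradient (u m) x) powr p) \<partial>lborel) \<le> ennreal (N powr p * N * (flat_const * d powr p))"
    proof (rule flat_gradient_of_limit[OF uV])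
      \<comment> \<open>The shift by \<open>M\<close> keeps all terms within distance \<open>d\<close> of \<open>u m\<close>.\<close>
      show "u (r (k + M)) \<in> test" for k by (rule uV)
      show "AE x in lborel. (\<lambda>k. u (r (k + M)) x) \<longlonglongrightarrow> 0"
        using r(2) by eventually_elim (rule LIMSEQ_ignore_initial_segment)
      show "energy (\<lambda>x. u m x - u (r (k + M)) x) \<le> d powr p" for k
      proof -
        have "M \<le> r (k + M)" using seq_suble[OF r(1), of "k + M"] by simp
        then show ?thesis
          unfolding energy_def using M[OF m] p weighted_norm_nonneg
          by (intro powr_mono2) (auto simp: sobolev_norm_weighted intro: less_imp_le)
      qed
    qed
    then have "ennreal (2 powr p * (1 + \<bar>\<mu> / p\<bar> powr p * hardy_const 0)) * (\<integral>\<^sup>+x. ennreal (norm (flat_gradient (u m) x) powr p) \<partial>lborel)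
       \<le> ennreal (2 powr p * (1 + \<bar>\<mu> / p\<bar> powr p * hardy_const 0)) * ennreal (N powr p * N * (flat_const * d powr p))"
      by (intro mult_left_mono) auto
    with energy_le_flat_gradient[OF uV[of m]]
    have "ennreal (energy (u m)) \<le> ennreal (2 powr p * (1 + \<bar>\<mu> / p\<bar> powr p * hardy_const 0)) * ennreal (N powr p * N * (flat_const * d powr p))"
      by (rule order_trans)
    also have "\<dots> = ennreal (C * d powr p)"
      unfolding C_def using p hardy_const_nonneg[of 0] flat_const_nonneg
      by (subst ennreal_mult[symmetric]) (auto simp: mult_ac simp del: abs_divide)
    finally have "energy (u m) \<le> C * d powr p" using C by simp
    then have "energy (u m) powr (1 / p) \<le> (C * d powr p) powr (1 / p)"
      by (rule powr_mono2[rotated 2]) (use p energy_nonneg in auto)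
    then have "sobolev_norm \<Omega> p \<mu> (u m) \<le> C powr (1 / p) * d"
      using p d C weighted_norm_nonneg[of \<Omega> p \<mu> "gradient (u m)"]
      by (simp add: energy_def powr_powr powr_mult sobolev_norm_weighted)
    then show ?thesis using Cd by simp
  qed
  then have "norm (sobolev_norm \<Omega> p \<mu> (u m) - 0) < e" if "m \<ge> M" for m
    using that by (simp add: sobolev_norm_weighted weighted_norm_nonneg)
  then show "\<exists>M. \<forall>m\<ge>M. norm (sobolev_norm \<Omega> p \<mu> (u m) - 0) < e" by blast
qed

lemma compact_embedding_subcritical:
  assumes s: "N * \<mu> / (N - p) \<le> s" "s \<le> \<mu> + p" and q: "1 \<le> q" "q < weighted_crit_exp N p s \<mu>"
    and \<nu>: "(\<integral>\<^sup>+x. ennreal (norm x powr (- s)) * indicator \<Omega> x \<partial>lborel) < \<infinity>"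
  shows "compact_embedding test (sobolev_norm \<Omega> p \<mu>) (lebesgue_norm \<Omega> q s)"
proof -
  have sN: "s < N" using s \<mu> by simp
  show ?thesis
    by (rule compact_embeddingI[OF sobolev_seminorm lebesgue_seminorm[OF q(1) sN]])
       (use bounded_sequence_has_cauchy_subsequence[OF s q \<nu>] sobolev_null_of_lebesgue_null[OF _ sN q(1)] in blast)+
qed

lemma weight_finite_bounded:
  assumes "bounded \<Omega>" "s < N"
  shows "(\<integral>\<^sup>+x. ennreal (norm x powr (- s)) * indicator \<Omega> x \<partial>lborel) < \<infinity>"
proof -
  obtain R where R: "\<And>x. x \<in> \<Omega> \<Longrightarrow> norm x \<le> R" using assms(1) by (auto simp: bounded_iff)
  have "(\<integral>\<^sup>+x. ennreal (norm x powr (- s)) * indicator \<Omega> x \<partial>lborel)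
     \<le> (\<integral>\<^sup>+x. ennreal (norm x powr (- s)) * indicator (cball (0::real^'n) R) x \<partial>lborel)"
    by (intro nn_integral_mono) (use R in \<open>auto split: split_indicator\<close>)
  also have "\<dots> < \<infinity>"
    by (rule nn_integral_norm_powr_ball_finite) (use assms(2) N in simp)
  finally show ?thesis .
qed

text \<open>Away from the unit ball the weight is at most one, because \<open>s\<close> is nonnegative.\<close>

lemma weight_finite_finite_measure:
  assumes "emeasure lborel \<Omega> < \<infinity>" "0 \<le> s" "s < N"
  shows "(\<integral>\<^sup>+x. ennreal (norm x powr (- s)) * indicator \<Omega> x \<partial>lborel) < \<infinity>"
proof -
  have [measurable]: "\<Omega> \<in> sets borel" "cball (0::real^'n) 1 \<in> sets borel" using open_domain by auto
  have "(\<integral>\<^sup>+x. ennreal (norm x powr (- s)) * indicator \<Omega> x \<partial>lborel)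
     \<le> (\<integral>\<^sup>+x. (ennreal (norm x powr (- s)) * indicator (cball 0 1) x + indicator \<Omega> x) \<partial>lborel)"
  proof (intro nn_integral_mono)
    fix x :: "real^'n"
    show "ennreal (norm x powr (- s)) * indicator \<Omega> x \<le> ennreal (norm x powr (- s)) * indicator (cball 0 1) x + indicator \<Omega> x"
    proof (cases "norm x \<le> 1")
      case False
      then have "norm x powr (- s) \<le> norm x powr 0" using assms(2) by (intro powr_mono) auto
      moreover have "norm x powr 0 = 1" using False by auto
      ultimately have "ennreal (norm x powr (- s)) \<le> 1" by (simp only: ennreal_le_1)
      then show ?thesis by (auto split: split_indicator)
    qed (auto split: split_indicator)
  qed
  also have "\<dots> = (\<integral>\<^sup>+x. ennreal (norm x powr (- s)) * indicator (cball (0::real^'n) 1) x \<partial>lborel) + emeasure lborel \<Omega>"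
    by (subst nn_integral_add) auto
  also have "\<dots> < \<infinity>"
    using nn_integral_norm_powr_ball_finite[of s 1, where 'a = "real^'n"] assms N by simp
  finally show ?thesis .
qed

text \<open>On a bounded set \<open>norm x powr (- s)\<close> is at most a constant times \<open>norm x powr (- s0)\<close>
  for the endpoint \<open>s0 = N * \<mu> / (N - p)\<close>, whose weighted critical exponent is the unweighted
  one.\<close>

lemma compact_embedding_weaker_weight:
  assumes bd: "bounded \<Omega>" and s: "s < N * \<mu> / (N - p)" and q: "1 \<le> q" "q < crit_exp N p"
  shows "compact_embedding test (sobolev_norm \<Omega> p \<mu>) (lebesgue_norm \<Omega> q s)"
proof -
  define s0 where "s0 = N * \<mu> / (N - p)"
  have pos: "N - p > 0" "N - p - \<mu> > 0" "p > 0" using p \<mu> by auto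
  have s0: "s0 \<le> \<mu> + p"
  proof -
    have "N * \<mu> = (\<mu> + p) * (N - p) - p * (N - p - \<mu>)" by (simp add: algebra_simps)
    also have "\<dots> \<le> (\<mu> + p) * (N - p)" using pos by simp
    finally show ?thesis using pos by (simp add: s0_def divide_le_eq)
  qed
  have crit: "crit_exp N p = weighted_crit_exp N p s0 \<mu>"
  proof -
    have "N - s0 = N * (N - p - \<mu>) / (N - p)" using pos by (simp add: s0_def field_simps)
    then show ?thesis using pos by (simp add: crit_exp_def weighted_crit_exp_def)
  qed
  have s0N: "s0 < N" and sN: "s < N" using s0 \<mu> s by (auto simp: s0_def)
  obtain R0 where R0: "\<And>x. x \<in> \<Omega> \<Longrightarrow> norm x \<le> R0" using bd by (auto simp: bounded_iff)
  define R where "R = max R0 1"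
  have R: "R > 0" "\<And>x. x \<in> \<Omega> \<Longrightarrow> norm x \<le> R" using R0 by (auto simp: R_def max.coboundedI1)
  define C where "C = (R powr (s0 - s)) powr (1 / q)"
  have C: "C > 0" using R by (simp add: C_def)
  have le: "lebesgue_norm \<Omega> q s u \<le> C * lebesgue_norm \<Omega> q s0 u" if u: "u \<in> test" for u
  proof -
    have [measurable]: "u \<in> borel_measurable borel"
      using test_function_bounded_support[OF u] by (auto simp: bounded_with_bounded_support_def)
    have "ennreal (lebesgue_norm \<Omega> q s u powr q) = (\<integral>\<^sup>+x. ennreal (\<bar>u x\<bar> powr q * norm x powr (- s)) \<partial>lborel)"
      using lebesgue_norm_nn_integral[OF open_domain _ _ u, of q s] q sN N by simp
    also have "\<dots> \<le> (\<integral>\<^sup>+x. ennreal (R powr (s0 - s)) * ennreal (\<bar>u x\<bar> powr q * norm x powr (- s0)) \<partial>lborel)"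
    proof (intro nn_integral_mono)
      fix x :: "real^'n"
      show "ennreal (\<bar>u x\<bar> powr q * norm x powr (- s)) \<le> ennreal (R powr (s0 - s)) * ennreal (\<bar>u x\<bar> powr q * norm x powr (- s0))"
      proof (cases "x \<in> \<Omega>")
        case True
        have "norm x powr (- s) = norm x powr (s0 - s) * norm x powr (- s0)" by (simp add: powr_add[symmetric])
        also have "\<dots> \<le> R powr (s0 - s) * norm x powr (- s0)"
          using R(2)[OF True] s by (intro mult_right_mono powr_mono2) (auto simp: s0_def)
        finally have "\<bar>u x\<bar> powr q * norm x powr (- s) \<le> \<bar>u x\<bar> powr q * (R powr (s0 - s) * norm x powr (- s0))"
          by (intro mult_left_mono) auto
        then show ?thesis by (simp add: ennreal_mult[symmetric] mult_ac ennreal_leI)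
      next
        case False
        then show ?thesis using test_function_zero_outside(1)[OF u] by simp
      qed
    qed
    also have "\<dots> = ennreal (R powr (s0 - s)) * (\<integral>\<^sup>+x. ennreal (\<bar>u x\<bar> powr q * norm x powr (- s0)) \<partial>lborel)"
      by (rule nn_integral_cmult) measurable
    also have "\<dots> = ennreal (R powr (s0 - s) * lebesgue_norm \<Omega> q s0 u powr q)"
      using lebesgue_norm_nn_integral[OF open_domain _ _ u, of q s0] q s0N N by (simp add: ennreal_mult)
    finally have "lebesgue_norm \<Omega> q s u powr q \<le> R powr (s0 - s) * lebesgue_norm \<Omega> q s0 u powr q" by simp
    then have "(lebesgue_norm \<Omega> q s u powr q) powr (1 / q) \<le> (R powr (s0 - s) * lebesgue_norm \<Omega> q s0 u powr q) powr (1 / q)"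
      by (rule powr_mono2[rotated 2]) (use q in auto)
    then show ?thesis
      using q weighted_norm_nonneg[of \<Omega> q s u] weighted_norm_nonneg[of \<Omega> q s0 u]
      by (simp add: powr_powr powr_mult lebesgue_norm_weighted C_def)
  qed
  have cauchy: "f \<in> cauchy_seqs test (lebesgue_norm \<Omega> q s)" if f: "f \<in> cauchy_seqs test (lebesgue_norm \<Omega> q s0)" for f
    unfolding cauchy_seqs_def mem_Collect_eq
  proof (intro conjI allI impI)
    show V: "f n \<in> test" for n using f by (simp add: cauchy_seqs_def)
    fix e :: real assume "0 < e"
    then have "e / C > 0" using C by simp
    then obtain M where M: "\<And>m n. m \<ge> M \<Longrightarrow> n \<ge> M \<Longrightarrow> lebesgue_norm \<Omega> q s0 (\<lambda>x. f m x - f n x) < e / C"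
      using f unfolding cauchy_seqs_def by blast
    show "\<exists>M. \<forall>m\<ge>M. \<forall>n\<ge>M. lebesgue_norm \<Omega> q s (\<lambda>x. f m x - f n x) < e"
    proof (intro exI[of _ M] allI impI)
      fix m n assume "M \<le> m" "M \<le> n"
      then have "C * lebesgue_norm \<Omega> q s0 (\<lambda>x. f m x - f n x) < e" using M[of m n] C by (simp add: field_simps)
      then show "lebesgue_norm \<Omega> q s (\<lambda>x. f m x - f n x) < e"
        using le[OF test_diff[OF V V], of m n] by simp
    qed
  qed
  show ?thesis
  proof (rule compact_embeddingI[OF sobolev_seminorm lebesgue_seminorm[OF q(1) sN]])
    fix u :: "nat \<Rightarrow> real^'n \<Rightarrow> real"
    assume "\<And>k. u k \<in> test" "\<exists>B. \<forall>k. sobolev_norm \<Omega> p \<mu> (u k) \<le> B"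
    with bounded_sequence_has_cauchy_subsequence[OF _ s0 q(1) _ weight_finite_bounded[OF bd s0N], of u] q(2) crit
    show "\<exists>r :: nat \<Rightarrow> nat. strict_mono r \<and> (\<lambda>k. u (r k)) \<in> cauchy_seqs test (lebesgue_norm \<Omega> q s)"
      using cauchy by (auto simp: s0_def)
  qed (rule sobolev_null_of_lebesgue_null[OF _ sN q(1)])
qed

end

theorem theorem2p1:
  fixes \<Omega> :: "(real^'n) set" and N p \<mu> s q :: real
  assumes "N = real CARD('n)" and "CARD('n) \<ge> 2"
    and "lipschitz_domain \<Omega>"
    and "1 \<le> p" and "p < N" and "\<mu> < N - p"
  shows
    "(bounded \<Omega> \<and>
        ((N * \<mu> / (N - p) \<le> s \<and> s \<le> \<mu> + p \<and> 1 \<le> q \<and> q < weighted_crit_exp N p s \<mu>) \<or>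
         (s < N * \<mu> / (N - p) \<and> 1 \<le> q \<and> q < crit_exp N p))
      \<longrightarrow> compact_embedding (test_functions \<Omega>) (sobolev_norm \<Omega> p \<mu>) (lebesgue_norm \<Omega> q s)) \<and>
     (\<not> bounded \<Omega> \<and> emeasure lborel \<Omega> < \<infinity> \<and> s \<ge> max 0 (N * \<mu> / (N - p)) \<and>
        s \<le> \<mu> + p \<and> 1 \<le> q \<and> q < weighted_crit_exp N p s \<mu>
      \<longrightarrow> compact_embedding (test_functions \<Omega>) (sobolev_norm \<Omega> p \<mu>) (lebesgue_norm \<Omega> q s))"
proof -
  interpret weighted_sobolev \<Omega> N p \<mu>
    using assms by unfold_locales (auto simp: lipschitz_domain_def)
  have sN: "s < N" if "s \<le> \<mu> + p" using that assms by simp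
  show ?thesis
    using compact_embedding_subcritical[of s q] compact_embedding_weaker_weight[of s q]
      weight_finite_bounded[of s] weight_finite_finite_measure[of s] sN by auto
qed

end
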